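(* Let $n\geq 1$ be an integer. There exist $\phi,\psi\in\mathcal O(\mathbb D^3,\mathbb D^3)\cap\mathcal C^\infty(\overline{\mathbb D}^3)$ and $\beta\in(-1,0)$ such that (i) $\mathcal E(\phi)=\mathcal E(\psi)$; (ii) for any $\xi\in\mathcal E(\phi)$ and any $\alpha\in\mathbb Z_+^3$ with $|\alpha|\leq n$, $\partial^\alpha\phi(\xi)=\partial^\alpha\psi(\xi)$; (iii) $C_\phi$ is continuous on $A^2_\beta(\mathbb D^3)$ and $C_\psi$ is not continuous on $A^2_\beta(\mathbb D^3)$.
   Context: $\mathbb D$ is the open unit disc of $\mathbb C$ and $\mathcal O(\mathbb D^3,\mathbb D^3)$ is the set of holomorphic maps $\mathbb D^3\to\mathbb D^3$. $\phi\in\mathcal C^\infty(\overline{\mathbb D}^3)$ means that $\phi$ and all its partial derivatives extend continuously to $\overline{\mathbb D}^3$ (the extensions are denoted in the same way); $\partial^\alpha$ denotes the (holomorphic) partial derivative of multi-index $\alpha$. For a map $\phi:\overline{\mathbb D}^d\to\overline{\mathbb D}^d$, $\mathcal E(\phi)=\{z\in\overline{\mathbb D}^d:\ \phi(z)\in\partial\overline{\mathbb D}^d\}$, where $\partial \overline{\mathbb D}^d$ is the topological boundary. $dA$ is the normalized area measure on $\mathbb D$; for $\beta>-1$, $dA_\beta(z)=(\beta+1)(1-|z|^2)^\beta dA(z)$ and $dV_\beta(z)=dA_\beta(z_1)\cdots dA_\beta(z_d)$ on $\mathbb D^d$. $A^2_\beta(\mathbb D^d)$ is the space of holomorphic functions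 $f:\mathbb D^d\to\mathbb C$ with $\|f\|^2=\int_{\mathbb D^d}|f|^2\,dV_\beta<+\infty$. The composition operator is $C_\phi(f)=f\circ\phi$; it is continuous on $A^2_\beta(\mathbb D^d)$ if it is a bounded operator from $A^2_\beta(\mathbb D^d)$ into itself. *)

theory Defs
  imports "HOL-Analysis.Analysis"
begin

definition polydisc :: "(complex ^ 'd) set" where
  "polydisc = {z. \<forall>i. cmod (z $ i) < 1}"

definition closed_polydisc :: "(complex ^ 'd) set" where
  "closed_polydisc = {z. \<forall>i. cmod (z $ i) \<le> 1}"


text \<open>Holomorphy in several variables: the Frechet derivative exists and is complex linear.\<close>

definition holo_on :: "(complex ^ 'd \<Rightarrow> complex) \<Rightarrow> (complex ^ 'd) set \<Rightarrow> bool" where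
  "holo_on f S \<longleftrightarrow>
     (\<forall>z\<in>S. \<exists>D. (f has_derivative D) (at z) \<and> (\<forall>c v. D (c *s v) = c * D v))"

definition holo_self_maps :: "(complex ^ 'd \<Rightarrow> complex ^ 'd) set" where
  "holo_self_maps =
     {\<phi>. (\<forall>j. holo_on (\<lambda>z. \<phi> z $ j) polydisc) \<and> \<phi> ` polydisc \<subseteq> polydisc}"


definition partial :: "'d \<Rightarrow> (complex ^ 'd \<Rightarrow> complex) \<Rightarrow> complex ^ 'd \<Rightarrow> complex" where
  "partial i f z = deriv (\<lambda>w. f (\<chi> j. if j = i then w else z $ j)) (z $ i)"

definition multi_partial ::
  "nat ^ 3 \<Rightarrow> (complex ^ 3 \<Rightarrow> complex) \<Rightarrow> complex ^ 3 \<Rightarrow> complex" where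
  "multi_partial \<alpha> f =
     (partial 1 ^^ (\<alpha> $ 1)) ((partial 2 ^^ (\<alpha> $ 2)) ((partial 3 ^^ (\<alpha> $ 3)) f))"

definition map_partial ::
  "nat ^ 3 \<Rightarrow> (complex ^ 3 \<Rightarrow> complex ^ 3) \<Rightarrow> complex ^ 3 \<Rightarrow> complex ^ 3" where
  "map_partial \<alpha> \<phi> z = (\<chi> j. multi_partial \<alpha> (\<lambda>w. \<phi> w $ j) z)"

text \<open>Maps are total functions of which only the values on the open polydisc matter. Their values on
  the closed polydisc, and those of their derivatives, are the limits from the open polydisc.\<close>

definition bdry_ext :: "(complex ^ 'd \<Rightarrow> complex ^ 'd) \<Rightarrow> complex ^ 'd \<Rightarrow> complex ^ 'd" where
  "bdry_ext g z = Lim (at z within polydisc) g"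

definition extends_continuously :: "(complex ^ 'd \<Rightarrow> complex ^ 'd) \<Rightarrow> bool" where
  "extends_continuously g \<longleftrightarrow>
     (\<exists>h. continuous_on closed_polydisc h \<and> (\<forall>z\<in>polydisc. h z = g z))"

text \<open>This is only used for holomorphic maps, all of whose real partial derivatives are, up to powers
  of the imaginary unit, holomorphic ones. The multi-index 0 accounts for the map itself.\<close>

definition smooth_up_to_boundary :: "(complex ^ 3 \<Rightarrow> complex ^ 3) set" where
  "smooth_up_to_boundary = {\<phi>. \<forall>\<alpha>. extends_continuously (map_partial \<alpha> \<phi>)}"

definition contact_set :: "(complex ^ 'd \<Rightarrow> complex ^ 'd) \<Rightarrow> (complex ^ 'd) set" where
  "contact_set \<phi> = {z \<in> closed_polydisc. bdry_ext \<phi> z \<in> frontier closed_polydisc}"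


text \<open>\<^term>\<open>uniform_measure lborel (ball 0 1)\<close> is the normalized area measure of the unit disc,
  extended by 0 to the plane.\<close>

definition disc_measure :: "real \<Rightarrow> complex measure" where
  "disc_measure \<beta> =
     density (uniform_measure lborel (ball 0 1))
       (\<lambda>z. ennreal ((\<beta> + 1) * (1 - (cmod z)\<^sup>2) powr \<beta>))"

definition polydisc_measure :: "real \<Rightarrow> (complex ^ 'd) measure" where
  "polydisc_measure \<beta> =
     distr (Pi\<^sub>M UNIV (\<lambda>_. disc_measure \<beta>)) borel vec_lambda"

lemma measurable_vec_lambda_disc_measure [measurable]:
  "vec_lambda \<in> measurable (Pi\<^sub>M UNIV (\<lambda>_::'d::finite. disc_measure \<beta>)) borel"
proof (rule borel_measurable_euclidean_space[THEN iffD2], intro ballI)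
  fix b :: "complex ^ 'd" assume "b \<in> Basis"
  have *: "sets (Pi\<^sub>M UNIV (\<lambda>_::'d. disc_measure \<beta>)) = sets (Pi\<^sub>M UNIV (\<lambda>_::'d. borel))"
    by (intro sets_PiM_cong) (auto simp: disc_measure_def)
  have "(\<lambda>f. vec_lambda f \<bullet> b) \<in> borel_measurable (Pi\<^sub>M UNIV (\<lambda>_::'d. borel))"
    unfolding inner_vec_def by simp
  then show "(\<lambda>f. vec_lambda f \<bullet> b) \<in> borel_measurable (Pi\<^sub>M UNIV (\<lambda>_::'d. disc_measure \<beta>))"
    using * measurable_cong_sets by blast
qed

definition bergman_sqnorm :: "real \<Rightarrow> (complex ^ 'd \<Rightarrow> complex) \<Rightarrow> ennreal" where
  "bergman_sqnorm \<beta> f =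
     (\<integral>\<^sup>+z\<in>polydisc. ennreal ((cmod (f z))\<^sup>2) \<partial>polydisc_measure \<beta>)"

definition bergman_space :: "real \<Rightarrow> (complex ^ 'd \<Rightarrow> complex) set" where
  "bergman_space \<beta> = {f. holo_on f polydisc \<and> bergman_sqnorm \<beta> f < \<infinity>}"

definition bergman_norm :: "real \<Rightarrow> (complex ^ 'd \<Rightarrow> complex) \<Rightarrow> real" where
  "bergman_norm \<beta> f = sqrt (enn2real (bergman_sqnorm \<beta> f))"

definition comp_op ::
  "(complex ^ 'd \<Rightarrow> complex ^ 'd) \<Rightarrow> (complex ^ 'd \<Rightarrow> complex) \<Rightarrow> complex ^ 'd \<Rightarrow> complex" where
  "comp_op \<phi> f = f \<circ> \<phi>"

definition comp_op_continuous :: "real \<Rightarrow> (complex ^ 'd \<Rightarrow> complex ^ 'd) \<Rightarrow> bool" where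
  "comp_op_continuous \<beta> \<phi> \<longleftrightarrow>
     comp_op \<phi> ` bergman_space \<beta> \<subseteq> bergman_space \<beta> \<and>
     (\<exists>C. \<forall>f\<in>bergman_space \<beta>. bergman_norm \<beta> (comp_op \<phi> f) \<le> C * bergman_norm \<beta> f)"

end

(* A function of the shape z_1 z_3 p(z_2) has modulus one on the closed tridisc exactly where
   |z_1| = |z_3| = 1 and |p(z_2)| = 1.  Take symbols (g, g, 0) with g = z_1 z_3 p(z_2) and p a polynomial
   with |p(e^{it})| = 1 - sin^{2k}(t/2).  Two exponents k < k' give the same contact set, and the difference of
   the two polynomials is divisible by (1 - z)^{2k}, so the jets at the contact points agree up to order 2k - 1.

   All norms are computed from power series.  If f(a, b, 0) = sum c_{jl} a^j b^l, then
   f(g, g, 0) = sum_m a_m g^m with a_m = sum_{j+l=m} c_{jl}.  With w_m = ||z^m||^2 (of order m^{-(1+beta)}),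
   Cauchy-Schwarz gives |a_m|^2 w_m^2 / (m+1) <= sum_{j+l=m} w_j w_l |c_{jl}|^2, hence
   ||f o (g,g,0)||^2 = sum |a_m|^2 w_m^2 ||p^m||^2 <= sup_m (m+1) ||p^m||^2 * ||f||^2.
   Conversely, testing on sum_{l=N}^{2N} z_1^{3N-l} z_2^l shows that boundedness forces N ||p^{3N}||^2 = O(1).
   Since p^m is divisible by z^m and has degree O(m), ||p^m||^2 is comparable with w_m times the mean of
   (1 - sin^{2k}(t/2))^{2m}, that is, with m^{-(1+beta)-1/(2k)}.  For beta = -1/(2k) the operator is thus bounded for
   the exponent k and unbounded for every k' > k. *)

theory Submission
  imports Defs "HOL-Complex_Analysis.Complex_Analysis" "HOL-Probability.Probability"
begin

section \<open>Rotation invariance and moments of the disc measure\<close>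

text \<open>The shape of the symbol is a balance of losses. Composition with (g, g, 0) sees only the
  diagonal of f(a, b, 0), and Cauchy-Schwarz on an antidiagonal of m + 1 coefficients loses a factor
  m + 1. The variables z_1 and z_3 contribute one w_m each, matching w_m^2 <= w_j w_l, which holds
  because the moments decrease. What is left is m + 1 against ||p^m||^2, so z_2 alone decides. As
  (m+1) m^{-(1+beta)-1/(2k)} has order m^{-beta-1/(2k)}, boundedness means beta >= -1/(2k): the
  threshold is negative and moves up with k, so the threshold of k fails for every larger exponent.
  The source of p is the identity -(1-z)^2/4 = z sin^2(t/2) at z = e^{it}: up to unimodular factors,
  a real function on the circle becomes a polynomial, and smoothness up to the boundary comes with
  it. The test functions keep to exponents between N and 2N because there w_j w_l is comparable with
  w_N^2, so that Cauchy-Schwarz loses at most a constant.\<close>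

lemma measurable_Complex [measurable]: "(\<lambda>p::real \<times> real. Complex (fst p) (snd p)) \<in> borel_measurable borel"
proof -
  have "continuous_on UNIV (\<lambda>p::real \<times> real. Complex (fst p) (snd p))"
    by (intro continuous_intros)
  then show ?thesis
    by (rule borel_measurable_continuous_onI)
qed

text \<open>Lebesgue measure is determined by its values on boxes, and a box in
  \<open>complex\<close> is a product of two intervals. This opens Tonelli in Cartesian coordinates
  for the shears below.\<close>

lemma lborel_complex_eq:
  "(lborel :: complex measure) = distr (lborel \<Otimes>\<^sub>M lborel) borel (\<lambda>p. Complex (fst p) (snd p))"
proof (rule lborel_eqI)
  fix l u :: complex
  assume "\<And>b. b \<in> Basis \<Longrightarrow> l \<bullet> b \<le> u \<bullet> b"
  then have le: "Re l \<le> Re u" "Im l \<le> Im u"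
    by (force simp: Basis_complex_def)+
  have eq: "(\<lambda>p. Complex (fst p) (snd p)) -` box l u = box (Re l) (Re u) \<times> box (Im l) (Im u)"
    by (auto simp: box_def Basis_complex_def)
  have m: "(\<lambda>p. Complex (fst p) (snd p)) \<in> lborel \<Otimes>\<^sub>M lborel \<rightarrow>\<^sub>M borel"
    unfolding lborel_prod by simp
  have "emeasure (distr (lborel \<Otimes>\<^sub>M lborel) borel (\<lambda>p. Complex (fst p) (snd p))) (box l u)
     = emeasure (lborel \<Otimes>\<^sub>M lborel) (box (Re l) (Re u) \<times> box (Im l) (Im u))"
    by (subst emeasure_distr[OF m]) (simp_all add: eq space_pair_measure)
  also have "\<dots> = ennreal (Re u - Re l) * ennreal (Im u - Im l)"
    using le by (subst lborel.emeasure_pair_measure_Times) auto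
  also have "\<dots> = (\<Prod>b\<in>Basis. (u - l) \<bullet> b)"
    using le by (simp add: Basis_complex_def ennreal_mult complex_eq_iff)
  finally show "emeasure (distr (lborel \<Otimes>\<^sub>M lborel) borel (\<lambda>p. Complex (fst p) (snd p))) (box l u)
      = (\<Prod>b\<in>Basis. (u - l) \<bullet> b)" .
qed simp

lemma nn_integral_lborel_complex:
  assumes [measurable]: "f \<in> borel_measurable borel"
  shows "(\<integral>\<^sup>+z. f z \<partial>lborel) = (\<integral>\<^sup>+x. \<integral>\<^sup>+y. f (Complex x y) \<partial>lborel \<partial>lborel)"
    and "(\<integral>\<^sup>+z. f z \<partial>lborel) = (\<integral>\<^sup>+y. \<integral>\<^sup>+x. f (Complex x y) \<partial>lborel \<partial>lborel)"
proof -
  have m [measurable]: "(\<lambda>p. Complex (fst p) (snd p)) \<in> lborel \<Otimes>\<^sub>M lborel \<rightarrow>\<^sub>M borel"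
    unfolding lborel_prod by simp
  have f: "(\<lambda>p. f (Complex (fst p) (snd p))) \<in> borel_measurable (lborel \<Otimes>\<^sub>M lborel)"
    by measurable
  have "(\<integral>\<^sup>+z. f z \<partial>lborel) = (\<integral>\<^sup>+p. f (Complex (fst p) (snd p)) \<partial>(lborel \<Otimes>\<^sub>M lborel))"
    by (subst lborel_complex_eq, subst nn_integral_distr) auto
  also have "\<dots> = (\<integral>\<^sup>+x. \<integral>\<^sup>+y. f (Complex x y) \<partial>lborel \<partial>lborel)"
    by (subst lborel.nn_integral_fst[OF f, symmetric]) simp
  finally show "(\<integral>\<^sup>+z. f z \<partial>lborel) = (\<integral>\<^sup>+x. \<integral>\<^sup>+y. f (Complex x y) \<partial>lborel \<partial>lborel)" .
  also have "\<dots> = (\<integral>\<^sup>+y. \<integral>\<^sup>+x. f (Complex x y) \<partial>lborel \<partial>lborel)"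
    by (subst lborel_pair.Fubini'[symmetric]) (use f in \<open>auto simp: split_beta'\<close>)
  finally show "(\<integral>\<^sup>+z. f z \<partial>lborel) = (\<integral>\<^sup>+y. \<integral>\<^sup>+x. f (Complex x y) \<partial>lborel \<partial>lborel)" .
qed

lemma nn_integral_lborel_translate:
  fixes f :: "real \<Rightarrow> ennreal"
  assumes [measurable]: "f \<in> borel_measurable borel"
  shows "(\<integral>\<^sup>+x. f (c + x) \<partial>lborel) = (\<integral>\<^sup>+x. f x \<partial>lborel)"
  by (subst lborel_distr_plus[of c, symmetric], subst nn_integral_distr) auto

text \<open>A shear translates each horizontal (or vertical) line by an amount that depends only on
  the line, so Tonelli and translation invariance suffice.\<close>

lemma nn_integral_lborel_shear:
  assumes [measurable]: "f \<in> borel_measurable borel"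
  shows "(\<integral>\<^sup>+z. f (z + of_real (a * Im z)) \<partial>lborel) = (\<integral>\<^sup>+z. f z \<partial>lborel)"
    and "(\<integral>\<^sup>+z. f (z + \<i> * of_real (a * Re z)) \<partial>lborel) = (\<integral>\<^sup>+z. f z \<partial>lborel)"
proof -
  have [measurable]: "(\<lambda>x. Complex x y) \<in> borel_measurable borel" "Complex y \<in> borel_measurable borel" for y
    by (intro borel_measurable_continuous_onI continuous_intros)+
  have "(\<integral>\<^sup>+z. f (z + of_real (a * Im z)) \<partial>lborel) = (\<integral>\<^sup>+y. \<integral>\<^sup>+x. f (Complex (a * y + x) y) \<partial>lborel \<partial>lborel)"
    by (subst nn_integral_lborel_complex(2)) (auto simp: Complex_eq algebra_simps)
  also have "\<dots> = (\<integral>\<^sup>+y. \<integral>\<^sup>+x. f (Complex x y) \<partial>lborel \<partial>lborel)"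
    by (subst nn_integral_lborel_translate) simp_all
  finally show "(\<integral>\<^sup>+z. f (z + of_real (a * Im z)) \<partial>lborel) = (\<integral>\<^sup>+z. f z \<partial>lborel)"
    by (subst nn_integral_lborel_complex(2)) auto
  have "(\<integral>\<^sup>+z. f (z + \<i> * of_real (a * Re z)) \<partial>lborel) = (\<integral>\<^sup>+x. \<integral>\<^sup>+y. f (Complex x (a * x + y)) \<partial>lborel \<partial>lborel)"
    by (subst nn_integral_lborel_complex(1)) (auto simp: Complex_eq algebra_simps)
  also have "\<dots> = (\<integral>\<^sup>+x. \<integral>\<^sup>+y. f (Complex x y) \<partial>lborel \<partial>lborel)"
    by (subst nn_integral_lborel_translate) simp_all
  finally show "(\<integral>\<^sup>+z. f (z + \<i> * of_real (a * Re z)) \<partial>lborel) = (\<integral>\<^sup>+z. f z \<partial>lborel)"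
    by (subst nn_integral_lborel_complex(1)) auto
qed

text \<open>A rotation by an angle other than \<open>\<pi>\<close> is a product of three shears; the general case follows
  by taking a square root.\<close>

lemma nn_integral_lborel_rotate:
  assumes [measurable]: "f \<in> borel_measurable borel" and "cmod c = 1"
  shows "(\<integral>\<^sup>+z. f (c * z) \<partial>lborel) = (\<integral>\<^sup>+z. f z \<partial>lborel)"
proof -
  have *: "(\<integral>\<^sup>+z. g (d * z) \<partial>lborel) = (\<integral>\<^sup>+z. g z \<partial>lborel)"
    if [measurable]: "g \<in> borel_measurable borel" and d: "cmod d = 1" "d \<noteq> -1"
    for d and g :: "complex \<Rightarrow> ennreal"
  proof -
    define S T where "S = (\<lambda>a z. z + complex_of_real (a * Im z))"
      and "T = (\<lambda>a z. z + \<i> * complex_of_real (a * Re z))"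
    have [measurable]: "S a \<in> borel_measurable borel" "T a \<in> borel_measurable borel" for a
      unfolding S_def T_def by measurable
    have r: "(Re d)\<^sup>2 + (Im d)\<^sup>2 = 1"
      using d by (simp add: cmod_def)
    have "1 + Re d \<noteq> 0"
    proof
      assume "1 + Re d = 0"
      then have "Re d = -1" by simp
      with r have "Im d = 0" by simp
      with \<open>Re d = -1\<close> d show False by (simp add: complex_eq_iff)
    qed
    \<comment> \<open>For d = e^{i theta} this is -tan(theta/2). The rotation is the horizontal
      shear by \<open>a\<close>, then the vertical shear by sin theta, then the horizontal shear by
      \<open>a\<close> again.\<close>
    define a where "a = - Im d / (1 + Re d)"
    have a1: "a * (1 + Re d) = - Im d"
      using \<open>1 + Re d \<noteq> 0\<close> by (simp add: a_def)
    have "a * Im d * (1 + Re d) = (Re d - 1) * (1 + Re d)"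
      using a1 r by algebra
    then have a2: "a * Im d = Re d - 1"
      using \<open>1 + Re d \<noteq> 0\<close> by simp
    have a3: "2 * a + a * a * Im d = - Im d"
      using a1 a2 by algebra
    have rot: "d * z = S a (T (Im d) (S a z))" for z
    proof (rule complex_eqI)
      have "Re (S a (T (Im d) (S a z))) = Re z * (1 + a * Im d) + Im z * (2 * a + a * a * Im d)"
        by (simp add: S_def T_def algebra_simps)
      then show "Re (d * z) = Re (S a (T (Im d) (S a z)))"
        by (simp add: a2 a3)
      have "Im (S a (T (Im d) (S a z))) = Im z * (1 + a * Im d) + Im d * Re z"
        by (simp add: S_def T_def algebra_simps)
      then show "Im (d * z) = Im (S a (T (Im d) (S a z)))"
        by (simp add: a2)
    qed
    have "(\<integral>\<^sup>+z. g (d * z) \<partial>lborel) = (\<integral>\<^sup>+z. g (S a (T (Im d) (S a z))) \<partial>lborel)"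
      by (simp only: rot)
    also have "\<dots> = (\<integral>\<^sup>+z. g (S a (T (Im d) z)) \<partial>lborel)"
      using nn_integral_lborel_shear(1)[of "\<lambda>z. g (S a (T (Im d) z))" a] by (simp add: S_def)
    also have "\<dots> = (\<integral>\<^sup>+z. g (S a z) \<partial>lborel)"
      using nn_integral_lborel_shear(2)[of "\<lambda>z. g (S a z)" "Im d"] by (simp add: T_def)
    also have "\<dots> = (\<integral>\<^sup>+z. g z \<partial>lborel)"
      using nn_integral_lborel_shear(1)[of g a] by (simp add: S_def)
    finally show ?thesis .
  qed
  \<comment> \<open>The principal root has nonnegative real part, so it is never -1, and rotating by
    it twice gives \<open>c\<close>.\<close>
  define d where "d = csqrt c"
  have d: "d * d = c" "cmod d = 1" "d \<noteq> -1"
  proof -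
    have "0 \<le> Re d"
      using csqrt_principal[of c] by (auto simp: d_def)
    then show "d \<noteq> -1" by auto
    show "d * d = c"
      by (simp add: d_def power2_eq_square[symmetric])
    then show "cmod d = 1"
      using assms(2) by (simp add: d_def norm_csqrt)
  qed
  have "(\<integral>\<^sup>+z. f (c * z) \<partial>lborel) = (\<integral>\<^sup>+z. f (d * (d * z)) \<partial>lborel)"
    by (simp add: d(1)[symmetric] mult.assoc)
  also have "\<dots> = (\<integral>\<^sup>+z. f (d * z) \<partial>lborel)"
    using *[of "\<lambda>z. f (d * z)" d] d by simp
  also have "\<dots> = (\<integral>\<^sup>+z. f z \<partial>lborel)"
    using *[of f d] d by simp
  finally show ?thesis .
qed

text \<open>For x in [0, 1] the points with |z|^2 <= x fill, up to the boundary circle, a disc of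
  area pi x, so both distribution functions are x there. Radial integrals thereby become Beta
  integrals.\<close>

lemma cmod_power2_uniform_distr:
  "distr (uniform_measure lborel (ball 0 1)) borel (\<lambda>z::complex. (cmod z)\<^sup>2)
    = uniform_measure lborel {0..1::real}"
proof (rule cdf_unique)
  have e: "emeasure lborel (ball 0 1 :: complex set) = ennreal pi"
    by (simp add: emeasure_ball unit_ball_vol_2)
  interpret U: prob_space "uniform_measure lborel (ball 0 1 :: complex set)"
    by (rule prob_space_uniform_measure) (auto simp: e)
  interpret V: prob_space "uniform_measure lborel {0..1::real}"
    by (rule prob_space_uniform_measure) auto
  interpret D: prob_space "distr (uniform_measure lborel (ball 0 1)) borel (\<lambda>z::complex. (cmod z)\<^sup>2)"
    by (rule U.prob_space_distr) simp
  show "real_distribution (distr (uniform_measure lborel (ball 0 1)) borel (\<lambda>z::complex. (cmod z)\<^sup>2))"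
    by standard auto
  show "real_distribution (uniform_measure lborel {0..1::real})"
    by standard auto
  show "cdf (distr (uniform_measure lborel (ball 0 1)) borel (\<lambda>z::complex. (cmod z)\<^sup>2))
     = cdf (uniform_measure lborel {0..1})"
  proof
    fix x :: real
    have "cdf (distr (uniform_measure lborel (ball 0 1)) borel (\<lambda>z::complex. (cmod z)\<^sup>2)) x
      = measure lborel (ball 0 1 \<inter> {z::complex. (cmod z)\<^sup>2 \<le> x}) / pi"
      unfolding cdf_def
      by (subst measure_distr) (simp_all add: e vimage_def measure_uniform_measure content_ball unit_ball_vol_2)
    also have "\<dots> = measure lborel ({0..1} \<inter> {..x})"
    proof -
      consider "x < 0" | "0 \<le> x" "x < 1" | "1 \<le> x" by linarith
      then show ?thesis
      proof cases
        case 1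
        then have "\<not> (cmod z)\<^sup>2 \<le> x" for z
          using zero_le_power2[of "cmod z"] by linarith
        then have "ball 0 1 \<inter> {z::complex. (cmod z)\<^sup>2 \<le> x} = {}"
          by auto
        moreover have "{0..1} \<inter> {..x} = {}"
          using 1 by auto
        ultimately show ?thesis by simp
      next
        case 2
        have "ball 0 1 \<inter> {z::complex. (cmod z)\<^sup>2 \<le> x} = cball 0 (sqrt x)"
        proof -
          have "cmod z < 1" if "(cmod z)\<^sup>2 \<le> x" for z :: complex
            using that 2 abs_square_less_1[of "cmod z"] by simp
          then have "z \<in> ball 0 1 \<inter> {z. (cmod z)\<^sup>2 \<le> x} \<longleftrightarrow> z \<in> cball 0 (sqrt x)" for z :: complex
            unfolding mem_cball_0 using 2 real_le_rsqrt[of "cmod z" x] sqrt_ge_absD[of "cmod z" x]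
            by auto
          then show ?thesis by blast
        qed
        moreover have "{0..1} \<inter> {..x} = {0..x}"
          using 2 by auto
        ultimately show ?thesis
          using 2 by (simp add: content_cball unit_ball_vol_2)
      next
        case 3
        have "(cmod z)\<^sup>2 \<le> x" if "cmod z < 1" for z :: complex
          using that 3 power_le_one[of "cmod z" 2] by simp
        then have "ball 0 1 \<inter> {z::complex. (cmod z)\<^sup>2 \<le> x} = ball 0 1"
          by auto
        moreover have "{0..1} \<inter> {..x} = {0..1}"
          using 3 by auto
        ultimately show ?thesis
          by (simp add: content_ball unit_ball_vol_2)
      qed
    qed
    also have "\<dots> = cdf (uniform_measure lborel {0..1}) x"
      unfolding cdf_def by simp
    finally show "cdf (distr (uniform_measure lborel (ball 0 1)) borel (\<lambda>z::complex. (cmod z)\<^sup>2)) x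
      = cdf (uniform_measure lborel {0..1}) x" .
  qed
qed


section \<open>The weighted disc measure: density, moments and their size\<close>

lemma sets_disc_measure [simp, measurable_cong]: "sets (disc_measure \<beta>) = sets borel"
  and space_disc_measure [simp]: "space (disc_measure \<beta>) = UNIV"
  by (simp_all add: disc_measure_def)

lemma emeasure_unit_disc: "emeasure lborel (ball 0 1 :: complex set) = ennreal pi"
  by (simp add: emeasure_ball unit_ball_vol_2)

lemma nn_integral_disc_measure:
  assumes [measurable]: "f \<in> borel_measurable borel"
  shows "(\<integral>\<^sup>+z. f z \<partial>disc_measure \<beta>) =
    (\<integral>\<^sup>+z. ennreal ((\<beta> + 1) * (1 - (cmod z)\<^sup>2) powr \<beta>) * f z \<partial>uniform_measure lborel (ball 0 1))"
  unfolding disc_measure_def by (subst nn_integral_density) auto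

lemma AE_disc_measure: "AE z in disc_measure \<beta>. cmod z < 1"
proof -
  have "AE z in uniform_measure lborel (ball 0 1). cmod z < 1"
    by (rule AE_uniform_measureI) auto
  then show ?thesis
    unfolding disc_measure_def by (subst AE_density) auto
qed

lemma nn_integral_disc_measure_rotate:
  assumes [measurable]: "f \<in> borel_measurable borel" and c: "cmod c = 1"
  shows "(\<integral>\<^sup>+z. f (c * z) \<partial>disc_measure \<beta>) = (\<integral>\<^sup>+z. f z \<partial>disc_measure \<beta>)"
proof -
  define g where "g z = ennreal ((\<beta> + 1) * (1 - (cmod z)\<^sup>2) powr \<beta>) * f z * indicator (ball 0 1) z" for z
  have [measurable]: "ball 0 1 \<in> sets (borel :: complex measure)"
    by simp
  have [measurable]: "g \<in> borel_measurable borel"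
    unfolding g_def by simp
  have "(\<integral>\<^sup>+z. f (c * z) \<partial>disc_measure \<beta>) = (\<integral>\<^sup>+z. g (c * z) \<partial>lborel) / ennreal pi"
    by (subst nn_integral_disc_measure, simp, subst nn_integral_uniform_measure)
       (auto simp: emeasure_unit_disc g_def norm_mult c indicator_def intro!: nn_integral_cong arg_cong2[where f="(/)"])
  also have "\<dots> = (\<integral>\<^sup>+z. g z \<partial>lborel) / ennreal pi"
    using nn_integral_lborel_rotate[of g c] c by simp
  also have "\<dots> = (\<integral>\<^sup>+z. f z \<partial>disc_measure \<beta>)"
    by (subst nn_integral_disc_measure, simp, subst nn_integral_uniform_measure)
       (auto simp: emeasure_unit_disc g_def[abs_def])
  finally show ?thesis .
qed

text \<open>This is the w_m of the overview: |z|^2 is uniform on [0, 1] under normalized area, which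
  turns the squared norm of z^m into a Beta integral.\<close>

definition disc_moment :: "real \<Rightarrow> nat \<Rightarrow> real" where
  "disc_moment \<beta> m = (\<beta> + 1) * Beta (real m + 1) (\<beta> + 1)"

lemma nn_integral_disc_moment:
  assumes "\<beta> > -1"
  shows "(\<integral>\<^sup>+z. ennreal (cmod z ^ (2 * m)) \<partial>disc_measure \<beta>) = ennreal (disc_moment \<beta> m)"
proof -
  define g where "g x = ennreal ((\<beta> + 1) * (1 - x) powr \<beta>) * ennreal (x ^ m)" for x
  have [measurable]: "g \<in> borel_measurable borel"
    unfolding g_def by measurable
  have "(\<integral>\<^sup>+z. ennreal (cmod z ^ (2 * m)) \<partial>disc_measure \<beta>)
    = (\<integral>\<^sup>+z. g ((cmod z)\<^sup>2) \<partial>uniform_measure lborel (ball 0 1))"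
    by (subst nn_integral_disc_measure) (auto simp: g_def power_mult)
  also have "\<dots> = (\<integral>\<^sup>+x. g x \<partial>uniform_measure lborel {0..1::real})"
    by (subst cmod_power2_uniform_distr[symmetric], subst nn_integral_distr) auto
  also have "\<dots> = (\<integral>\<^sup>+x. g x * indicator {0..1} x \<partial>lborel)"
    by (subst nn_integral_uniform_measure) (auto simp: divide_ennreal_def)
  \<comment> \<open>For m = 0 the two integrands differ at x = 0, since \<open>0 ^ 0\<close> is 1
    but \<open>0 powr 0\<close> is 0; that point is discarded as a null set.\<close>
  also have "\<dots> = (\<integral>\<^sup>+x. ennreal (indicator {0..1} x * ((\<beta> + 1) * (x powr (real m + 1 - 1) * (1 - x) powr (\<beta> + 1 - 1)))) \<partial>lborel)"
    using assms
    by (intro nn_integral_cong_AE, use AE_lborel_singleton[of "0::real"] in eventually_elim)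
       (auto simp: g_def indicator_def powr_realpow ennreal_mult'[symmetric] mult_ac)
  also have "\<dots> = ennreal (disc_moment \<beta> m)"
    unfolding disc_moment_def using assms
    by (intro nn_integral_has_integral_lebesgue has_integral_mult_right has_integral_Beta_real) auto
  finally show ?thesis .
qed

lemma disc_moment_0 [simp]: "\<beta> > -1 \<Longrightarrow> disc_moment \<beta> 0 = 1"
proof -
  assume b: "\<beta> > -1"
  then have "\<beta> + 1 \<notin> \<int>\<^sub>\<le>\<^sub>0"
    using nonpos_Ints_nonpos[of "\<beta> + 1"] by auto
  then have "Gamma (1 + (\<beta> + 1)) = (\<beta> + 1) * Gamma (\<beta> + 1)"
    using Gamma_plus1[of "\<beta> + 1"] by (simp add: add_ac)
  moreover have "Gamma (\<beta> + 1) \<noteq> 0"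
    by (rule less_imp_neq[symmetric, OF Gamma_real_pos]) (use b in simp)
  ultimately show ?thesis
    using b by (simp add: disc_moment_def Beta_def)
qed

lemma disc_moment_Suc:
  assumes "\<beta> > -1"
  shows "disc_moment \<beta> (Suc m) = disc_moment \<beta> m * (real (Suc m) / (real (Suc m) + (\<beta> + 1)))"
proof -
  have "(real m + 1) \<notin> \<int>\<^sub>\<le>\<^sub>0"
    by (auto elim!: nonpos_Ints_cases)
  from Beta_plus1_left[OF this, of "\<beta> + 1"] assms show ?thesis
    by (simp add: disc_moment_def field_simps)
qed

lemma disc_moment_pos:
  assumes "\<beta> > -1"
  shows "disc_moment \<beta> m > 0"
  using assms by (induction m) (auto simp: disc_moment_Suc intro!: mult_pos_pos divide_pos_pos)

lemma prob_space_disc_measure: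
  assumes "\<beta> > -1"
  shows "prob_space (disc_measure \<beta>)"
  using nn_integral_disc_moment[OF assms, of 0] assms by (intro prob_spaceI) simp

lemma disc_moment_antimono:
  assumes "\<beta> > -1" "m \<le> n"
  shows "disc_moment \<beta> n \<le> disc_moment \<beta> m"
proof (rule lift_Suc_antimono_le[OF _ assms(2)])
  fix k
  show "disc_moment \<beta> (Suc k) \<le> disc_moment \<beta> k"
    using assms(1) disc_moment_pos[OF assms(1), of k]
    unfolding disc_moment_Suc[OF assms(1)] by (intro mult_left_le) auto
qed

text \<open>Induction through the ratio x/(x+b) with x = m + 1 and b = beta + 1. Weighted
  arithmetic-geometric mean gives (1 + 1/x)^b <= 1 + b/x, which is where b <= 1 enters.\<close>

lemma disc_moment_upper:
  assumes "\<beta> > -1" "\<beta> \<le> 0"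
  shows "disc_moment \<beta> m \<le> real (Suc m) powr (- (\<beta> + 1))"
proof (induction m)
  case (Suc m)
  define b where "b = \<beta> + 1"
  define x where "x = real (Suc m)"
  have b: "0 < b" "b \<le> 1" and x: "0 < x"
    using assms by (auto simp: b_def x_def)
  have "(1 + 1 / x) powr b * 1 powr (1 - b) \<le> b * (1 + 1 / x) + (1 - b) * 1"
    using b x by (intro Youngs_inequality_0) (auto intro: add_pos_pos)
  then have "(1 + 1 / x) powr b \<le> 1 + b * (1 / x)"
    by (simp add: algebra_simps)
  then have "((x + 1) / x) powr b \<le> (x + b) / x"
    using x by (simp add: field_simps)
  then have "inverse ((x + b) / x) \<le> inverse (((x + 1) / x) powr b)"
    using b x by (intro le_imp_inverse_le) auto
  then have "x powr (-b) * (x / (x + b)) \<le> x powr (-b) * (x powr b / (x + 1) powr b)"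
    using x by (intro mult_left_mono) (auto simp: powr_divide)
  moreover have "x powr (-b) * (x powr b / (x + 1) powr b) = (x + 1) powr (-b)"
    using x by (simp add: powr_minus divide_inverse)
  ultimately have *: "x powr (-b) * (x / (x + b)) \<le> (x + 1) powr (-b)"
    by simp
  have "disc_moment \<beta> (Suc m) = disc_moment \<beta> m * (x / (x + b))"
    using assms by (simp add: disc_moment_Suc x_def b_def)
  also have "\<dots> \<le> x powr (-b) * (x / (x + b))"
    using Suc b x by (intro mult_right_mono) (auto simp: x_def b_def)
  also note *
  finally show ?case
    by (simp add: x_def b_def add.commute)
qed (use assms in simp)

text \<open>The reverse ratio estimate follows from ln(1 + 1/x) >= 1/(x+1) and exp y >= 1 + y. The
  factor 1/2 is fixed by the start m = 1, where the moment is 1/(beta+2).\<close>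

lemma disc_moment_lower:
  assumes "\<beta> > -1" "\<beta> \<le> 0" "m \<ge> 1"
  shows "disc_moment \<beta> m \<ge> real m powr (- (\<beta> + 1)) / 2"
  using assms(3)
proof (induction m rule: dec_induct)
  case base
  have "1 / 2 \<le> 1 / (\<beta> + 2)"
    using assms by (intro divide_left_mono) auto
  then show ?case using disc_moment_Suc[of \<beta> 0] assms by (simp add: add.commute)
next
  case (step m)
  define b where "b = \<beta> + 1"
  define x where "x = real m"
  have b: "0 < b" "b \<le> 1" and x: "1 \<le> x"
    using assms step by (auto simp: b_def x_def)
  have "1 / (x + 1) \<le> ln ((x + 1) / x)"
  proof -
    have "ln (x / (x + 1)) \<le> x / (x + 1) - 1"
      using x by (intro ln_le_minus_one) auto
    then show ?thesis
      using x by (simp add: ln_div field_simps)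
  qed
  then have "b * (1 / (x + 1)) \<le> b * ln ((x + 1) / x)"
    using b by (intro mult_left_mono) auto
  then have "exp (b / (x + 1)) \<le> ((x + 1) / x) powr b"
    using x by (simp add: powr_def)
  moreover have "1 + b / (x + 1) \<le> exp (b / (x + 1))"
    by (rule exp_ge_add_one_self)
  moreover have "(x + 1 + b) / (x + 1) = 1 + b / (x + 1)"
    using x by (simp add: field_simps)
  ultimately have "(x + 1 + b) / (x + 1) \<le> ((x + 1) / x) powr b"
    by linarith
  then have "inverse (((x + 1) / x) powr b) \<le> inverse ((x + 1 + b) / (x + 1))"
    using b x by (intro le_imp_inverse_le) auto
  then have "x powr (-b) * (x powr b / (x + 1) powr b) \<le> x powr (-b) * ((x + 1) / (x + 1 + b))"
    using x by (intro mult_left_mono) (auto simp: powr_divide)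
  moreover have "x powr (-b) * (x powr b / (x + 1) powr b) = (x + 1) powr (-b)"
    using x by (simp add: powr_minus divide_inverse)
  ultimately have *: "(x + 1) powr (-b) \<le> x powr (-b) * ((x + 1) / (x + 1 + b))"
    by simp
  have "(x + 1) powr (-b) / 2 \<le> x powr (-b) / 2 * ((x + 1) / (x + 1 + b))"
    unfolding times_divide_eq_left by (intro divide_right_mono *) simp
  also have "\<dots> \<le> disc_moment \<beta> m * ((x + 1) / (x + 1 + b))"
    using step.IH b x by (intro mult_right_mono) (auto simp: x_def b_def)
  also have "\<dots> = disc_moment \<beta> (Suc m)"
    using assms by (simp add: disc_moment_Suc x_def b_def add_ac)
  finally show ?case
    by (simp add: x_def b_def add.commute)
qed

section \<open>Parseval's identity on the circle and on the disc\<close>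

lemma has_bochner_integral_cis_int:
  "has_bochner_integral lborel (\<lambda>t. indicator {0..2*pi} t *\<^sub>R cis (of_int k * t)) (if k = 0 then of_real (2 * pi) else 0)"
proof (cases "k = 0")
  case True
  have "has_bochner_integral lborel (\<lambda>t. indicator {0..2*pi} t *\<^sub>R (1::complex)) (of_real (2 * pi) - of_real 0)"
    by (rule has_bochner_integral_FTC_Icc) (auto intro!: derivative_eq_intros)
  with True show ?thesis by simp
next
  case False
  define F where "F t = cis (of_int k * t) / (\<i> * of_int k)" for t
  have c: "cis (of_int k * t) = exp (\<i> * (of_int k * of_real t))" for t
    by (simp add: cis_conv_exp)
  have "has_bochner_integral lborel (\<lambda>t. indicator {0..2*pi} t *\<^sub>R cis (of_int k * t)) (F (2 * pi) - F 0)"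
  proof (rule has_bochner_integral_FTC_Icc)
    show "(F has_vector_derivative cis (of_int k * t)) (at t within {0..2 * pi})" for t
      unfolding F_def c using False
      by (auto intro!: has_vector_derivative_real_field derivative_eq_intros simp: mult.commute[of _ \<i>])
    show "continuous_on {0..2 * pi} (\<lambda>t. cis (of_int k * t))"
      by (intro continuous_intros)
  qed simp
  moreover have "F (2 * pi) = F 0"
    unfolding F_def using cis_multiple_2pi[of "of_int k"] by (simp add: mult_ac)
  ultimately show ?thesis using False by simp
qed

lemma circle_parseval_finite:
  fixes c :: "nat \<Rightarrow> complex"
  shows "has_bochner_integral lborel
    (\<lambda>t. indicator {0..2*pi} t * (cmod (\<Sum>j<N. c j * cis (real j * t)))\<^sup>2) (2 * pi * (\<Sum>j<N. (cmod (c j))\<^sup>2))"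
proof -
  have expand: "complex_of_real ((cmod (\<Sum>j<N. c j * cis (real j * t)))\<^sup>2)
      = (\<Sum>j<N. \<Sum>l<N. (c j * cnj (c l)) * cis (of_int (int j - int l) * t))" for t
  proof -
    have "complex_of_real ((cmod (\<Sum>j<N. c j * cis (real j * t)))\<^sup>2)
      = (\<Sum>j<N. c j * cis (real j * t)) * cnj (\<Sum>l<N. c l * cis (real l * t))"
      by (rule complex_norm_square)
    also have "\<dots> = (\<Sum>j<N. \<Sum>l<N. (c j * cis (real j * t)) * (cnj (c l) * cis (- (real l * t))))"
      by (simp add: cnj_sum sum_product cis_cnj)
    also have "\<dots> = (\<Sum>j<N. \<Sum>l<N. (c j * cnj (c l)) * cis (of_int (int j - int l) * t))"
    proof (intro sum.cong refl)
      fix j l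
      have "cis (of_int (int j - int l) * t) = cis (real j * t) * cis (- (real l * t))"
        by (simp add: cis_mult algebra_simps)
      then show "(c j * cis (real j * t)) * (cnj (c l) * cis (- (real l * t)))
        = (c j * cnj (c l)) * cis (of_int (int j - int l) * t)"
        by simp
    qed
    finally show ?thesis .
  qed
  have "has_bochner_integral lborel
    (\<lambda>t. \<Sum>j<N. \<Sum>l<N. (c j * cnj (c l)) * (indicator {0..2*pi} t *\<^sub>R cis (of_int (int j - int l) * t)))
    (\<Sum>j<N. \<Sum>l<N. (c j * cnj (c l)) * (if int j - int l = 0 then of_real (2 * pi) else 0))"
    by (intro has_bochner_integral_sum has_bochner_integral_mult_right has_bochner_integral_cis_int)
  also have "(\<lambda>t. \<Sum>j<N. \<Sum>l<N. (c j * cnj (c l)) * (indicator {0..2*pi} t *\<^sub>R cis (of_int (int j - int l) * t)))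
    = (\<lambda>t. complex_of_real (indicator {0..2*pi} t * (cmod (\<Sum>j<N. c j * cis (real j * t)))\<^sup>2))"
    unfolding of_real_mult expand
    by (auto simp: fun_eq_iff sum_distrib_left indicator_def)
  also have "(\<Sum>j<N. \<Sum>l<N. (c j * cnj (c l)) * (if int j - int l = 0 then of_real (2 * pi) else 0))
    = complex_of_real (2 * pi * (\<Sum>j<N. (cmod (c j))\<^sup>2))"
  proof -
    have "(\<Sum>l<N. (c j * cnj (c l)) * (if int j - int l = 0 then of_real (2 * pi) else 0))
      = of_real (2 * pi) * of_real ((cmod (c j))\<^sup>2)" if "j < N" for j
    proof -
      have "(\<Sum>l<N. (c j * cnj (c l)) * (if int j - int l = 0 then of_real (2 * pi) else 0))
        = (\<Sum>l<N. if j = l then c j * cnj (c l) * of_real (2 * pi) else 0)"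
        by (intro sum.cong) auto
      then show ?thesis
        using that by (simp add: complex_norm_square[symmetric] mult_ac)
    qed
    then show ?thesis
      by (simp add: sum_distrib_left)
  qed
  finally show ?thesis
    by (auto dest: has_bochner_integral_bounded_linear[OF bounded_linear_Re])
qed

text \<open>Absolute summability bounds all partial sums by one constant, so the finite identity
  passes to the limit by dominated convergence.\<close>

lemma circle_parseval:
  fixes c :: "nat \<Rightarrow> complex"
  assumes sm: "summable (\<lambda>j. cmod (c j))"
  shows "(\<integral>\<^sup>+t. ennreal ((cmod (\<Sum>j. c j * cis (real j * t)))\<^sup>2) * indicator {0..2*pi} t \<partial>lborel)
    = ennreal (2 * pi) * (\<Sum>j. ennreal ((cmod (c j))\<^sup>2))"
proof -
  define S where "S N t = (\<Sum>j<N. c j * cis (real j * t))" for N t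
  define S' where "S' t = (\<Sum>j. c j * cis (real j * t))" for t
  define B where "B = (\<Sum>j. cmod (c j))"
  have meas [measurable]: "S N \<in> borel_measurable borel" for N
    unfolding S_def by (intro borel_measurable_continuous_onI continuous_intros)
  have lim: "(\<lambda>N. S N t) \<longlonglongrightarrow> S' t" for t
    unfolding S_def S'_def using sm
    by (intro summable_LIMSEQ summable_norm_cancel[where f="\<lambda>j. c j * cis (real j * t)"]) (simp add: norm_mult)
  have [measurable]: "S' \<in> borel_measurable borel"
    by (rule borel_measurable_LIMSEQ_metric[OF meas lim])
  have bound: "cmod (S N t) \<le> B" for N t
  proof -
    have "cmod (S N t) \<le> (\<Sum>j<N. cmod (c j))"
      unfolding S_def by (intro order_trans[OF norm_sum] sum_mono) (simp add: norm_mult)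
    also have "\<dots> \<le> B"
      unfolding B_def using sm by (intro sum_le_suminf) auto
    finally show ?thesis .
  qed
  have "(\<lambda>N. (LINT t|lborel. indicator {0..2*pi} t * (cmod (S N t))\<^sup>2))
      \<longlonglongrightarrow> (LINT t|lborel. indicator {0..2*pi} t * (cmod (S' t))\<^sup>2)"
    and int: "integrable lborel (\<lambda>t. indicator {0..2*pi} t * (cmod (S' t))\<^sup>2)"
  proof -
    have w: "integrable lborel (\<lambda>t::real. indicator {0..2*pi} t *\<^sub>R B\<^sup>2)"
      by (rule integrable_scaleR_left) (auto simp: integrable_indicator_iff)
    have b: "AE t in lborel. norm (indicator {0..2*pi} t * (cmod (S N t))\<^sup>2) \<le> indicator {0..2*pi} t *\<^sub>R B\<^sup>2" for N
      using bound by (auto intro!: AE_I2 mult_left_mono power_mono simp: indicator_def)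
    have l: "AE t in lborel. (\<lambda>N. indicator {0..2*pi} t * (cmod (S N t))\<^sup>2) \<longlonglongrightarrow> indicator {0..2*pi} t * (cmod (S' t))\<^sup>2"
      by (intro AE_I2 tendsto_intros lim)
    show "(\<lambda>N. (LINT t|lborel. indicator {0..2*pi} t * (cmod (S N t))\<^sup>2))
      \<longlonglongrightarrow> (LINT t|lborel. indicator {0..2*pi} t * (cmod (S' t))\<^sup>2)"
      by (rule integral_dominated_convergence[OF _ _ w l b]) auto
    show "integrable lborel (\<lambda>t. indicator {0..2*pi} t * (cmod (S' t))\<^sup>2)"
      by (rule integrable_dominated_convergence[OF _ _ w l b]) auto
  qed
  moreover have "(LINT t|lborel. indicator {0..2*pi} t * (cmod (S N t))\<^sup>2) = 2 * pi * (\<Sum>j<N. (cmod (c j))\<^sup>2)" for N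
    unfolding S_def using circle_parseval_finite by (rule has_bochner_integral_integral_eq)
  ultimately have "(\<lambda>N. 2 * pi * (\<Sum>j<N. (cmod (c j))\<^sup>2)) \<longlonglongrightarrow> (LINT t|lborel. indicator {0..2*pi} t * (cmod (S' t))\<^sup>2)"
    by simp
  then have "(\<lambda>N. ennreal (2 * pi * (\<Sum>j<N. (cmod (c j))\<^sup>2))) \<longlonglongrightarrow> ennreal (LINT t|lborel. indicator {0..2*pi} t * (cmod (S' t))\<^sup>2)"
    by (rule tendsto_ennrealI)
  moreover have "(\<lambda>N. ennreal (2 * pi * (\<Sum>j<N. (cmod (c j))\<^sup>2))) \<longlonglongrightarrow> ennreal (2 * pi) * (\<Sum>j. ennreal ((cmod (c j))\<^sup>2))"
    by (simp add: ennreal_mult sum_nonneg sum_ennreal[symmetric] del: sum_ennreal)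
       (intro ennreal_tendsto_cmult summable_LIMSEQ, auto simp: ennreal_mult_less_top)
  ultimately have "ennreal (LINT t|lborel. indicator {0..2*pi} t * (cmod (S' t))\<^sup>2) = ennreal (2 * pi) * (\<Sum>j. ennreal ((cmod (c j))\<^sup>2))"
    by (rule LIMSEQ_unique)
  moreover have "(\<integral>\<^sup>+t. ennreal ((cmod (S' t))\<^sup>2) * indicator {0..2*pi} t \<partial>lborel)
     = (\<integral>\<^sup>+t. ennreal (indicator {0..2*pi} t * (cmod (S' t))\<^sup>2) \<partial>lborel)"
    by (intro nn_integral_cong) (auto simp: indicator_def)
  moreover have "\<dots> = ennreal (LINT t|lborel. indicator {0..2*pi} t * (cmod (S' t))\<^sup>2)"
    by (intro nn_integral_eq_integral int) auto
  ultimately show ?thesis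
    unfolding S'_def by simp
qed

text \<open>Rotation invariance takes the place of polar coordinates: average |h(e^{it} z)|^2 over
  t, exchange the integrals, and apply the circle identity for each fixed z. All values lie in
  \<open>ennreal\<close>, so functions of infinite norm are covered.\<close>

lemma disc_parseval:
  assumes \<beta>: "\<beta> > -1" and [measurable]: "h \<in> borel_measurable borel"
    and h: "\<And>z. cmod z < 1 \<Longrightarrow> (\<lambda>j. a j * z ^ j) sums h z"
  shows "(\<integral>\<^sup>+z. ennreal ((cmod (h z))\<^sup>2) \<partial>disc_measure \<beta>)
    = (\<Sum>j. ennreal ((cmod (a j))\<^sup>2) * ennreal (disc_moment \<beta> j))"
proof -
  interpret P: prob_space "disc_measure \<beta>"
    by (rule prob_space_disc_measure[OF \<beta>])
  have [measurable]: "cis \<in> borel_measurable borel"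
    by (intro borel_measurable_continuous_onI continuous_intros)
  interpret pair_sigma_finite "disc_measure \<beta>" lborel ..
  let ?I = "(\<integral>\<^sup>+z. ennreal ((cmod (h z))\<^sup>2) \<partial>disc_measure \<beta>)"
  have "ennreal (2 * pi) * ?I = (\<integral>\<^sup>+t. ?I * indicator {0..2*pi} t \<partial>lborel)"
    by (subst nn_integral_cmult) (auto simp: mult.commute)
  also have "\<dots> = (\<integral>\<^sup>+t. (\<integral>\<^sup>+z. ennreal ((cmod (h (cis t * z)))\<^sup>2) * indicator {0..2*pi} t \<partial>disc_measure \<beta>) \<partial>lborel)"
  proof (intro nn_integral_cong)
    fix t :: real
    have "?I = (\<integral>\<^sup>+z. ennreal ((cmod (h (cis t * z)))\<^sup>2) \<partial>disc_measure \<beta>)"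
      by (rule nn_integral_disc_measure_rotate[symmetric]) auto
    then show "?I * indicator {0..2*pi} t = (\<integral>\<^sup>+z. ennreal ((cmod (h (cis t * z)))\<^sup>2) * indicator {0..2*pi} t \<partial>disc_measure \<beta>)"
      by (subst nn_integral_multc) auto
  qed
  also have "\<dots> = (\<integral>\<^sup>+z. (\<integral>\<^sup>+t. ennreal ((cmod (h (cis t * z)))\<^sup>2) * indicator {0..2*pi} t \<partial>lborel) \<partial>disc_measure \<beta>)"
    by (rule Fubini') auto
  also have "\<dots> = (\<integral>\<^sup>+z. ennreal (2 * pi) * (\<Sum>j. ennreal ((cmod (a j))\<^sup>2) * ennreal (cmod z ^ (2 * j))) \<partial>disc_measure \<beta>)"
  proof (intro nn_integral_cong_AE, use AE_disc_measure[of \<beta>] in eventually_elim)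
    fix z assume z: "cmod z < 1"
    \<comment> \<open>A point of modulus strictly between |z| and 1: convergence there forces
      absolute convergence at z.\<close>
    define w where "w = complex_of_real ((1 + cmod z) / 2)"
    have w: "cmod w < 1" "cmod z < cmod w"
      using z by (auto simp: w_def simp del: of_real_add of_real_divide)
    have sm: "summable (\<lambda>j. cmod (a j * z ^ j))"
      using powser_insidea[OF sums_summable[OF h[OF w(1)]] w(2)] .
    have eq: "h (cis t * z) = (\<Sum>j. (a j * z ^ j) * cis (real j * t))" for t
    proof -
      have "(\<lambda>j. a j * (cis t * z) ^ j) sums h (cis t * z)"
        using z by (intro h) (simp add: norm_mult)
      moreover have "a j * (cis t * z) ^ j = (a j * z ^ j) * cis (real j * t)" for j
        by (simp add: power_mult_distrib Complex.DeMoivre)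
      ultimately show ?thesis
        by (simp add: sums_iff)
    qed
    show "(\<integral>\<^sup>+t. ennreal ((cmod (h (cis t * z)))\<^sup>2) * indicator {0..2*pi} t \<partial>lborel)
      = ennreal (2 * pi) * (\<Sum>j. ennreal ((cmod (a j))\<^sup>2) * ennreal (cmod z ^ (2 * j)))"
      unfolding eq circle_parseval[OF sm]
      by (simp add: norm_mult norm_power power_mult_distrib power_mult[symmetric] mult.commute ennreal_mult'[symmetric])
  qed
  also have "\<dots> = ennreal (2 * pi) * (\<Sum>j. ennreal ((cmod (a j))\<^sup>2) * ennreal (disc_moment \<beta> j))"
    by (simp add: nn_integral_cmult nn_integral_suminf nn_integral_disc_moment[OF \<beta>])
  finally show ?thesis
    by (subst (asm) ennreal_mult_cancel_left) auto
qed

section \<open>Double power series on the bidisc\<close>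

lemma continuous_on_contour_integral_linepath:
  fixes G :: "complex \<Rightarrow> complex \<Rightarrow> complex"
  assumes "continuous_on (closed_segment u v \<times> S) (\<lambda>(w, b). G w b)"
  shows "continuous_on S (\<lambda>b. contour_integral (linepath u v) (\<lambda>w. G w b))"
proof -
  have "continuous_on (S \<times> cbox 0 1) (\<lambda>(b, t). G (linepath u v t) b * (v - u))"
  proof -
    have "continuous_on (S \<times> cbox 0 1) (\<lambda>x. (linepath u v (snd x), fst x))"
      by (auto simp: linepath_def intro!: continuous_intros)
    from continuous_on_compose2[OF assms this]
    have "continuous_on (S \<times> cbox 0 1) (\<lambda>x. G (linepath u v (snd x)) (fst x))"
      by (simp add: image_subset_iff linepath_in_path)
    then have "continuous_on (S \<times> cbox 0 1) (\<lambda>x. G (linepath u v (snd x)) (fst x) * (v - u))"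
      by (rule continuous_on_mult_right)
    then show ?thesis
      by (simp add: split_beta')
  qed
  then have "continuous_on S (\<lambda>b. integral (cbox 0 1) (\<lambda>t. G (linepath u v t) b * (v - u)))"
    by (rule integral_continuous_on_param)
  then show ?thesis
    by (simp add: contour_integral_integral)
qed

text \<open>Cauchy's formula writes the coefficient as a contour integral of g(a, b) / b^{l+1} over
  b. It is continuous in a, and its integral over a triangle in a vanishes once the two contour
  integrals are exchanged, so Morera's theorem applies.\<close>

lemma holomorphic_on_taylor_coeff:
  fixes g :: "complex \<Rightarrow> complex \<Rightarrow> complex"
  assumes cont: "continuous_on (ball 0 1 \<times> ball 0 1) (\<lambda>(a, b). g a b)"
    and hol1: "\<And>b. cmod b < 1 \<Longrightarrow> (\<lambda>a. g a b) holomorphic_on ball 0 1"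
    and hol2: "\<And>a. cmod a < 1 \<Longrightarrow> g a holomorphic_on ball 0 1"
  shows "(\<lambda>a. (deriv ^^ l) (g a) 0 / fact l) holomorphic_on ball 0 1"
proof -
  define \<gamma> where "\<gamma> = circlepath 0 (1/2)"
  define G where "G a b = g a b / b ^ Suc l" for a b
  have pi: "path_image \<gamma> = sphere 0 (1/2)"
    by (simp add: \<gamma>_def path_image_circlepath_nonneg)
  have contG: "continuous_on (ball 0 1 \<times> path_image \<gamma>) (\<lambda>(a, b). G a b)"
    unfolding G_def split_beta'
    by (intro continuous_intros continuous_on_subset[OF cont[unfolded split_beta']]) (auto simp: pi)
  have vd: "vector_derivative \<gamma> (at t) = pi * \<i> * exp (2 * of_real pi * \<i> * t)" for t
    by (simp add: \<gamma>_def vector_derivative_circlepath)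
  have vp: "valid_path \<gamma>"
    by (simp add: \<gamma>_def)
  define h where "h a = contour_integral \<gamma> (G a)" for a
  have coeff: "(deriv ^^ l) (g a) 0 / fact l = h a / (2 * pi * \<i>)" if "a \<in> ball 0 1" for a
  proof -
    have "g a holomorphic_on cball 0 (1/2)"
      by (rule holomorphic_on_subset[OF hol2]) (use that in auto)
    then have "contour_integral \<gamma> (\<lambda>u. g a u / (u - 0) ^ Suc l) = (2 * pi * \<i>) * (deriv ^^ l) (g a) 0 / fact l"
      unfolding \<gamma>_def
      by (intro Cauchy_contour_integral_circlepath holomorphic_on_imp_continuous_on)
         (auto intro: holomorphic_on_subset)
    then show ?thesis
      by (simp add: h_def G_def[abs_def])
  qed
  have conth: "continuous_on (ball 0 1) h"
  proof -
    have "continuous_on (ball 0 1 \<times> cbox 0 1) (\<lambda>(a, t). G a (\<gamma> t) * vector_derivative \<gamma> (at t))"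
    proof -
      have "continuous_on {0..1} \<gamma>"
        using path_circlepath[of 0 "1/2"] by (simp add: \<gamma>_def path_def)
      then have "continuous_on (ball 0 1 \<times> cbox 0 1) (\<lambda>x. \<gamma> (snd x))"
        by (rule continuous_on_compose2[OF _ continuous_on_snd[OF continuous_on_id]]) auto
      then have "continuous_on (ball 0 1 \<times> cbox 0 1) (\<lambda>x. (fst x, \<gamma> (snd x)))"
        by (rule continuous_on_Pair[OF continuous_on_fst[OF continuous_on_id]])
      from continuous_on_compose2[OF contG this]
      have "continuous_on (ball 0 1 \<times> cbox 0 1) (\<lambda>x. G (fst x) (\<gamma> (snd x)))"
        by (simp add: path_image_def image_subset_iff)
      moreover have "continuous_on (ball 0 1 \<times> cbox 0 1)
          (\<lambda>x :: complex \<times> real. pi * \<i> * exp (2 * of_real pi * \<i> * of_real (snd x)))"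
        by (intro continuous_intros)
      ultimately have "continuous_on (ball 0 1 \<times> cbox 0 1) (\<lambda>x :: complex \<times> real. G (fst x) (\<gamma> (snd x)) * (pi * \<i> * exp (2 * of_real pi * \<i> * snd x)))"
        by (rule continuous_on_mult)
      then show ?thesis
        unfolding split_beta' vd .
    qed
    then have "continuous_on (ball 0 1) (\<lambda>a. integral (cbox 0 1) (\<lambda>t. G a (\<gamma> t) * vector_derivative \<gamma> (at t)))"
      by (rule integral_continuous_on_param)
    then show ?thesis
      by (simp add: contour_integral_integral h_def[abs_def])
  qed
  have "h analytic_on ball 0 1"
  proof (rule Morera_triangle[OF conth open_ball], intro impI)
    fix a b c :: complex
    assume sub: "convex hull {a, b, c} \<subseteq> ball 0 1"
    define I where "I u v z = contour_integral (linepath u v) (\<lambda>w. G w z)" for u v z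
    have seg: "closed_segment a b \<subseteq> ball 0 1" "closed_segment b c \<subseteq> ball 0 1" "closed_segment c a \<subseteq> ball 0 1"
      using sub by (auto simp: segment_convex_hull intro!: order_trans[OF hull_mono sub])
    have swap: "contour_integral (linepath u v) h = contour_integral \<gamma> (I u v)"
      and intI: "I u v contour_integrable_on \<gamma>"
      if "closed_segment u v \<subseteq> ball 0 1" for u v
    proof -
      have c: "continuous_on (closed_segment u v \<times> path_image \<gamma>) (\<lambda>(a, b). G a b)"
        by (rule continuous_on_subset[OF contG]) (use that in auto)
      show "contour_integral (linepath u v) h = contour_integral \<gamma> (I u v)"
        unfolding h_def[abs_def] I_def[abs_def]
        by (rule contour_integral_swap) (use c vp in \<open>auto simp: vd intro!: continuous_intros\<close>)
      show "I u v contour_integrable_on \<gamma>"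
        using continuous_on_contour_integral_linepath[OF c] unfolding I_def[abs_def] \<gamma>_def
        by (rule contour_integrable_continuous_circlepath)
    qed
    \<comment> \<open>For a fixed z on the circle the division by z^{l+1} is harmless, so the
      integrand is holomorphic in w and Cauchy's theorem holds on the triangle before the
      integration over the circle.\<close>
    have zero: "I a b z + I b c z + I c a z = 0" if "z \<in> path_image \<gamma>" for z
    proof -
      have "(\<lambda>w. G w z) holomorphic_on ball 0 1"
        unfolding G_def using that by (intro holomorphic_intros hol1) (auto simp: pi)
      then have "(\<lambda>w. G w z) holomorphic_on convex hull {a, b, c}"
        by (rule holomorphic_on_subset[OF _ sub])
      then have 0: "((\<lambda>w. G w z) has_contour_integral 0) (linepath a b +++ linepath b c +++ linepath c a)"
        by (rule Cauchy_theorem_triangle)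
      have "(\<lambda>w. G w z) contour_integrable_on linepath u v" if "closed_segment u v \<subseteq> ball 0 1" for u v
        using \<open>(\<lambda>w. G w z) holomorphic_on ball 0 1\<close> that
        by (intro contour_integrable_continuous_linepath holomorphic_on_imp_continuous_on)
           (rule holomorphic_on_subset)
      with seg contour_integral_unique[OF 0] show ?thesis
        by (simp add: I_def add.assoc)
    qed
    have "contour_integral (linepath a b) h + contour_integral (linepath b c) h + contour_integral (linepath c a) h
      = contour_integral \<gamma> (\<lambda>z. I a b z + I b c z + I c a z)"
      using seg by (simp add: swap intI contour_integral_add contour_integrable_add)
    also have "\<dots> = contour_integral \<gamma> (\<lambda>z. 0)"
      by (rule contour_integral_eq) (rule zero)
    finally show "contour_integral (linepath a b) h + contour_integral (linepath b c) h + contour_integral (linepath c a) h = 0"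
      by simp
  qed
  then have "(\<lambda>a. h a / (2 * pi * \<i>)) holomorphic_on ball 0 1"
    by (intro holomorphic_intros analytic_imp_holomorphic) auto
  then show ?thesis
    by (rule holomorphic_transform) (simp add: coeff)
qed

lemma abs_summable_on_product_UNIV:
  fixes A B :: "nat \<Rightarrow> real"
  assumes "summable A" "summable B" "\<And>n. A n \<ge> 0" "\<And>n. B n \<ge> 0"
  shows "(\<lambda>(l, j). norm (A l * B j)) summable_on UNIV \<times> UNIV"
proof -
  have A: "A summable_on UNIV" and B: "B summable_on UNIV"
    using assms by (auto intro!: norm_summable_imp_summable_on)
  have "(\<lambda>j. norm (A l * B j)) summable_on UNIV" for l
    using summable_on_cmult_right[OF B, of "A l"] assms by (simp add: abs_mult)
  moreover have "(\<lambda>l. norm (infsum (\<lambda>j. norm (A l * B j)) UNIV)) summable_on UNIV"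
    using summable_on_cmult_left[OF A, of "infsum B UNIV"] assms B
    by (simp add: abs_mult infsum_cmult_right infsum_nonneg)
  ultimately show ?thesis
    using Infinite_Sum.abs_summable_on_Sigma_iff[where f="\<lambda>(l, j). A l * B j" and A=UNIV and B="\<lambda>_. UNIV"] by (simp add: split_beta')
qed

text \<open>A crude bound, uniform in beta and valid at j = 0; its purpose is polynomial growth of
  Taylor coefficients.\<close>

lemma disc_moment_ge:
  assumes "\<beta> > -1" "\<beta> \<le> 0"
  shows "disc_moment \<beta> j \<ge> 1 / (2 * real (Suc j))"
proof (cases "j = 0")
  case False
  then have "1 / (2 * real (Suc j)) \<le> 1 / (2 * real j)"
    by (intro divide_left_mono) auto
  also have "\<dots> = real j powr (-1) / 2"
    using False by (simp add: powr_minus_divide)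
  also have "\<dots> \<le> real j powr (- (\<beta> + 1)) / 2"
    using assms False by (intro divide_right_mono powr_mono) auto
  also have "\<dots> \<le> disc_moment \<beta> j"
    using False assms by (intro disc_moment_lower) auto
  finally show ?thesis .
qed (use assms in simp)

text \<open>Models g(a, b) = f(a, b, 0). Joint continuity, which Frechet differentiability of f
  supplies, feeds the contour integrals for the coefficients; \<open>\<beta> \<le> 0\<close> feeds
  the lower bound on the moments.\<close>

locale bidisc_holomorphic =
  fixes g :: "complex \<Rightarrow> complex \<Rightarrow> complex" and \<beta> :: real
  assumes cont: "continuous_on (ball 0 1 \<times> ball 0 1) (\<lambda>(a, b). g a b)"
    and hol1: "\<And>b. cmod b < 1 \<Longrightarrow> (\<lambda>a. g a b) holomorphic_on ball 0 1"
    and hol2: "\<And>a. cmod a < 1 \<Longrightarrow> g a holomorphic_on ball 0 1"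
    and \<beta>: "-1 < \<beta>" "\<beta> \<le> 0"
begin

definition C :: "nat \<Rightarrow> complex \<Rightarrow> complex" where
  "C l a = (deriv ^^ l) (g a) 0 / fact l"

text \<open>The coefficient of a^j b^l: the expansion in b is taken first, then \<open>C l\<close>
  is expanded in a.\<close>

definition c :: "nat \<Rightarrow> nat \<Rightarrow> complex" where
  "c j l = (deriv ^^ j) (C l) 0 / fact j"

definition sqnorm :: ennreal where
  "sqnorm = (\<integral>\<^sup>+a. \<integral>\<^sup>+b. ennreal ((cmod (g a b))\<^sup>2) * indicator (ball 0 1 \<times> ball 0 1) (a, b)
    \<partial>disc_measure \<beta> \<partial>disc_measure \<beta>)"

lemma C_holomorphic: "C l holomorphic_on ball 0 1"
  using holomorphic_on_taylor_coeff[OF cont hol1 hol2, of l] by (simp add: C_def[abs_def])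

lemma C_sums: "cmod a < 1 \<Longrightarrow> cmod b < 1 \<Longrightarrow> (\<lambda>l. C l a * b ^ l) sums g a b"
  using holomorphic_power_series[OF hol2, of a b] by (simp add: C_def)

lemma c_sums: "cmod a < 1 \<Longrightarrow> (\<lambda>j. c j l * a ^ j) sums C l a"
  using holomorphic_power_series[OF C_holomorphic, of a l] by (simp add: c_def)

lemma sqnorm_eq:
  "sqnorm = (\<Sum>l. (\<Sum>j. ennreal ((cmod (c j l))\<^sup>2) * ennreal (disc_moment \<beta> j)) * ennreal (disc_moment \<beta> l))"
proof -
  \<comment> \<open>Extension by zero off the open disc or bidisc yields Borel functions on the
    whole plane without changing the integrals.\<close>
  define G where "G a b = (if (a, b) \<in> ball 0 1 \<times> ball 0 1 then g a b else 0)" for a b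
  define C' where "C' l a = (if a \<in> ball 0 1 then C l a else 0)" for l a
  have G: "(\<lambda>x. if x \<in> ball 0 1 \<times> ball 0 1 then (case x of (a, b) \<Rightarrow> g a b) else 0) \<in> borel_measurable borel"
    by (intro borel_measurable_continuous_on_if cont) (auto intro!: borel_open open_Times)
  have G_meas [measurable]: "G a \<in> borel_measurable borel" for a
    using measurable_compose[OF _ G, of "Pair a" borel] by (simp add: G_def[abs_def] cong: if_cong)
  have C'_meas [measurable]: "C' l \<in> borel_measurable borel" for l
    unfolding C'_def
    by (intro borel_measurable_continuous_on_if holomorphic_on_imp_continuous_on C_holomorphic) auto
  have "sqnorm = (\<integral>\<^sup>+a. \<integral>\<^sup>+b. ennreal ((cmod (G a b))\<^sup>2) \<partial>disc_measure \<beta> \<partial>disc_measure \<beta>)"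
    unfolding sqnorm_def by (intro nn_integral_cong) (auto simp: G_def indicator_def)
  also have "\<dots> = (\<integral>\<^sup>+a. (\<Sum>l. ennreal ((cmod (C' l a))\<^sup>2) * ennreal (disc_moment \<beta> l)) \<partial>disc_measure \<beta>)"
  proof (intro nn_integral_cong_AE, use AE_disc_measure[of \<beta>] in eventually_elim)
    fix a :: complex assume a: "cmod a < 1"
    have "(\<integral>\<^sup>+b. ennreal ((cmod (G a b))\<^sup>2) \<partial>disc_measure \<beta>)
      = (\<Sum>l. ennreal ((cmod (C l a))\<^sup>2) * ennreal (disc_moment \<beta> l))"
      using a by (intro disc_parseval \<beta> G_meas) (simp add: G_def C_sums)
    then show "(\<integral>\<^sup>+b. ennreal ((cmod (G a b))\<^sup>2) \<partial>disc_measure \<beta>)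
      = (\<Sum>l. ennreal ((cmod (C' l a))\<^sup>2) * ennreal (disc_moment \<beta> l))"
      using a by (simp add: C'_def)
  qed
  also have "\<dots> = (\<Sum>l. (\<integral>\<^sup>+a. ennreal ((cmod (C' l a))\<^sup>2) \<partial>disc_measure \<beta>) * ennreal (disc_moment \<beta> l))"
    by (subst nn_integral_suminf) (auto simp: nn_integral_multc)
  also have "\<dots> = (\<Sum>l. (\<Sum>j. ennreal ((cmod (c j l))\<^sup>2) * ennreal (disc_moment \<beta> j)) * ennreal (disc_moment \<beta> l))"
  proof -
    have "(\<integral>\<^sup>+a. ennreal ((cmod (C' l a))\<^sup>2) \<partial>disc_measure \<beta>)
      = (\<Sum>j. ennreal ((cmod (c j l))\<^sup>2) * ennreal (disc_moment \<beta> j))" for l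
      by (rule disc_parseval[OF \<beta>(1) C'_meas]) (simp add: C'_def c_sums)
    then show ?thesis by simp
  qed
  finally show ?thesis .
qed

lemma term_le_sqnorm:
  "ennreal ((cmod (c j l))\<^sup>2 * disc_moment \<beta> j * disc_moment \<beta> l) \<le> sqnorm"
proof -
  have "ennreal ((cmod (c j l))\<^sup>2 * disc_moment \<beta> j * disc_moment \<beta> l)
    = ennreal ((cmod (c j l))\<^sup>2) * ennreal (disc_moment \<beta> j) * ennreal (disc_moment \<beta> l)"
    using disc_moment_pos[OF \<beta>(1), of j] disc_moment_pos[OF \<beta>(1), of l] by (simp add: ennreal_mult)
  also have "\<dots> \<le> (\<Sum>j. ennreal ((cmod (c j l))\<^sup>2) * ennreal (disc_moment \<beta> j)) * ennreal (disc_moment \<beta> l)"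
    using sum_le_suminf[of "\<lambda>j. ennreal ((cmod (c j l))\<^sup>2) * ennreal (disc_moment \<beta> j)" "{j}"]
    by (intro mult_right_mono) auto
  also have "\<dots> \<le> sqnorm"
    unfolding sqnorm_eq
    using sum_le_suminf[of "\<lambda>l. (\<Sum>j. ennreal ((cmod (c j l))\<^sup>2) * ennreal (disc_moment \<beta> j)) * ennreal (disc_moment \<beta> l)" "{l}"]
    by auto
  finally show ?thesis .
qed

text \<open>One term of a nonnegative double series is at most its sum, and the moments decay no
  faster than 1/j. Such slow growth makes the double series converge absolutely inside the
  bidisc.\<close>

lemma coeff_bound:
  assumes "sqnorm < \<infinity>"
  shows "cmod (c j l) \<le> 2 * sqrt (enn2real sqnorm) * (real (Suc j) * real (Suc l))"
proof -
  let ?E = "enn2real sqnorm"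
  let ?P = "real (Suc j) * real (Suc l)"
  have "(cmod (c j l))\<^sup>2 * disc_moment \<beta> j * disc_moment \<beta> l \<le> ?E"
    using term_le_sqnorm[of j l] assms disc_moment_pos[OF \<beta>(1)]
    by (subst ennreal_le_iff[symmetric]) (auto simp: less_top[symmetric])
  moreover have "(cmod (c j l))\<^sup>2 * (1 / (2 * real (Suc j))) * (1 / (2 * real (Suc l)))
      \<le> (cmod (c j l))\<^sup>2 * disc_moment \<beta> j * disc_moment \<beta> l"
    using disc_moment_ge[OF \<beta>] disc_moment_pos[OF \<beta>(1)]
    by (intro mult_mono mult_left_mono) (auto intro!: mult_nonneg_nonneg simp: less_imp_le simp del: of_nat_Suc)
  ultimately have "(cmod (c j l))\<^sup>2 * (1 / (2 * real (Suc j))) * (1 / (2 * real (Suc l))) \<le> ?E"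
    by linarith
  then have "(cmod (c j l))\<^sup>2 \<le> 4 * ?E * ?P"
    by (simp add: field_simps del: of_nat_Suc)
  \<comment> \<open>The product of the two indices is at least 1, so squaring it only weakens the
    bound and makes the right side a perfect square.\<close>
  also have "\<dots> \<le> 4 * ?E * ?P\<^sup>2"
  proof -
    have "1 * 1 \<le> ?P"
      by (intro mult_mono) auto
    then have "?P * 1 \<le> ?P\<^sup>2"
      unfolding power2_eq_square by (intro mult_left_mono) auto
    then show ?thesis
      by (intro mult_left_mono) auto
  qed
  also have "\<dots> = (2 * sqrt ?E * ?P)\<^sup>2"
    by (simp add: power_mult_distrib)
  finally show ?thesis
    by (rule power2_le_imp_le) simp
qed

text \<open>Times powers of |w|, the coefficient bound is a product of two convergent series with
  terms (n+1) |w|^n. Absolute convergence then allows summing by rows, which identifies the value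
  g(w, w), and also along antidiagonals.\<close>

lemma diagonal_sums:
  assumes fin: "sqnorm < \<infinity>" and w: "cmod w < 1"
  shows "(\<lambda>m. (\<Sum>j\<le>m. c j (m - j)) * w ^ m) sums g w w"
proof -
  define f where "f = (\<lambda>(l, j). c j l * w ^ j * w ^ l)"
  define A where "A n = real (Suc n) * cmod w ^ n" for n
  define K where "K = 2 * sqrt (enn2real sqnorm)"
  have smA: "summable A"
    using geometric_deriv_sums[of "cmod w"] w by (auto simp: A_def[abs_def] sums_iff)
  have A0: "A n \<ge> 0" and K0: "K \<ge> 0" for n
    by (simp_all add: A_def K_def)
  have bound: "norm (f (l, j)) \<le> K * A l * A j" for l j
  proof -
    have "norm (f (l, j)) = cmod (c j l) * (cmod w ^ j * cmod w ^ l)"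
      by (simp add: f_def norm_mult norm_power)
    also have "\<dots> \<le> (K * (real (Suc j) * real (Suc l))) * (cmod w ^ j * cmod w ^ l)"
      unfolding K_def by (intro mult_right_mono coeff_bound[OF fin]) auto
    finally show ?thesis
      by (simp add: A_def mult_ac)
  qed
  have "(\<lambda>(l, j). norm (K * A l * A j)) summable_on UNIV \<times> UNIV"
    using smA by (intro abs_summable_on_product_UNIV summable_mult) (simp_all add: A0 K0)
  then have "(\<lambda>x. norm (f x)) summable_on UNIV \<times> UNIV"
    unfolding split_beta'
    by (rule Infinite_Sum.abs_summable_on_comparison_test) (use bound in \<open>force intro: order_trans[OF _ abs_ge_self]\<close>)
  then obtain S where S: "(f has_sum S) (UNIV \<times> UNIV)"
    using Infinite_Sum.abs_summable_summable Infinite_Sum.summable_on_def by blast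
  have "((\<lambda>l. C l w * w ^ l) has_sum S) UNIV"
  proof (rule has_sum_SigmaD[OF S])
    fix l
    have "summable (\<lambda>j. K * A l * A j)"
      by (intro summable_mult smA)
    then have "summable (\<lambda>j. norm (f (l, j)))"
      by (rule summable_comparison_test') (use bound in auto)
    moreover have "(\<lambda>j. f (l, j)) sums (C l w * w ^ l)"
      unfolding f_def using sums_mult2[OF c_sums[OF w, of l], of "w ^ l"] by simp
    ultimately show "((\<lambda>j. f (l, j)) has_sum C l w * w ^ l) UNIV"
      by (rule norm_summable_imp_has_sum)
  qed
  then have "S = g w w"
    using has_sum_imp_sums C_sums[OF w w] sums_unique2 by blast
  \<comment> \<open>The pair (m, j) with j <= m stands for l = m - j, so the subtraction of naturals
    is exact.\<close>
  have bij: "bij_betw (\<lambda>(m, j). (m - j, j)) (SIGMA m:UNIV. {..m}) (UNIV \<times> UNIV :: (nat \<times> nat) set)"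
    by (rule bij_betwI[where g = "\<lambda>(l, j). (l + j, j)"]) auto
  have "((\<lambda>x. f ((\<lambda>(m, j). (m - j, j)) x)) has_sum S) (SIGMA m:UNIV. {..m})"
    using has_sum_reindex_bij_betw[OF bij, of f S] S by simp
  then have "((\<lambda>m. \<Sum>j\<le>m. c j (m - j) * w ^ j * w ^ (m - j)) has_sum S) UNIV"
    by (rule has_sum_SigmaD) (auto simp: f_def intro!: has_sum_finite)
  then have "(\<lambda>m. \<Sum>j\<le>m. c j (m - j) * w ^ j * w ^ (m - j)) sums S"
    by (rule has_sum_imp_sums)
  also have "(\<lambda>m. \<Sum>j\<le>m. c j (m - j) * w ^ j * w ^ (m - j)) = (\<lambda>m. (\<Sum>j\<le>m. c j (m - j)) * w ^ m)"
    by (auto simp: sum_distrib_right mult.assoc power_add[symmetric] intro!: ext sum.cong)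
  finally show ?thesis
    using \<open>S = g w w\<close> by simp
qed

lemma diagonal_coeff_bound:
  "(\<Sum>m. ennreal ((cmod (\<Sum>j\<le>m. c j (m - j)))\<^sup>2 * ((disc_moment \<beta> m)\<^sup>2 / real (Suc m)))) \<le> sqnorm"
proof -
  let ?w = "disc_moment \<beta>"
  have w0: "0 < ?w j" for j
    by (rule disc_moment_pos[OF \<beta>(1)])
  define x where "x j l = (cmod (c j l))\<^sup>2 * ?w j * ?w l" for j l
  have x0: "0 \<le> x j l" for j l
    using w0[of j] w0[of l] by (simp add: x_def)
  have step: "(cmod (\<Sum>j\<le>m. c j (m - j)))\<^sup>2 * ((?w m)\<^sup>2 / real (Suc m)) \<le> (\<Sum>j\<le>m. x j (m - j))" for m
  proof -
    have "(cmod (\<Sum>j\<le>m. c j (m - j)))\<^sup>2 \<le> (\<Sum>j\<le>m. cmod (c j (m - j)))\<^sup>2"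
      by (intro power_mono norm_sum) auto
    also have "\<dots> \<le> real (card {..m}) * (\<Sum>j\<le>m. (cmod (c j (m - j)))\<^sup>2)"
      using sum_squared_le_sum_of_squares[of "\<lambda>j. cmod (c j (m - j))" "{..m}"] by (simp add: mult.commute)
    finally have "(cmod (\<Sum>j\<le>m. c j (m - j)))\<^sup>2 * ((?w m)\<^sup>2 / real (Suc m))
        \<le> (real (Suc m) * (\<Sum>j\<le>m. (cmod (c j (m - j)))\<^sup>2)) * ((?w m)\<^sup>2 / real (Suc m))"
      by (intro mult_right_mono) auto
    also have "\<dots> = (\<Sum>j\<le>m. (cmod (c j (m - j)))\<^sup>2 * (?w m * ?w m))"
      by (simp add: sum_distrib_right power2_eq_square del: of_nat_Suc)
    also have "\<dots> \<le> (\<Sum>j\<le>m. x j (m - j))"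
    proof (intro sum_mono)
      fix j assume "j \<in> {..m}"
      \<comment> \<open>The moments decrease, and both j and m - j are at most m.\<close>
      then have "?w m * ?w m \<le> ?w j * ?w (m - j)"
        using w0 by (intro mult_mono disc_moment_antimono \<beta>) (auto simp: less_imp_le)
      then show "(cmod (c j (m - j)))\<^sup>2 * (?w m * ?w m) \<le> x j (m - j)"
        unfolding x_def mult.assoc by (intro mult_left_mono) auto
    qed
    finally show ?thesis .
  qed
  have sq: "sqnorm = (\<Sum>l. \<Sum>j. ennreal (x j l))"
    unfolding sqnorm_eq x_def using w0
    by (simp add: ennreal_mult less_imp_le ennreal_suminf_multc)
  show ?thesis
  proof (rule suminf_le_const)
    fix M
    have "(\<Sum>m<M. ennreal ((cmod (\<Sum>j\<le>m. c j (m - j)))\<^sup>2 * ((?w m)\<^sup>2 / real (Suc m))))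
      \<le> (\<Sum>m<M. \<Sum>j\<le>m. ennreal (x j (m - j)))"
      using step x0 by (intro sum_mono) (simp add: sum_ennreal ennreal_leI)
    \<comment> \<open>The antidiagonals below M fill a triangle, which is enlarged to the square of
      side M; the square can be summed in the order of \<open>sq\<close>.\<close>
    also have "\<dots> = (\<Sum>(j, l)\<in>{(j, l). j + l < M}. ennreal (x j l))"
      by (rule sum.triangle_reindex[symmetric])
    also have "\<dots> \<le> (\<Sum>(j, l)\<in>{..<M} \<times> {..<M}. ennreal (x j l))"
      by (intro sum_mono2) auto
    also have "\<dots> = (\<Sum>j<M. \<Sum>l<M. ennreal (x j l))"
      by (rule sum.cartesian_product[symmetric])
    also have "\<dots> = (\<Sum>l<M. \<Sum>j<M. ennreal (x j l))"
      by (rule sum.swap)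
    also have "\<dots> \<le> (\<Sum>l<M. \<Sum>j. ennreal (x j l))"
      by (intro sum_mono sum_le_suminf) auto
    also have "\<dots> \<le> sqnorm"
      unfolding sq by (intro sum_le_suminf) auto
    finally show "(\<Sum>m<M. ennreal ((cmod (\<Sum>j\<le>m. c j (m - j)))\<^sup>2 * ((?w m)\<^sup>2 / real (Suc m)))) \<le> sqnorm" .
  qed simp
qed

end

section \<open>The one-variable profiles\<close>

text \<open>Jordan's inequality: sin is concave on this interval, so it lies above its
  chord.\<close>

lemma sin_ge_linear:
  fixes x :: real
  assumes "0 \<le> x" "x \<le> pi / 2"
  shows "2 * x / pi \<le> sin x"
proof -
  have "convex_on {0..pi/2} (\<lambda>x. - sin x)"
    by (rule f''_ge0_imp_convex[where f' = "\<lambda>x. - cos x" and f'' = sin])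
       (auto intro!: derivative_eq_intros sin_ge_zero)
  from convex_onD[OF this, of "2 * x / pi" 0 "pi/2"] assms show ?thesis
    by (simp add: field_simps)
qed

text \<open>The integrand is |p(e^{it})|^{2m} for the profile p below. The integral is not
  normalized, hence the factors \<open>2 * pi\<close> in later comparisons.\<close>

definition circle_mean :: "nat \<Rightarrow> nat \<Rightarrow> ennreal" where
  "circle_mean k m = (\<integral>\<^sup>+t. ennreal ((1 - sin (t / 2) ^ (2 * k)) ^ (2 * m)) * indicator {0..2*pi} t \<partial>lborel)"

lemma even_power_sin_le_1: "sin (t::real) ^ (2 * k) \<le> 1"
  by (simp add: power_mult power_le_one abs_square_le_1)

text \<open>On the arc from 0 to m^{-1/(2k)} one has 2m sin^{2k}(t/2) <= 1/2, so Bernoulli's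
  inequality keeps the integrand at least 1/2 there.\<close>

lemma circle_mean_lower:
  assumes "k \<ge> 1" "m \<ge> 1"
  shows "circle_mean k m \<ge> ennreal (real m powr (- 1 / (2 * real k)) / 2)"
proof -
  define \<delta> where "\<delta> = real m powr (- 1 / (2 * real k))"
  have \<delta>: "0 < \<delta>" "\<delta> \<le> 1"
    using assms powr_mono[of "- 1 / (2 * real k)" 0 "real m"] by (auto simp: \<delta>_def)
  have \<delta>k: "\<delta> ^ (2 * k) = 1 / real m"
  proof -
    have "\<delta> ^ (2 * k) = \<delta> powr real (2 * k)"
      using \<delta> by (simp only: powr_realpow)
    also have "\<dots> = real m powr (-1)"
      using assms by (simp add: \<delta>_def powr_powr)
    finally show ?thesis
      using assms by (simp add: powr_minus_divide)
  qed
  have "ennreal (\<delta> / 2) = ennreal (1/2) * ennreal \<delta>"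
    using \<delta> by (subst ennreal_mult[symmetric]) auto
  also have "\<dots> = (\<integral>\<^sup>+t. ennreal (1/2) * indicator {0..\<delta>} t \<partial>lborel)"
    using \<delta> by (subst nn_integral_cmult_indicator) auto
  also have "\<dots> \<le> circle_mean k m"
    unfolding circle_mean_def
  proof (intro nn_integral_mono)
    fix t :: real
    have "ennreal (1 / 2) \<le> ennreal ((1 - sin (t / 2) ^ (2 * k)) ^ (2 * m))" if t: "0 \<le> t" "t \<le> \<delta>"
    proof -
      have "0 \<le> sin (t / 2)" "sin (t / 2) \<le> t / 2"
        using t \<delta> pi_ge_two sin_x_le_x[of "t / 2"] by (auto intro!: sin_ge_zero)
      then have "sin (t / 2) ^ (2 * k) \<le> (\<delta> / 2) ^ (2 * k)"
        using t by (intro power_mono) auto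
      also have "\<dots> = (1 / real m) * (1 / 4) ^ k"
        using power_mult[of "2 :: real" 2 k] by (simp add: power_divide \<delta>k power_one_over)
      also have "\<dots> \<le> (1 / real m) * (1 / 4) ^ 1"
        using assms by (intro mult_left_mono power_decreasing) auto
      finally have s: "sin (t / 2) ^ (2 * k) \<le> 1 / (4 * real m)"
        by simp
      have "1 / 2 = 1 + real (2 * m) * (- (1 / (4 * real m)))"
        using assms by (simp add: field_simps)
      also have "\<dots> \<le> 1 + real (2 * m) * (- (sin (t / 2) ^ (2 * k)))"
        using s by (intro add_left_mono mult_left_mono) auto
      also have "\<dots> \<le> (1 + - (sin (t / 2) ^ (2 * k))) ^ (2 * m)"
        using even_power_sin_le_1[of "t / 2" k] by (intro Bernoulli_inequality) simp
      finally show ?thesis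
        by (intro ennreal_leI) simp
    qed
    moreover have "\<delta> \<le> 2 * pi"
      using \<delta> pi_ge_two by linarith
    ultimately show "ennreal (1 / 2) * indicator {0..\<delta>} t
        \<le> ennreal ((1 - sin (t / 2) ^ (2 * k)) ^ (2 * m)) * indicator {0..2*pi} t"
      by (auto simp: indicator_def intro!: ennreal_leI)
  qed
  finally show ?thesis
    by (simp add: \<delta>_def)
qed

text \<open>With s = sin^{2k}(t/2), the bound (1-s)^{2m} (1+s)^{2m} <= 1 and Bernoulli give
  (1-s)^{2m} <= 1/(1+2ms). Jordan's inequality turns this into 2/(1+(Lt)^2), whose integral is an
  arctangent of size 1/L.\<close>

lemma circle_mean_upper:
  assumes "k \<ge> 1" "m \<ge> 1"
  shows "circle_mean k m \<le> ennreal (2 * pi\<^sup>2 * real m powr (- 1 / (2 * real k)))"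
proof -
  \<comment> \<open>Chosen so that (L t)^{2k} = m (t/pi)^{2k}, the lower bound for m sin^{2k}(t/2)
    given by Jordan's inequality.\<close>
  define L where "L = real m powr (1 / (2 * real k)) / pi"
  have L: "0 < L"
    using assms by (simp add: L_def)
  have Lk: "(L * pi) ^ (2 * k) = real m"
  proof -
    have "(L * pi) ^ (2 * k) = (L * pi) powr real (2 * k)"
      using L by (simp only: powr_realpow mult_pos_pos pi_gt_zero)
    also have "\<dots> = real m powr 1"
      using assms by (simp add: L_def powr_powr)
    finally show ?thesis
      using assms by simp
  qed
  define f where "f x = 2 / (1 + (L * x)\<^sup>2)" for x
  have f0: "f x \<ge> 0" for x
    by (simp add: f_def)
  have [measurable]: "f \<in> borel_measurable borel"
    unfolding f_def by measurable
  have key: "(1 - sin (t / 2) ^ (2 * k)) ^ (2 * m) \<le> f t" if t: "0 \<le> t" "t \<le> pi" for t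
  proof -
    define X where "X = L * t"
    define s where "s = sin (t / 2) ^ (2 * k)"
    have s1: "s \<le> 1" "0 \<le> s"
      unfolding s_def by (rule even_power_sin_le_1) simp
    have "t / pi \<le> sin (t / 2)"
      using sin_ge_linear[of "t / 2"] t by simp
    then have "(t / pi) ^ (2 * k) \<le> s"
      unfolding s_def using t by (intro power_mono) auto
    then have "real m * (t / pi) ^ (2 * k) \<le> real m * s"
      by (intro mult_left_mono) auto
    also have "real m * (t / pi) ^ (2 * k) = X ^ (2 * k)"
      unfolding Lk[symmetric] X_def power_mult_distrib[symmetric] by simp
    finally have ms: "X ^ (2 * k) \<le> real m * s" .
    \<comment> \<open>Trading the exponent 2k for 2, at the cost of an additive 1, makes the
      arctangent serve every k.\<close>
    have "X\<^sup>2 - 1 \<le> X ^ (2 * k)"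
    proof (cases "X\<^sup>2 \<le> 1")
      case False
      then have "(X\<^sup>2) ^ 1 \<le> (X\<^sup>2) ^ k"
        using assms by (intro power_increasing) auto
      then show ?thesis by (simp add: power_mult)
    qed (simp add: power_mult order_trans[of _ 0])
    then have "X\<^sup>2 \<le> 1 + real m * s"
      using ms by linarith
    then have le: "(1 + X\<^sup>2) / 2 \<le> 1 + real (2 * m) * s"
    proof -
      define y where "y = real m * s"
      have "0 \<le> y" "real (2 * m) * s = 2 * y" "X\<^sup>2 \<le> 1 + y"
        using s1 \<open>X\<^sup>2 \<le> 1 + real m * s\<close> by (simp_all add: y_def)
      then show ?thesis
        by simp
    qed
    have "(1 - s) ^ (2 * m) * (1 + real (2 * m) * s) \<le> (1 - s) ^ (2 * m) * (1 + s) ^ (2 * m)"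
      using s1 by (intro mult_left_mono Bernoulli_inequality) auto
    also have "\<dots> = (1 - s * s) ^ (2 * m)"
      by (simp add: power_mult_distrib[symmetric] algebra_simps)
    also have "\<dots> \<le> 1"
      using s1 mult_le_one[of s s] by (intro power_le_one) auto
    finally have "(1 - s) ^ (2 * m) * (1 + real (2 * m) * s) \<le> 1" .
    moreover have "(1 - s) ^ (2 * m) * ((1 + X\<^sup>2) / 2) \<le> (1 - s) ^ (2 * m) * (1 + real (2 * m) * s)"
      using le s1 by (intro mult_left_mono) auto
    ultimately have "(1 - s) ^ (2 * m) * ((1 + X\<^sup>2) / 2) \<le> 1"
      by linarith
    moreover have "1 + X\<^sup>2 > 0"
      by (rule add_pos_nonneg) auto
    ultimately show ?thesis
      unfolding f_def X_def[symmetric] s_def[symmetric] by (simp add: field_simps)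
  qed
  \<comment> \<open>Jordan's inequality reaches only t <= pi; the other half of the circle follows
    from the symmetry of sin(t/2) under t -> 2 pi - t.\<close>
  have key2: "(1 - sin (t / 2) ^ (2 * k)) ^ (2 * m) \<le> f t + f (2 * pi - t)" if t: "0 \<le> t" "t \<le> 2 * pi" for t
  proof (cases "t \<le> pi")
    case True
    with key[of t] f0[of "2 * pi - t"] t show ?thesis by linarith
  next
    case False
    have "sin ((2 * pi - t) / 2) = sin (t / 2)"
      by (simp add: diff_divide_distrib sin_diff)
    with key[of "2 * pi - t"] f0[of t] t False show ?thesis by simp
  qed
  have deriv: "((\<lambda>t. 2 / L * arctan (L * t)) has_real_derivative f t) (at t)" for t
  proof -
    have "((\<lambda>t. arctan (L * t)) has_real_derivative inverse (1 + (L * t)\<^sup>2) * L) (at t)"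
      by (auto intro!: derivative_eq_intros)
    moreover have "2 / L * (inverse (1 + (L * t)\<^sup>2) * L) = f t"
      using L by (simp add: f_def divide_simps)
    ultimately show ?thesis
      by (metis DERIV_cmult)
  qed
  have deriv2: "((\<lambda>t. - (2 / L * arctan (L * (2 * pi - t)))) has_real_derivative f (2 * pi - t)) (at t)" for t
  proof -
    have "((\<lambda>t. 2 * pi - t) has_real_derivative -1) (at t)"
      by (auto intro!: derivative_eq_intros)
    from DERIV_minus[OF DERIV_chain2[OF deriv this]] show ?thesis
      by simp
  qed
  define B where "B = pi / L"
  have I1: "(\<integral>\<^sup>+t. ennreal (f t) * indicator {0..2*pi} t \<partial>lborel) \<le> ennreal B"
  proof -
    have "(\<integral>\<^sup>+t. ennreal (f t) * indicator {0..2*pi} t \<partial>lborel)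
       = ennreal (2 / L * arctan (L * (2 * pi)) - 2 / L * arctan (L * 0))"
      using L f0
      by (intro nn_integral_FTC_Icc deriv) auto
    also have "\<dots> \<le> ennreal B"
      using L arctan_ubound[of "L * (2 * pi)"]
      by (intro ennreal_leI) (auto simp: B_def field_simps)
    finally show ?thesis .
  qed
  have I2: "(\<integral>\<^sup>+t. ennreal (f (2 * pi - t)) * indicator {0..2*pi} t \<partial>lborel) \<le> ennreal B"
  proof -
    have "(\<integral>\<^sup>+t. ennreal (f (2 * pi - t)) * indicator {0..2*pi} t \<partial>lborel)
       = ennreal (- (2 / L * arctan (L * (2 * pi - 2 * pi))) - (- (2 / L * arctan (L * (2 * pi - 0)))))"
      using L f0
      by (intro nn_integral_FTC_Icc deriv2) auto
    also have "\<dots> \<le> ennreal B"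
      using L arctan_ubound[of "L * (2 * pi)"]
      by (intro ennreal_leI) (auto simp: B_def field_simps)
    finally show ?thesis .
  qed
  have "circle_mean k m \<le> (\<integral>\<^sup>+t. ennreal (f t) * indicator {0..2*pi} t + ennreal (f (2 * pi - t)) * indicator {0..2*pi} t \<partial>lborel)"
    unfolding circle_mean_def using key2 f0
    by (intro nn_integral_mono) (auto simp: indicator_def ennreal_plus[symmetric] simp del: ennreal_plus intro!: ennreal_leI)
  also have "\<dots> = (\<integral>\<^sup>+t. ennreal (f t) * indicator {0..2*pi} t \<partial>lborel) + (\<integral>\<^sup>+t. ennreal (f (2 * pi - t)) * indicator {0..2*pi} t \<partial>lborel)"
    by (intro nn_integral_add) measurable
  also have "\<dots> \<le> ennreal B + ennreal B"
    by (intro add_mono I1 I2)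
  also have "\<dots> = ennreal (2 * pi\<^sup>2 * real m powr (- 1 / (2 * real k)))"
    using L by (simp add: B_def L_def powr_minus_divide ennreal_plus[symmetric] power2_eq_square del: ennreal_plus)
  finally show ?thesis .
qed

section \<open>The profile polynomials and the norms of their powers\<close>

lemma poly_sums_coeff: "(\<lambda>j. coeff q j * z ^ j) sums poly q (z :: complex)"
  unfolding poly_altdef by (rule sums_finite) (auto simp: coeff_eq_0)

lemma borel_measurable_poly [measurable]: "poly (q :: complex poly) \<in> borel_measurable borel"
  by (intro borel_measurable_continuous_onI continuous_intros)

lemma nn_integral_disc_poly:
  assumes "\<beta> > -1"
  shows "(\<integral>\<^sup>+z. ennreal ((cmod (poly q z))\<^sup>2) \<partial>disc_measure \<beta>)
    = (\<Sum>j. ennreal ((cmod (coeff q j))\<^sup>2) * ennreal (disc_moment \<beta> j))"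
  using assms by (intro disc_parseval poly_sums_coeff) auto

lemma nn_integral_circle_poly:
  "(\<integral>\<^sup>+t. ennreal ((cmod (poly q (cis t)))\<^sup>2) * indicator {0..2*pi} t \<partial>lborel)
    = ennreal (2 * pi) * (\<Sum>j. ennreal ((cmod (coeff q j))\<^sup>2))"
proof -
  have "summable (\<lambda>j. cmod (coeff q j))"
    by (rule summable_finite[of "{..degree q}"]) (auto simp: coeff_eq_0)
  moreover have "poly q (cis t) = (\<Sum>j. coeff q j * cis (real j * t))" for t
    using poly_sums_coeff[of q "cis t"] by (simp add: sums_iff Complex.DeMoivre)
  ultimately show ?thesis
    by (simp only: circle_parseval)
qed

text \<open>On the circle the inner polynomial is z^K (1 - sin^{2k}(t/2)). The outer factor z,
  written \<open>pCons 0\<close>, makes p^m vanish to order m at 0. The exponent \<open>K\<close> is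
  kept separate from \<open>k\<close> so that z^K cancels when two profiles with the same
  \<open>K\<close> are subtracted; \<open>K - k\<close> is a true difference only for
  \<open>k \<le> K\<close>.\<close>

definition profile :: "nat \<Rightarrow> nat \<Rightarrow> complex poly" where
  "profile K k = pCons 0 (monom 1 K - monom 1 (K - k) * (smult (- 1 / 4) ([:1, -1:]\<^sup>2)) ^ k)"

lemma poly_profile: "poly (profile K k) z = z * (z ^ K - z ^ (K - k) * (- ((1 - z)\<^sup>2) / 4) ^ k)"
  by (simp add: profile_def poly_monom)

text \<open>From 1 - e^{it} = -2i e^{it/2} sin(t/2) follows -(1 - e^{it})^2/4 = e^{it} sin^2(t/2),
  and its k-th power supplies exactly the e^{ikt} missing from z^{K-k}.\<close>

lemma cmod_profile_cis:
  assumes "k \<le> K"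
  shows "cmod (poly (profile K k) (cis t)) = 1 - sin (t / 2) ^ (2 * k)"
proof -
  have "1 - cis t = cis (t / 2) * (- 2 * \<i> * of_real (sin (t / 2)))"
  proof -
    have "1 - cis t = cis (t / 2) * cis (- (t / 2)) - cis (t / 2) * cis (t / 2)"
      by (simp add: cis_mult)
    also have "\<dots> = cis (t / 2) * (- 2 * \<i> * of_real (sin (t / 2)))"
      by (simp add: right_diff_distrib[symmetric] complex_eq_iff)
    finally show ?thesis .
  qed
  then have "(1 - cis t)\<^sup>2 = (cis (t / 2) * (- 2 * \<i> * of_real (sin (t / 2))))\<^sup>2"
    by (simp only:)
  then have "(1 - cis t)\<^sup>2 = (cis (t / 2) * cis (t / 2)) * (- 4 * of_real ((sin (t / 2))\<^sup>2))"
    by (simp add: power_mult_distrib power2_eq_square)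
  then have u: "- ((1 - cis t)\<^sup>2) / 4 = cis t * of_real ((sin (t / 2))\<^sup>2)"
    by (simp add: cis_mult)
  have "cis t ^ K - cis t ^ (K - k) * (- ((1 - cis t)\<^sup>2) / 4) ^ k
    = cis t ^ K * of_real (1 - sin (t / 2) ^ (2 * k))"
    unfolding u power_mult_distrib mult.assoc[symmetric] power_add[symmetric]
    using assms by (simp add: right_diff_distrib power_mult)
  then have "poly (profile K k) (cis t) = cis t * (cis t ^ K * of_real (1 - sin (t / 2) ^ (2 * k)))"
    by (simp add: poly_profile)
  then have "cmod (poly (profile K k) (cis t)) = cmod (complex_of_real (1 - sin (t / 2) ^ (2 * k)))"
    by (simp add: norm_mult norm_power del: of_real_diff of_real_power)
  then show ?thesis
    using even_power_sin_le_1[of "t / 2" k] by (simp del: of_real_diff of_real_power)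
qed

lemma circle_mean_profile:
  assumes "k \<le> K"
  shows "circle_mean k m = ennreal (2 * pi) * (\<Sum>j. ennreal ((cmod (coeff (profile K k ^ m) j))\<^sup>2))"
  unfolding nn_integral_circle_poly[symmetric] circle_mean_def
  by (simp add: poly_power norm_power cmod_profile_cis[OF assms] power_mult[symmetric] mult.commute)

definition profile_sqnorm :: "real \<Rightarrow> nat \<Rightarrow> nat \<Rightarrow> nat \<Rightarrow> ennreal" where
  "profile_sqnorm \<beta> K k m = (\<integral>\<^sup>+z. ennreal (cmod (poly (profile K k) z) ^ (2 * m)) \<partial>disc_measure \<beta>)"

lemma profile_sqnorm_eq:
  assumes "\<beta> > -1"
  shows "profile_sqnorm \<beta> K k m
    = (\<Sum>j. ennreal ((cmod (coeff (profile K k ^ m) j))\<^sup>2) * ennreal (disc_moment \<beta> j))"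
  unfolding nn_integral_disc_poly[OF assms, symmetric] profile_sqnorm_def
  by (simp add: norm_power poly_power power_mult[symmetric] mult.commute)

text \<open>The coefficients of p^m start at degree m, where every decreasing weight is at most w_m;
  pulling out that weight leaves Parseval on the circle.\<close>

lemma profile_sqnorm_upper:
  assumes "\<beta> > -1" "k \<le> K"
  shows "ennreal (2 * pi) * profile_sqnorm \<beta> K k m \<le> ennreal (disc_moment \<beta> m) * circle_mean k m"
proof -
  let ?c = "\<lambda>j. ennreal ((cmod (coeff (profile K k ^ m) j))\<^sup>2)"
  have "coeff (profile K k ^ m) j = 0" if "j < m" for j
  proof -
    have "profile K k = [:0, 1:] * (monom 1 K - monom 1 (K - k) * (smult (- 1 / 4) ([:1, -1:]\<^sup>2)) ^ k)"
      by (simp add: profile_def)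
    then have "profile K k ^ m = monom 1 m * (monom 1 K - monom 1 (K - k) * (smult (- 1 / 4) ([:1, -1:]\<^sup>2)) ^ k) ^ m"
      by (simp only: power_mult_distrib monom_altdef) simp
    with that show ?thesis
      by (simp add: coeff_monom_mult)
  qed
  then have "?c j * ennreal (disc_moment \<beta> j) \<le> ?c j * ennreal (disc_moment \<beta> m)" for j
    using disc_moment_antimono[OF assms(1), of m j]
    by (cases "j < m") (auto intro!: mult_left_mono ennreal_leI)
  then have "profile_sqnorm \<beta> K k m \<le> (\<Sum>j. ?c j * ennreal (disc_moment \<beta> m))"
    unfolding profile_sqnorm_eq[OF assms(1)] by (intro suminf_le) auto
  then have "ennreal (2 * pi) * profile_sqnorm \<beta> K k m \<le> ennreal (2 * pi) * ((\<Sum>j. ?c j) * ennreal (disc_moment \<beta> m))"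
    by (intro mult_left_mono) auto
  then show ?thesis
    by (simp add: circle_mean_profile[OF assms(2)] mult_ac)
qed

lemma profile_sqnorm_lower:
  assumes "\<beta> > -1" "k \<le> K"
  shows "ennreal (disc_moment \<beta> (degree (profile K k) * m)) * circle_mean k m
    \<le> ennreal (2 * pi) * profile_sqnorm \<beta> K k m"
proof -
  let ?c = "\<lambda>j. ennreal ((cmod (coeff (profile K k ^ m) j))\<^sup>2)"
  let ?D = "degree (profile K k) * m"
  have "coeff (profile K k ^ m) j = 0" if "j > ?D" for j
    using that degree_power_le[of "profile K k" m] by (intro coeff_eq_0) (auto simp: mult.commute)
  then have "?c j * ennreal (disc_moment \<beta> ?D) \<le> ?c j * ennreal (disc_moment \<beta> j)" for j
    using disc_moment_antimono[OF assms(1), of j ?D]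
    by (cases "j > ?D") (auto intro!: mult_left_mono ennreal_leI)
  then have "(\<Sum>j. ?c j * ennreal (disc_moment \<beta> ?D)) \<le> profile_sqnorm \<beta> K k m"
    unfolding profile_sqnorm_eq[OF assms(1)] by (intro suminf_le) auto
  then have "ennreal (2 * pi) * ((\<Sum>j. ?c j) * ennreal (disc_moment \<beta> ?D)) \<le> ennreal (2 * pi) * profile_sqnorm \<beta> K k m"
    by (intro mult_left_mono) auto
  then show ?thesis
    by (simp add: circle_mean_profile[OF assms(2)] mult_ac)
qed

text \<open>With s = 1/(2k) = -beta the exponents cancel: (m+1) (m+1)^{s-1} m^{-s} = ((m+1)/m)^s <=
  2. The case m = 0 is separate because the circle estimate starts at m = 1.\<close>

lemma profile_sqnorm_bounded:
  assumes k: "1 \<le> k" "k \<le> K" and \<beta>: "\<beta> = - 1 / (2 * real k)"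
  shows "ennreal (real (Suc m)) * profile_sqnorm \<beta> K k m \<le> ennreal (2 * pi)"
proof (cases "m = 0")
  case True
  have "\<beta> > -1"
    using k by (simp add: \<beta>)
  then interpret prob_space "disc_measure \<beta>"
    by (rule prob_space_disc_measure)
  show ?thesis
    using True pi_gt3 emeasure_space_1 by (simp add: profile_sqnorm_def)
next
  case False
  define x where "x = real m"
  have x: "x \<ge> 1"
    using False by (simp add: x_def)
  have \<beta>1: "\<beta> > -1" "\<beta> \<le> 0"
    using k by (auto simp: \<beta>)
  define s where "s = 1 / (2 * real k)"
  have s: "0 < s" "s \<le> 1" "\<beta> = - s"
    using k by (auto simp: s_def \<beta>)
  have "ennreal (2 * pi) * profile_sqnorm \<beta> K k m \<le> ennreal (disc_moment \<beta> m) * circle_mean k m"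
    by (rule profile_sqnorm_upper[OF \<beta>1(1) k(2)])
  also have "\<dots> \<le> ennreal ((x + 1) powr (- (\<beta> + 1))) * ennreal (2 * pi\<^sup>2 * x powr (- s))"
    using disc_moment_upper[OF \<beta>1, of m] circle_mean_upper[OF k(1), of m] False
    by (intro mult_mono ennreal_leI) (auto simp: x_def s_def add.commute)
  also have "\<dots> = ennreal (2 * pi) * ennreal (pi * ((x + 1) powr (s - 1) * x powr (- s)))"
    using x by (simp add: ennreal_mult[symmetric] s power2_eq_square mult_ac)
  finally have "profile_sqnorm \<beta> K k m \<le> ennreal (pi * ((x + 1) powr (s - 1) * x powr (- s)))"
    by (subst (asm) ennreal_mult_le_mult_iff) auto
  then have "ennreal (x + 1) * profile_sqnorm \<beta> K k m \<le> ennreal (x + 1) * ennreal (pi * ((x + 1) powr (s - 1) * x powr (- s)))"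
    by (intro mult_left_mono) auto
  also have "\<dots> = ennreal (pi * ((x + 1) powr s * x powr (- s)))"
  proof -
    have "(x + 1) powr s = (x + 1) powr 1 * (x + 1) powr (s - 1)"
      by (subst powr_add[symmetric]) simp
    then have "(x + 1) * (pi * ((x + 1) powr (s - 1) * x powr (- s))) = pi * ((x + 1) powr s * x powr (- s))"
      using x by simp
    then show ?thesis
      using x by (subst ennreal_mult[symmetric]) auto
  qed
  also have "\<dots> \<le> ennreal (2 * pi)"
  proof (rule ennreal_leI)
    have "(x + 1) powr s * x powr (- s) = ((x + 1) / x) powr s"
      using x by (simp add: powr_divide powr_minus_divide)
    also have "\<dots> \<le> 2 powr s"
      using x s by (intro powr_mono2) (auto simp: field_simps)
    also have "\<dots> \<le> 2 powr 1"
      using s by (intro powr_mono) auto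
    finally show "pi * ((x + 1) powr s * x powr (- s)) \<le> 2 * pi"
      by (simp add: mult.commute)
  qed
  finally show ?thesis
    by (simp add: x_def add.commute)
qed

lemma profile_sqnorm_ge:
  assumes \<beta>: "\<beta> > -1" "\<beta> \<le> 0" and k: "1 \<le> k" "k \<le> K"
  obtains c where "c > 0"
    "\<And>m. m \<ge> 1 \<Longrightarrow> ennreal (c * real m powr (- (\<beta> + 1) - 1 / (2 * real k))) \<le> profile_sqnorm \<beta> K k m"
proof -
  \<comment> \<open>The successor makes \<open>D\<close> positive without computing the degree, so
    that \<open>disc_moment_lower\<close> applies at \<open>D * m\<close>.\<close>
  define D where "D = Suc (degree (profile K k))"
  \<comment> \<open>The 8 pi collects one factor 2 from each of the two lower bounds and the 2 pi of
    the circle integral.\<close>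
  define c where "c = real D powr (- (\<beta> + 1)) / (8 * pi)"
  have "c > 0"
    by (simp add: c_def D_def)
  moreover have "ennreal (c * real m powr (- (\<beta> + 1) - 1 / (2 * real k))) \<le> profile_sqnorm \<beta> K k m" if m: "m \<ge> 1" for m
  proof -
    have "(real D * real m) powr (- (\<beta> + 1)) / 2 \<le> disc_moment \<beta> (D * m)"
      using disc_moment_lower[OF \<beta>, of "D * m"] m by (simp add: D_def algebra_simps)
    also have "\<dots> \<le> disc_moment \<beta> (degree (profile K k) * m)"
      by (rule disc_moment_antimono[OF \<beta>(1)]) (simp add: D_def)
    finally have 1: "real D powr (- (\<beta> + 1)) * real m powr (- (\<beta> + 1)) / 2 \<le> disc_moment \<beta> (degree (profile K k) * m)"
      by (simp add: powr_mult)
    have "ennreal (2 * pi) * ennreal (c * real m powr (- (\<beta> + 1) - 1 / (2 * real k)))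
      = ennreal (real D powr (- (\<beta> + 1)) * real m powr (- (\<beta> + 1)) / 2) * ennreal (real m powr (- 1 / (2 * real k)) / 2)"
      using m by (simp add: c_def ennreal_mult[symmetric] powr_add[symmetric])
    also have "\<dots> \<le> ennreal (disc_moment \<beta> (degree (profile K k) * m)) * circle_mean k m"
      by (intro mult_mono ennreal_leI 1 circle_mean_lower k m) auto
    also have "\<dots> \<le> ennreal (2 * pi) * profile_sqnorm \<beta> K k m"
      by (rule profile_sqnorm_lower[OF \<beta>(1) k(2)])
    finally show ?thesis
      by (subst (asm) ennreal_mult_le_mult_iff) auto
  qed
  ultimately show ?thesis
    by (rule that)
qed

section \<open>Integration over the tridisc\<close>

definition vec3 :: "complex \<Rightarrow> complex \<Rightarrow> complex \<Rightarrow> complex ^ 3" where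
  "vec3 a b c = (\<chi> i. if i = 1 then a else if i = 2 then b else c)"

lemma vec3_nth [simp]: "vec3 a b c $ 1 = a" "vec3 a b c $ 2 = b" "vec3 a b c $ 3 = c"
  by (simp_all add: vec3_def)

lemma vec3_mem_polydisc [simp]: "vec3 a b c \<in> polydisc \<longleftrightarrow> cmod a < 1 \<and> cmod b < 1 \<and> cmod c < 1"
  by (simp add: polydisc_def forall_3)

lemma open_polydisc: "open (polydisc :: (complex ^ 'd) set)"
proof -
  have "polydisc = (\<Inter>i. (\<lambda>z :: complex ^ 'd. z $ i) -` ball 0 1)"
    by (auto simp: polydisc_def)
  also have "open \<dots>"
    by (intro open_INT finite ballI open_vimage continuous_on_component continuous_on_id open_ball)
  finally show ?thesis .
qed

text \<open>The order of integration is left as a parameter, because two different innermost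
  variables are wanted later.\<close>

lemma nn_integral_polydisc_measure:
  fixes f :: "complex ^ 3 \<Rightarrow> ennreal"
  assumes \<beta>: "\<beta> > -1" and [measurable]: "f \<in> borel_measurable borel"
    and UNIV: "(UNIV :: 3 set) = {i, j, l}" and distinct: "i \<noteq> j" "i \<noteq> l" "j \<noteq> l"
  shows "(\<integral>\<^sup>+z. f z \<partial>polydisc_measure \<beta>)
    = (\<integral>\<^sup>+a. \<integral>\<^sup>+b. \<integral>\<^sup>+c. f (\<chi> n. if n = i then c else if n = j then b else a)
        \<partial>disc_measure \<beta> \<partial>disc_measure \<beta> \<partial>disc_measure \<beta>)"
proof -
  let ?M = "\<lambda>_::3. disc_measure \<beta>"
  interpret P: prob_space "disc_measure \<beta>"
    by (rule prob_space_disc_measure[OF \<beta>])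
  interpret product_sigma_finite ?M ..
  have m: "(\<lambda>x. f (vec_lambda x)) \<in> borel_measurable (Pi\<^sub>M UNIV ?M)"
    by measurable
  have sub: "vec_lambda (x(j := b, i := c)) = (\<chi> n. if n = i then c else if n = j then b else x l)"
    for x :: "3 \<Rightarrow> complex" and b c
  proof -
    have "n = l" if "n \<noteq> i" "n \<noteq> j" for n
      using UNIV that by auto
    then show ?thesis
      by (auto simp: vec_eq_iff)
  qed
  have "(\<integral>\<^sup>+z. f z \<partial>polydisc_measure \<beta>) = (\<integral>\<^sup>+x. f (vec_lambda x) \<partial>Pi\<^sub>M {i, j, l} ?M)"
    unfolding polydisc_measure_def UNIV[symmetric] by (rule nn_integral_distr) measurable
  also have "\<dots> = (\<integral>\<^sup>+x. \<integral>\<^sup>+c. f (vec_lambda (x(i := c))) \<partial>disc_measure \<beta> \<partial>Pi\<^sub>M {j, l} ?M)"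
    using m distinct by (intro product_nn_integral_insert) (auto simp: UNIV)
  also have "\<dots> = (\<integral>\<^sup>+x. \<integral>\<^sup>+b. \<integral>\<^sup>+c. f (vec_lambda (x(j := b, i := c))) \<partial>disc_measure \<beta> \<partial>disc_measure \<beta> \<partial>Pi\<^sub>M {l} ?M)"
  proof (rule product_nn_integral_insert)
    have "(\<lambda>(x, c). f (vec_lambda (x(i := c)))) \<in> borel_measurable (Pi\<^sub>M {j, l} ?M \<Otimes>\<^sub>M disc_measure \<beta>)"
      using measurable_compose[OF measurable_add_dim[of i "{j, l}" ?M] m[unfolded UNIV]] by (simp add: split_beta')
    then show "(\<lambda>x. \<integral>\<^sup>+c. f (vec_lambda (x(i := c))) \<partial>disc_measure \<beta>) \<in> borel_measurable (Pi\<^sub>M {j, l} ?M)"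
      by (rule P.borel_measurable_nn_integral)
  qed (use distinct in auto)
  also have "\<dots> = (\<integral>\<^sup>+x. \<integral>\<^sup>+b. \<integral>\<^sup>+c. f (\<chi> n. if n = i then c else if n = j then b else x l) \<partial>disc_measure \<beta> \<partial>disc_measure \<beta> \<partial>Pi\<^sub>M {l} ?M)"
    by (simp only: sub)
  also have "\<dots> = (\<integral>\<^sup>+a. \<integral>\<^sup>+b. \<integral>\<^sup>+c. f (\<chi> n. if n = i then c else if n = j then b else a)
        \<partial>disc_measure \<beta> \<partial>disc_measure \<beta> \<partial>disc_measure \<beta>)"
  proof (rule product_nn_integral_singleton)
    let ?v = "\<lambda>x. (\<chi> n. if n = i then snd x else if n = j then snd (fst x) else fst (fst x)) :: complex ^ 3"
    have "continuous_on UNIV (\<lambda>x. if n = i then snd x else if n = j then snd (fst x) else fst (fst x) :: complex)" for n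
      by (cases "n = i"; cases "n = j") (auto intro!: continuous_intros)
    then have "continuous_on UNIV ?v"
      by (intro continuous_on_vec_lambda)
    then have "?v \<in> borel_measurable ((borel \<Otimes>\<^sub>M borel) \<Otimes>\<^sub>M borel)"
      unfolding borel_prod by (rule borel_measurable_continuous_onI)
    moreover have sets: "sets ((disc_measure \<beta> \<Otimes>\<^sub>M disc_measure \<beta>) \<Otimes>\<^sub>M disc_measure \<beta>)
        = sets ((borel \<Otimes>\<^sub>M borel) \<Otimes>\<^sub>M borel)"
      by (intro sets_pair_measure_cong) simp_all
    ultimately have [measurable]: "?v \<in> borel_measurable ((disc_measure \<beta> \<Otimes>\<^sub>M disc_measure \<beta>) \<Otimes>\<^sub>M disc_measure \<beta>)"
      by (simp only: measurable_cong_sets[OF sets refl])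
    have "(\<lambda>x. f (?v x)) \<in> borel_measurable ((disc_measure \<beta> \<Otimes>\<^sub>M disc_measure \<beta>) \<Otimes>\<^sub>M disc_measure \<beta>)"
      by measurable
    then have "(\<lambda>(y, c). f (?v (y, c))) \<in> borel_measurable ((disc_measure \<beta> \<Otimes>\<^sub>M disc_measure \<beta>) \<Otimes>\<^sub>M disc_measure \<beta>)"
      by (simp add: split_beta')
    then have "(\<lambda>y. \<integral>\<^sup>+c. f (?v (y, c)) \<partial>disc_measure \<beta>) \<in> borel_measurable (disc_measure \<beta> \<Otimes>\<^sub>M disc_measure \<beta>)"
      by (rule P.borel_measurable_nn_integral)
    then have "(\<lambda>(a, b). \<integral>\<^sup>+c. f (?v ((a, b), c)) \<partial>disc_measure \<beta>) \<in> borel_measurable (disc_measure \<beta> \<Otimes>\<^sub>M disc_measure \<beta>)"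
      by (simp add: split_beta')
    from P.borel_measurable_nn_integral[OF this]
    show "(\<lambda>a. \<integral>\<^sup>+b. \<integral>\<^sup>+c. f (\<chi> n. if n = i then c else if n = j then b else a) \<partial>disc_measure \<beta> \<partial>disc_measure \<beta>)
      \<in> borel_measurable (disc_measure \<beta>)"
      by simp
  qed
  finally show ?thesis .
qed

lemma holo_on_imp_continuous_on: "holo_on f S \<Longrightarrow> continuous_on S f"
  unfolding holo_on_def by (meson continuous_at_imp_continuous_on has_derivative_continuous)

lemma bounded_linear_scaleC: "bounded_linear (\<lambda>h. h *s (v :: complex ^ 'd))"
  by (rule linear_conv_bounded_linear[THEN iffD1])
     (auto simp: linear_iff vec_eq_iff algebra_simps)

text \<open>Complex linearity of the Frechet derivative turns h -> D(h v) into multiplication by the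
  number D v, which is one-variable differentiability along the line.\<close>

lemma holo_on_line_field_differentiable:
  assumes "holo_on f S" "u + w *s v \<in> S"
  shows "(\<lambda>w. f (u + w *s v)) field_differentiable (at w)"
proof -
  obtain D where D: "(f has_derivative D) (at (u + w *s v))" and lin: "\<And>c v. D (c *s v) = c * D v"
    using assms unfolding holo_on_def by blast
  have "((\<lambda>w. u + w *s v) has_derivative (\<lambda>h. h *s v)) (at w)"
    by (auto intro!: derivative_eq_intros bounded_linear_imp_has_derivative bounded_linear_scaleC)
  from has_derivative_compose[OF this D] have "((\<lambda>w. f (u + w *s v)) has_derivative (\<lambda>h. D v * h)) (at w)"
    by (simp add: lin mult.commute)
  then show ?thesis
    unfolding field_differentiable_def has_field_derivative_def by blast
qed

lemma holo_on_vec3_holomorphic: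
  fixes f :: "complex ^ 3 \<Rightarrow> complex"
  assumes f: "holo_on f polydisc"
  shows "cmod b < 1 \<Longrightarrow> cmod c < 1 \<Longrightarrow> (\<lambda>a. f (vec3 a b c)) holomorphic_on ball 0 1"
    and "cmod a < 1 \<Longrightarrow> cmod c < 1 \<Longrightarrow> (\<lambda>b. f (vec3 a b c)) holomorphic_on ball 0 1"
    and "cmod a < 1 \<Longrightarrow> cmod b < 1 \<Longrightarrow> (\<lambda>c. f (vec3 a b c)) holomorphic_on ball 0 1"
proof -
  have 1: "vec3 a b c = vec3 0 b c + a *s vec3 1 0 0" "vec3 a b c = vec3 a 0 c + b *s vec3 0 1 0"
    "vec3 a b c = vec3 a b 0 + c *s vec3 0 0 1" for a b c
    by (simp_all add: vec_eq_iff forall_3)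
  show "cmod b < 1 \<Longrightarrow> cmod c < 1 \<Longrightarrow> (\<lambda>a. f (vec3 a b c)) holomorphic_on ball 0 1"
    unfolding holomorphic_on_def
    using holo_on_line_field_differentiable[OF f, of "vec3 0 b c" _ "vec3 1 0 0", folded 1(1)]
    by (auto intro: field_differentiable_at_within)
  show "cmod a < 1 \<Longrightarrow> cmod c < 1 \<Longrightarrow> (\<lambda>b. f (vec3 a b c)) holomorphic_on ball 0 1"
    unfolding holomorphic_on_def
    using holo_on_line_field_differentiable[OF f, of "vec3 a 0 c" _ "vec3 0 1 0", folded 1(2)]
    by (auto intro: field_differentiable_at_within)
  show "cmod a < 1 \<Longrightarrow> cmod b < 1 \<Longrightarrow> (\<lambda>c. f (vec3 a b c)) holomorphic_on ball 0 1"
    unfolding holomorphic_on_def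
    using holo_on_line_field_differentiable[OF f, of "vec3 a b 0" _ "vec3 0 0 1", folded 1(3)]
    by (auto intro: field_differentiable_at_within)
qed

lemma continuous_on_vec3 [continuous_intros]:
  assumes "continuous_on S f" "continuous_on S g" "continuous_on S h"
  shows "continuous_on S (\<lambda>x. vec3 (f x) (g x) (h x))"
  unfolding vec3_def
proof (rule continuous_on_vec_lambda)
  fix i :: 3
  show "continuous_on S (\<lambda>x. if i = 1 then f x else if i = 2 then g x else h x)"
    using assms by (cases "i = 1"; cases "i = 2") auto
qed

text \<open>With \<open>c\<close> innermost, f can be compared with its slice c = 0; with
  \<open>a\<close> innermost, a composite can be expanded as a power series in the first variable.
  The indicator makes the integrand Borel although f is arbitrary off the polydisc.\<close>

lemma bergman_sqnorm_iterated:
  fixes f :: "complex ^ 3 \<Rightarrow> complex"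
  assumes \<beta>: "\<beta> > -1" and f: "continuous_on polydisc f"
  shows "bergman_sqnorm \<beta> f = (\<integral>\<^sup>+a. \<integral>\<^sup>+b. \<integral>\<^sup>+c. ennreal ((cmod (f (vec3 a b c)))\<^sup>2) * indicator polydisc (vec3 a b c)
        \<partial>disc_measure \<beta> \<partial>disc_measure \<beta> \<partial>disc_measure \<beta>)"
    and "bergman_sqnorm \<beta> f = (\<integral>\<^sup>+c. \<integral>\<^sup>+b. \<integral>\<^sup>+a. ennreal ((cmod (f (vec3 a b c)))\<^sup>2) * indicator polydisc (vec3 a b c)
        \<partial>disc_measure \<beta> \<partial>disc_measure \<beta> \<partial>disc_measure \<beta>)"
proof -
  have "(\<lambda>z. if z \<in> polydisc then f z else 0) \<in> borel_measurable borel"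
    by (intro borel_measurable_continuous_on_if f) (auto intro: borel_open open_polydisc)
  then have "(\<lambda>z. ennreal ((cmod (if z \<in> polydisc then f z else 0))\<^sup>2)) \<in> borel_measurable borel"
    by measurable
  also have "(\<lambda>z. ennreal ((cmod (if z \<in> polydisc then f z else 0))\<^sup>2)) = (\<lambda>z. ennreal ((cmod (f z))\<^sup>2) * indicator polydisc z)"
    by (auto simp: indicator_def)
  finally have m: "(\<lambda>z. ennreal ((cmod (f z))\<^sup>2) * indicator polydisc z) \<in> borel_measurable borel" .
  have U: "(UNIV :: 3 set) = {3, 2, 1}" "(UNIV :: 3 set) = {1, 2, 3}"
    unfolding UNIV_3 by auto
  have v: "(\<chi> n. if n = 3 then c else if n = 2 then b else a) = vec3 a b c"
    "(\<chi> n. if n = 1 then a else if n = 2 then b else c) = vec3 a b c" for a b c :: complex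
    by (simp_all add: vec_eq_iff forall_3)
  show "bergman_sqnorm \<beta> f = (\<integral>\<^sup>+a. \<integral>\<^sup>+b. \<integral>\<^sup>+c. ennreal ((cmod (f (vec3 a b c)))\<^sup>2) * indicator polydisc (vec3 a b c)
        \<partial>disc_measure \<beta> \<partial>disc_measure \<beta> \<partial>disc_measure \<beta>)"
    unfolding bergman_sqnorm_def
    using nn_integral_polydisc_measure[OF \<beta> m U(1)] unfolding v by simp
  show "bergman_sqnorm \<beta> f = (\<integral>\<^sup>+c. \<integral>\<^sup>+b. \<integral>\<^sup>+a. ennreal ((cmod (f (vec3 a b c)))\<^sup>2) * indicator polydisc (vec3 a b c)
        \<partial>disc_measure \<beta> \<partial>disc_measure \<beta> \<partial>disc_measure \<beta>)"
    unfolding bergman_sqnorm_def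
    using nn_integral_polydisc_measure[OF \<beta> m U(2)] unfolding v by simp
qed

lemma disc_parseval_indicator:
  assumes \<beta>: "\<beta> > -1" and h: "continuous_on (ball 0 1) h"
    and sums: "\<And>z. cmod z < 1 \<Longrightarrow> (\<lambda>j. a j * z ^ j) sums h z"
  shows "(\<integral>\<^sup>+z. ennreal ((cmod (h z))\<^sup>2) * indicator (ball 0 1) z \<partial>disc_measure \<beta>)
    = (\<Sum>j. ennreal ((cmod (a j))\<^sup>2) * ennreal (disc_moment \<beta> j))"
proof -
  define h' where "h' z = (if z \<in> ball 0 1 then h z else 0)" for z
  have "h' \<in> borel_measurable borel"
    unfolding h'_def by (intro borel_measurable_continuous_on_if h) auto
  then have "(\<integral>\<^sup>+z. ennreal ((cmod (h' z))\<^sup>2) \<partial>disc_measure \<beta>)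
    = (\<Sum>j. ennreal ((cmod (a j))\<^sup>2) * ennreal (disc_moment \<beta> j))"
    by (rule disc_parseval[OF \<beta>]) (simp add: h'_def sums)
  also have "(\<integral>\<^sup>+z. ennreal ((cmod (h' z))\<^sup>2) \<partial>disc_measure \<beta>)
    = (\<integral>\<^sup>+z. ennreal ((cmod (h z))\<^sup>2) * indicator (ball 0 1) z \<partial>disc_measure \<beta>)"
    by (intro nn_integral_cong) (auto simp: h'_def indicator_def)
  finally show ?thesis .
qed

text \<open>For fixed a and b, |f(a, b, 0)|^2 is the zeroth term of the Parseval series in c, with
  weight w_0 = 1. Restriction to the slice that contains the image of the symbols is thus a
  contraction.\<close>

lemma bidisc_sqnorm_le:
  fixes f :: "complex ^ 3 \<Rightarrow> complex"
  assumes \<beta>: "\<beta> > -1" and f: "holo_on f polydisc"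
  shows "(\<integral>\<^sup>+a. \<integral>\<^sup>+b. ennreal ((cmod (f (vec3 a b 0)))\<^sup>2) * indicator (ball 0 1 \<times> ball 0 1) (a, b)
    \<partial>disc_measure \<beta> \<partial>disc_measure \<beta>) \<le> bergman_sqnorm \<beta> f"
  unfolding bergman_sqnorm_iterated(1)[OF \<beta> holo_on_imp_continuous_on[OF f]]
proof (intro nn_integral_mono)
  fix a b :: complex
  show "ennreal ((cmod (f (vec3 a b 0)))\<^sup>2) * indicator (ball 0 1 \<times> ball 0 1) (a, b)
    \<le> (\<integral>\<^sup>+c. ennreal ((cmod (f (vec3 a b c)))\<^sup>2) * indicator polydisc (vec3 a b c) \<partial>disc_measure \<beta>)"
  proof (cases "cmod a < 1 \<and> cmod b < 1")
    case True
    define h where "h c = f (vec3 a b c)" for c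
    have h: "h holomorphic_on ball 0 1"
      unfolding h_def using True by (intro holo_on_vec3_holomorphic(3)[OF f]) auto
    have "(\<lambda>j. (deriv ^^ j) h 0 / fact j * z ^ j) sums h z" if "cmod z < 1" for z
      using holomorphic_power_series[OF h, of z] that by simp
    from disc_parseval_indicator[OF \<beta> holomorphic_on_imp_continuous_on[OF h] this]
    have "(\<integral>\<^sup>+c. ennreal ((cmod (h c))\<^sup>2) * indicator (ball 0 1) c \<partial>disc_measure \<beta>)
      = (\<Sum>j. ennreal ((cmod ((deriv ^^ j) h 0 / fact j))\<^sup>2) * ennreal (disc_moment \<beta> j))" .
    also have "\<dots> \<ge> (\<Sum>j\<in>{0}. ennreal ((cmod ((deriv ^^ j) h 0 / fact j))\<^sup>2) * ennreal (disc_moment \<beta> j))"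
      by (intro sum_le_suminf) auto
    finally have "ennreal ((cmod (h 0))\<^sup>2) \<le> (\<integral>\<^sup>+c. ennreal ((cmod (h c))\<^sup>2) * indicator (ball 0 1) c \<partial>disc_measure \<beta>)"
      using \<beta> by simp
    then show ?thesis
      using True by (simp add: h_def indicator_def)
  qed (auto simp: indicator_def)
qed

text \<open>As a power series in z_1 the function has coefficients a_m (z_3 p(z_2))^m. Parseval in
  z_1 yields one factor w_m, and integrating |z_3|^{2m} yields the second.\<close>

lemma bergman_sqnorm_composite:
  fixes h :: "complex ^ 3 \<Rightarrow> complex"
  assumes \<beta>: "\<beta> > -1" and h: "continuous_on polydisc h"
    and p: "\<And>z. cmod z < 1 \<Longrightarrow> cmod (poly p z) < 1"
    and F: "\<And>w. cmod w < 1 \<Longrightarrow> (\<lambda>m. a m * w ^ m) sums F w"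
    and hF: "\<And>z. z \<in> polydisc \<Longrightarrow> h z = F (z $ 1 * z $ 3 * poly p (z $ 2))"
  shows "bergman_sqnorm \<beta> h = (\<Sum>m. ennreal ((cmod (a m))\<^sup>2 * (disc_moment \<beta> m)\<^sup>2) *
    (\<integral>\<^sup>+z. ennreal (cmod (poly p z) ^ (2 * m)) \<partial>disc_measure \<beta>))"
proof -
  let ?w = "disc_moment \<beta>"
  have w0: "0 \<le> ?w m" for m
    using disc_moment_pos[OF \<beta>, of m] by simp
  have inner: "(\<integral>\<^sup>+a. ennreal ((cmod (h (vec3 a b c)))\<^sup>2) * indicator polydisc (vec3 a b c) \<partial>disc_measure \<beta>)
    = (\<Sum>m. ennreal ((cmod (a m))\<^sup>2 * ?w m) * ennreal (cmod c ^ (2 * m)) * ennreal (cmod (poly p b) ^ (2 * m)))"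
    if bc: "cmod b < 1" "cmod c < 1" for b c
  proof -
    define l where "l = c * poly p b"
    have l: "cmod l < 1"
      unfolding l_def norm_mult using bc p[OF bc(1)] mult_strict_mono[of "cmod c" 1 "cmod (poly p b)" 1] by simp
    have cont: "continuous_on (ball 0 1) (\<lambda>z. h (vec3 z b c))"
      by (rule continuous_on_compose2[OF h]) (use bc in \<open>auto intro!: continuous_intros\<close>)
    have sums: "(\<lambda>m. (a m * l ^ m) * z ^ m) sums h (vec3 z b c)" if z: "cmod z < 1" for z
    proof -
      have "cmod (z * l) < 1"
        unfolding norm_mult using z l mult_strict_mono[of "cmod z" 1 "cmod l" 1] by simp
      from F[OF this] show ?thesis
        using z bc by (simp add: hF power_mult_distrib l_def mult_ac)
    qed
    have "(\<integral>\<^sup>+a. ennreal ((cmod (h (vec3 a b c)))\<^sup>2) * indicator polydisc (vec3 a b c) \<partial>disc_measure \<beta>)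
      = (\<integral>\<^sup>+z. ennreal ((cmod (h (vec3 z b c)))\<^sup>2) * indicator (ball 0 1) z \<partial>disc_measure \<beta>)"
      using bc by (intro nn_integral_cong) (auto simp: indicator_def)
    also have "\<dots> = (\<Sum>m. ennreal ((cmod (a m * l ^ m))\<^sup>2) * ennreal (?w m))"
      by (rule disc_parseval_indicator[OF \<beta> cont sums])
    also have "\<dots> = (\<Sum>m. ennreal ((cmod (a m))\<^sup>2 * ?w m) * ennreal (cmod c ^ (2 * m)) * ennreal (cmod (poly p b) ^ (2 * m)))"
      using w0 by (intro suminf_cong)
        (simp add: l_def norm_mult norm_power power_mult_distrib power_mult[symmetric] ennreal_mult[symmetric] mult_ac)
    finally show ?thesis .
  qed
  let ?N = "\<lambda>m. \<integral>\<^sup>+z. ennreal (cmod (poly p z) ^ (2 * m)) \<partial>disc_measure \<beta>"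
  have "bergman_sqnorm \<beta> h = (\<integral>\<^sup>+c. \<integral>\<^sup>+b. (\<Sum>m. ennreal ((cmod (a m))\<^sup>2 * ?w m) * ennreal (cmod c ^ (2 * m)) * ennreal (cmod (poly p b) ^ (2 * m)))
        \<partial>disc_measure \<beta> \<partial>disc_measure \<beta>)"
    unfolding bergman_sqnorm_iterated(2)[OF \<beta> h]
  proof -
    have "AE b in disc_measure \<beta>. (\<integral>\<^sup>+a. ennreal ((cmod (h (vec3 a b c)))\<^sup>2) * indicator polydisc (vec3 a b c) \<partial>disc_measure \<beta>)
      = (\<Sum>m. ennreal ((cmod (a m))\<^sup>2 * ?w m) * ennreal (cmod c ^ (2 * m)) * ennreal (cmod (poly p b) ^ (2 * m)))"
      if "cmod c < 1" for c
      using AE_disc_measure[of \<beta>] by eventually_elim (rule inner[OF _ that])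
    from nn_integral_cong_AE[OF this]
    show "(\<integral>\<^sup>+c. \<integral>\<^sup>+b. \<integral>\<^sup>+a. ennreal ((cmod (h (vec3 a b c)))\<^sup>2) * indicator polydisc (vec3 a b c)
        \<partial>disc_measure \<beta> \<partial>disc_measure \<beta> \<partial>disc_measure \<beta>)
      = (\<integral>\<^sup>+c. \<integral>\<^sup>+b. (\<Sum>m. ennreal ((cmod (a m))\<^sup>2 * ?w m) * ennreal (cmod c ^ (2 * m)) * ennreal (cmod (poly p b) ^ (2 * m)))
        \<partial>disc_measure \<beta> \<partial>disc_measure \<beta>)"
      by (intro nn_integral_cong_AE, use AE_disc_measure[of \<beta>] in eventually_elim) simp
  qed
  also have "\<dots> = (\<Sum>m. ennreal ((cmod (a m))\<^sup>2 * ?w m) * ennreal (?w m) * ?N m)"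
    by (simp add: nn_integral_suminf nn_integral_cmult nn_integral_multc nn_integral_disc_moment[OF \<beta>])
  also have "\<dots> = (\<Sum>m. ennreal ((cmod (a m))\<^sup>2 * (?w m)\<^sup>2) * ?N m)"
    using w0 by (intro suminf_cong) (simp add: power2_eq_square[of "?w _"] ennreal_mult mult_ac)
  finally show ?thesis .
qed

section \<open>Norms of composed functions\<close>

definition comp_symbol :: "complex poly \<Rightarrow> complex ^ 3 \<Rightarrow> complex ^ 3" where
  "comp_symbol p z = vec3 (z $ 1 * z $ 3 * poly p (z $ 2)) (z $ 1 * z $ 3 * poly p (z $ 2)) 0"

text \<open>The hypothesis \<open>bound\<close> pays for the factor m + 1 lost in
  \<open>diagonal_coeff_bound\<close>, and the slice inequality leads from the bidisc back to the
  norm of f.\<close>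

lemma bergman_sqnorm_comp_le:
  assumes \<beta>: "\<beta> > -1" "\<beta> \<le> 0" and f: "f \<in> bergman_space \<beta>"
    and p: "\<And>z. cmod z < 1 \<Longrightarrow> cmod (poly p z) < 1"
    and bound: "\<And>m. ennreal (real (Suc m)) * (\<integral>\<^sup>+z. ennreal (cmod (poly p z) ^ (2 * m)) \<partial>disc_measure \<beta>) \<le> ennreal B"
    and comp_cont: "continuous_on polydisc (comp_op (comp_symbol p) f)"
  shows "bergman_sqnorm \<beta> (comp_op (comp_symbol p) f) \<le> ennreal B * bergman_sqnorm \<beta> f"
proof -
  let ?w = "disc_moment \<beta>"
  have holo: "holo_on f polydisc" and fin: "bergman_sqnorm \<beta> f < \<infinity>"
    using f by (auto simp: bergman_space_def)
  define g where "g a b = f (vec3 a b 0)" for a b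
  interpret bidisc_holomorphic g \<beta>
  proof
    have "continuous_on (ball 0 1 \<times> ball 0 1) (\<lambda>x. f (vec3 (fst x) (snd x) 0))"
      by (rule continuous_on_compose2[OF holo_on_imp_continuous_on[OF holo]])
        (auto intro!: continuous_intros)
    then show "continuous_on (ball 0 1 \<times> ball 0 1) (\<lambda>(a, b). g a b)"
      by (simp add: g_def split_beta')
    show "(\<lambda>a. g a b) holomorphic_on ball 0 1" if "cmod b < 1" for b
      unfolding g_def using that by (intro holo_on_vec3_holomorphic[OF holo]) auto
    show "g a holomorphic_on ball 0 1" if "cmod a < 1" for a
      unfolding g_def[abs_def] using that by (intro holo_on_vec3_holomorphic[OF holo]) auto
  qed (use \<beta> in auto)
  have le: "sqnorm \<le> bergman_sqnorm \<beta> f"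
    unfolding sqnorm_def g_def by (rule bidisc_sqnorm_le[OF \<beta>(1) holo])
  then have "sqnorm < \<infinity>"
    using fin by simp
  define a where "a m = (\<Sum>j\<le>m. c j (m - j))" for m
  let ?N = "\<lambda>m. \<integral>\<^sup>+z. ennreal (cmod (poly p z) ^ (2 * m)) \<partial>disc_measure \<beta>"
  have "bergman_sqnorm \<beta> (comp_op (comp_symbol p) f) = (\<Sum>m. ennreal ((cmod (a m))\<^sup>2 * (?w m)\<^sup>2) * ?N m)"
  proof (rule bergman_sqnorm_composite[OF \<beta>(1) comp_cont p])
    show "(\<lambda>m. a m * w ^ m) sums g w w" if "cmod w < 1" for w
      unfolding a_def using diagonal_sums[OF \<open>sqnorm < \<infinity>\<close> that] .
  qed (auto simp: comp_op_def comp_symbol_def g_def)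
  also have "\<dots> \<le> (\<Sum>m. ennreal B * ennreal ((cmod (a m))\<^sup>2 * ((?w m)\<^sup>2 / real (Suc m))))"
  proof (intro suminf_le)
    fix m
    have "ennreal ((cmod (a m))\<^sup>2 * (?w m)\<^sup>2) = ennreal ((cmod (a m))\<^sup>2 * ((?w m)\<^sup>2 / real (Suc m))) * ennreal (real (Suc m))"
      by (subst ennreal_mult[symmetric]) (auto simp del: of_nat_Suc)
    then have "ennreal ((cmod (a m))\<^sup>2 * (?w m)\<^sup>2) * ?N m
      = ennreal ((cmod (a m))\<^sup>2 * ((?w m)\<^sup>2 / real (Suc m))) * (ennreal (real (Suc m)) * ?N m)"
      by (simp only: mult.assoc)
    also have "\<dots> \<le> ennreal ((cmod (a m))\<^sup>2 * ((?w m)\<^sup>2 / real (Suc m))) * ennreal B"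
      by (intro mult_left_mono bound) auto
    finally show "ennreal ((cmod (a m))\<^sup>2 * (?w m)\<^sup>2) * ?N m \<le> ennreal B * ennreal ((cmod (a m))\<^sup>2 * ((?w m)\<^sup>2 / real (Suc m)))"
      by (simp only: mult.commute)
  qed auto
  also have "\<dots> = ennreal B * (\<Sum>m. ennreal ((cmod (a m))\<^sup>2 * ((?w m)\<^sup>2 / real (Suc m))))"
    by simp
  also have "\<dots> \<le> ennreal B * bergman_sqnorm \<beta> f"
    unfolding a_def by (intro mult_left_mono order_trans[OF diagonal_coeff_bound le]) auto
  finally show ?thesis .
qed

text \<open>The middle third of the antidiagonal of degree 3N: both exponents run through [N, 2N],
  so the monomials have comparable norms and equal coefficients nearly saturate
  Cauchy-Schwarz.\<close>

definition diagonal_test :: "nat \<Rightarrow> complex ^ 3 \<Rightarrow> complex" where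
  "diagonal_test N z = (\<Sum>l=N..2*N. z $ 1 ^ (3 * N - l) * z $ 2 ^ l)"

lemma continuous_on_diagonal_test: "continuous_on S (diagonal_test N)"
  unfolding diagonal_test_def by (intro continuous_intros)

lemma bergman_sqnorm_diagonal_test:
  assumes \<beta>: "\<beta> > -1"
  shows "bergman_sqnorm \<beta> (diagonal_test N) \<le> ennreal (real (Suc N) * (disc_moment \<beta> N)\<^sup>2)"
proof -
  let ?w = "disc_moment \<beta>"
  interpret P: prob_space "disc_measure \<beta>"
    by (rule prob_space_disc_measure[OF \<beta>])
  have w0: "0 \<le> ?w m" for m
    using disc_moment_pos[OF \<beta>, of m] by simp
  have inner: "(\<integral>\<^sup>+b. \<integral>\<^sup>+c. ennreal ((cmod (diagonal_test N (vec3 a b c)))\<^sup>2) * indicator polydisc (vec3 a b c) \<partial>disc_measure \<beta> \<partial>disc_measure \<beta>)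
      \<le> (\<Sum>l=N..2*N. ennreal (cmod a ^ (2 * (3 * N - l))) * ennreal (?w l))" for a
  proof -
    define h where "h b = (\<Sum>l=N..2*N. a ^ (3 * N - l) * b ^ l)" for b
    define d where "d l = (if l \<in> {N..2*N} then a ^ (3 * N - l) else 0)" for l
    have "(\<integral>\<^sup>+b. \<integral>\<^sup>+c. ennreal ((cmod (diagonal_test N (vec3 a b c)))\<^sup>2) * indicator polydisc (vec3 a b c) \<partial>disc_measure \<beta> \<partial>disc_measure \<beta>)
      \<le> (\<integral>\<^sup>+b. \<integral>\<^sup>+c. ennreal ((cmod (h b))\<^sup>2) \<partial>disc_measure \<beta> \<partial>disc_measure \<beta>)"
      by (intro nn_integral_mono) (auto simp: indicator_def diagonal_test_def h_def)
    also have "\<dots> = (\<integral>\<^sup>+b. ennreal ((cmod (h b))\<^sup>2) \<partial>disc_measure \<beta>)"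
      using P.emeasure_space_1 by simp
    also have "\<dots> = (\<Sum>l. ennreal ((cmod (d l))\<^sup>2) * ennreal (?w l))"
    proof (rule disc_parseval[OF \<beta>])
      show "h \<in> borel_measurable borel"
        unfolding h_def by (intro borel_measurable_continuous_onI continuous_intros)
      have "(\<lambda>l. if l \<in> {N..2*N} then a ^ (3 * N - l) * z ^ l else 0) sums h z" for z
        unfolding h_def by (rule sums_If_finite_set) simp
      then show "(\<lambda>l. d l * z ^ l) sums h z" for z
        by (simp add: d_def if_distrib[of "\<lambda>x. x * _"] cong: if_cong)
    qed
    also have "\<dots> = (\<Sum>l=N..2*N. ennreal ((cmod (d l))\<^sup>2) * ennreal (?w l))"
      by (rule suminf_finite) (auto simp: d_def)
    also have "\<dots> = (\<Sum>l=N..2*N. ennreal (cmod a ^ (2 * (3 * N - l))) * ennreal (?w l))"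
      by (intro sum.cong refl) (simp add: d_def norm_power power_mult[symmetric] mult.commute)
    finally show ?thesis .
  qed
  have "bergman_sqnorm \<beta> (diagonal_test N) \<le> (\<integral>\<^sup>+a. (\<Sum>l=N..2*N. ennreal (cmod a ^ (2 * (3 * N - l))) * ennreal (?w l)) \<partial>disc_measure \<beta>)"
    unfolding bergman_sqnorm_iterated(1)[OF \<beta> continuous_on_diagonal_test] by (intro nn_integral_mono inner)
  also have "\<dots> = (\<Sum>l=N..2*N. ennreal (?w (3 * N - l)) * ennreal (?w l))"
    by (simp add: nn_integral_sum nn_integral_multc nn_integral_disc_moment[OF \<beta>])
  also have "\<dots> = ennreal (\<Sum>l=N..2*N. ?w (3 * N - l) * ?w l)"
    using w0 by (simp add: ennreal_mult[symmetric] sum_ennreal)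
  also have "\<dots> \<le> ennreal (\<Sum>l=N..2*N. ?w N * ?w N)"
    using w0 by (intro ennreal_leI sum_mono mult_mono disc_moment_antimono[OF \<beta>]) auto
  also have "\<dots> = ennreal (real (Suc N) * (?w N)\<^sup>2)"
    by (simp add: power2_eq_square Suc_diff_le)
  finally show ?thesis .
qed

text \<open>All N + 1 monomials collapse to one power of g, so N + 1 enters squared, whereas the
  squared norm of the test function contains it only once.\<close>

lemma bergman_sqnorm_comp_diagonal_test:
  assumes \<beta>: "\<beta> > -1"
    and p: "\<And>z. cmod z < 1 \<Longrightarrow> cmod (poly p z) < 1"
  shows "bergman_sqnorm \<beta> (comp_op (comp_symbol p) (diagonal_test N))
    = ennreal ((real (Suc N) * disc_moment \<beta> (3 * N))\<^sup>2) * (\<integral>\<^sup>+z. ennreal (cmod (poly p z) ^ (2 * (3 * N))) \<partial>disc_measure \<beta>)"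
proof -
  define a where "a m = (if m = 3 * N then of_nat (Suc N) else 0 :: complex)" for m
  have eq: "comp_op (comp_symbol p) (diagonal_test N) z = of_nat (Suc N) * (z $ 1 * z $ 3 * poly p (z $ 2)) ^ (3 * N)" for z
  proof -
    have "comp_op (comp_symbol p) (diagonal_test N) z = (\<Sum>l=N..2*N. (z $ 1 * z $ 3 * poly p (z $ 2)) ^ (3 * N))"
      unfolding comp_op_def diagonal_test_def comp_symbol_def o_def
      by (intro sum.cong) (auto simp: power_add[symmetric] simp del: power_mult_distrib)
    then show ?thesis
      by (simp add: Suc_diff_le)
  qed
  have "bergman_sqnorm \<beta> (comp_op (comp_symbol p) (diagonal_test N)) = (\<Sum>m. ennreal ((cmod (a m))\<^sup>2 * (disc_moment \<beta> m)\<^sup>2) *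
    (\<integral>\<^sup>+z. ennreal (cmod (poly p z) ^ (2 * m)) \<partial>disc_measure \<beta>))"
  proof (rule bergman_sqnorm_composite[OF \<beta> _ p])
    show "continuous_on polydisc (comp_op (comp_symbol p) (diagonal_test N))"
      unfolding eq[abs_def] by (intro continuous_intros)
    have "(\<lambda>m. if m = 3 * N then of_nat (Suc N) * w ^ m else 0) sums (of_nat (Suc N) * w ^ (3 * N))" for w :: complex
      by (rule sums_single)
    then show "(\<lambda>m. a m * w ^ m) sums (of_nat (Suc N) * w ^ (3 * N))" for w
      by (simp add: a_def if_distrib[of "\<lambda>x. x * _"] cong: if_cong del: of_nat_Suc)
  qed (simp_all add: eq)
  also have "\<dots> = (\<Sum>m\<in>{3 * N}. ennreal ((cmod (a m))\<^sup>2 * (disc_moment \<beta> m)\<^sup>2) *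
    (\<integral>\<^sup>+z. ennreal (cmod (poly p z) ^ (2 * m)) \<partial>disc_measure \<beta>))"
    by (rule suminf_finite) (auto simp: a_def)
  finally show ?thesis
    by (simp add: a_def power_mult_distrib del: of_nat_Suc)
qed

section \<open>Polynomial functions and their jets\<close>

text \<open>A class of functions closed under \<open>partial\<close>, so that smoothness up to the
  boundary reduces to continuity on the whole space.\<close>

inductive polyfun :: "(complex ^ 'd \<Rightarrow> complex) \<Rightarrow> bool" where
  const: "polyfun (\<lambda>z. c)"
| coord: "polyfun (\<lambda>z. z $ i)"
| add: "polyfun f \<Longrightarrow> polyfun g \<Longrightarrow> polyfun (\<lambda>z. f z + g z)"
| mult: "polyfun f \<Longrightarrow> polyfun g \<Longrightarrow> polyfun (\<lambda>z. f z * g z)"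

lemma polyfun_diff: "polyfun f \<Longrightarrow> polyfun g \<Longrightarrow> polyfun (\<lambda>z. f z - g z)"
  using polyfun.add[OF _ polyfun.mult[OF polyfun.const[of "-1"]], of f g] by simp

lemma polyfun_power: "polyfun f \<Longrightarrow> polyfun (\<lambda>z. f z ^ n)"
  by (induction n) (auto intro: polyfun.intros)

lemma polyfun_sum: "(\<And>x. x \<in> A \<Longrightarrow> polyfun (f x)) \<Longrightarrow> polyfun (\<lambda>z. \<Sum>x\<in>A. f x z)"
  by (induction A rule: infinite_finite_induct) (auto intro: polyfun.intros)

lemma polyfun_poly: "polyfun f \<Longrightarrow> polyfun (\<lambda>z. poly p (f z))"
  by (induction p) (auto intro: polyfun.intros)

lemma polyfun_continuous_on: "polyfun f \<Longrightarrow> continuous_on S f"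
  by (induction rule: polyfun.induct) (auto intro!: continuous_intros)

lemma polyfun_has_derivative:
  assumes "polyfun f"
  shows "\<exists>D. (f has_derivative D) (at z) \<and> (\<forall>c v. D (c *s v) = c * D v)"
  using assms
proof induction
  case (const c)
  show ?case by (intro exI[of _ "\<lambda>_. 0"]) auto
next
  case (coord i)
  have "((\<lambda>z :: complex ^ 'a. z $ i) has_derivative (\<lambda>z. z $ i)) (at z)"
    by (intro bounded_linear_imp_has_derivative bounded_linear_vec_nth)
  then show ?case by (intro exI[of _ "\<lambda>z. z $ i"]) simp
next
  case (add f g)
  then obtain D E where "(f has_derivative D) (at z)" "\<forall>c v. D (c *s v) = c * D v"
    "(g has_derivative E) (at z)" "\<forall>c v. E (c *s v) = c * E v" by blast
  then show ?case
    by (intro exI[of _ "\<lambda>v. D v + E v"]) (auto intro: has_derivative_add simp: algebra_simps)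
next
  case (mult f g)
  then obtain D E where "(f has_derivative D) (at z)" "\<forall>c v. D (c *s v) = c * D v"
    "(g has_derivative E) (at z)" "\<forall>c v. E (c *s v) = c * E v" by blast
  moreover from this have "((\<lambda>z. f z * g z) has_derivative (\<lambda>v. f z * E v + D v * g z)) (at z)"
    by (intro has_derivative_mult)
  ultimately show ?case
    by (intro exI[of _ "\<lambda>v. f z * E v + D v * g z"]) (auto simp: algebra_simps)
qed

lemma polyfun_holo_on: "polyfun f \<Longrightarrow> holo_on f S"
  using polyfun_has_derivative unfolding holo_on_def by blast

abbreviation upd :: "complex ^ 'd \<Rightarrow> 'd \<Rightarrow> complex \<Rightarrow> complex ^ 'd" where
  "upd z i w \<equiv> (\<chi> j. if j = i then w else z $ j)"

lemma upd_triv [simp]: "upd z i (z $ i) = z"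
  by (auto simp: vec_eq_iff)

text \<open>\<open>partial\<close> is built on \<open>deriv\<close>, whose sum and product rules ask
  for differentiability in the moving coordinate.\<close>

lemma polyfun_upd_field_differentiable:
  "polyfun f \<Longrightarrow> (\<lambda>w. f (upd z i w)) field_differentiable (at w)"
proof (induction rule: polyfun.induct)
  case (coord k)
  show ?case by (cases "k = i") auto
qed (auto intro!: field_differentiable_add field_differentiable_mult)

lemma partial_const: "partial i (\<lambda>z. c) = (\<lambda>z. 0)"
  by (simp add: partial_def fun_eq_iff)

lemma partial_coord: "partial i (\<lambda>z. z $ k) = (\<lambda>z. if k = i then 1 else 0)"
  by (simp add: partial_def fun_eq_iff)

lemma partial_add:
  assumes "polyfun f" "polyfun g"
  shows "partial i (\<lambda>z. f z + g z) = (\<lambda>z. partial i f z + partial i g z)"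
  unfolding partial_def fun_eq_iff using assms
  by (auto intro!: deriv_add polyfun_upd_field_differentiable)

lemma partial_mult:
  assumes "polyfun f" "polyfun g"
  shows "partial i (\<lambda>z. f z * g z) = (\<lambda>z. f z * partial i g z + partial i f z * g z)"
  unfolding partial_def fun_eq_iff using assms
  by (simp add: deriv_mult polyfun_upd_field_differentiable)

lemma polyfun_partial: "polyfun f \<Longrightarrow> polyfun (partial i f)"
proof (induction rule: polyfun.induct)
  case (const c)
  then show ?case by (simp add: partial_const polyfun.const)
next
  case (coord k)
  then show ?case by (simp add: partial_coord polyfun.const)
next
  case (add f g)
  then show ?case by (simp add: partial_add polyfun.add)
next
  case (mult f g)
  then show ?case by (simp add: partial_mult polyfun.add polyfun.mult)
qed

lemma polyfun_partial_funpow: "polyfun f \<Longrightarrow> polyfun ((partial i ^^ m) f)"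
  by (induction m) (auto intro: polyfun_partial)

lemma polyfun_multi_partial: "polyfun f \<Longrightarrow> polyfun (multi_partial \<alpha> f)"
  by (simp add: multi_partial_def polyfun_partial_funpow)

text \<open>Congruence modulo q^s. Requiring the cofactor to be polynomial is what allows the
  relation to be differentiated.\<close>

definition agree_mod :: "(complex ^ 'd \<Rightarrow> complex) \<Rightarrow> nat \<Rightarrow> (complex ^ 'd \<Rightarrow> complex) \<Rightarrow> (complex ^ 'd \<Rightarrow> complex) \<Rightarrow> bool" where
  "agree_mod q s f g \<longleftrightarrow> polyfun f \<and> polyfun g \<and> (\<exists>h. polyfun h \<and> f = (\<lambda>z. g z + q z ^ s * h z))"

lemma partial_power_Suc:
  assumes "polyfun q"
  shows "\<exists>r. polyfun r \<and> partial i (\<lambda>z. q z ^ Suc s) = (\<lambda>z. q z ^ s * r z)"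
proof (induction s)
  case 0
  then show ?case using polyfun_partial[OF assms] by auto
next
  case (Suc s)
  then obtain r where r: "polyfun r" "partial i (\<lambda>z. q z ^ Suc s) = (\<lambda>z. q z ^ s * r z)" by blast
  have "partial i (\<lambda>z. q z * q z ^ Suc s) = (\<lambda>z. q z * (q z ^ s * r z) + partial i q z * q z ^ Suc s)"
    unfolding partial_mult[OF assms polyfun_power[OF assms]] r(2) ..
  also have "\<dots> = (\<lambda>z. q z ^ Suc s * (r z + partial i q z))"
    by (simp add: algebra_simps)
  finally show ?case
    using r(1) polyfun_partial[OF assms, of i]
    by (intro exI[of _ "\<lambda>z. r z + partial i q z"]) (simp add: polyfun.add)
qed

text \<open>By the product rule the derivative of q^{s+1} h keeps a factor q^s: each derivative
  costs one power of q.\<close>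

lemma agree_mod_partial:
  assumes q: "polyfun q" and "agree_mod q (Suc s) f g"
  shows "agree_mod q s (partial i f) (partial i g)"
proof -
  obtain h where h: "polyfun f" "polyfun g" "polyfun h" "f = (\<lambda>z. g z + q z ^ Suc s * h z)"
    using assms unfolding agree_mod_def by blast
  obtain r where r: "polyfun r" "partial i (\<lambda>z. q z ^ Suc s) = (\<lambda>z. q z ^ s * r z)"
    using partial_power_Suc[OF q] by blast
  have "partial i f = (\<lambda>z. partial i g z + partial i (\<lambda>z. q z ^ Suc s * h z) z)"
    unfolding h(4) by (intro partial_add h polyfun.mult polyfun_power q)
  also have "\<dots> = (\<lambda>z. partial i g z + (q z ^ Suc s * partial i h z + (q z ^ s * r z) * h z))"
    unfolding partial_mult[OF polyfun_power[OF q] h(3)] r(2) ..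
  also have "\<dots> = (\<lambda>z. partial i g z + q z ^ s * (q z * partial i h z + r z * h z))"
    by (simp add: algebra_simps)
  finally have eq: "partial i f = \<dots>" .
  show ?thesis
    unfolding agree_mod_def
    by (intro conjI exI[of _ "\<lambda>z. q z * partial i h z + r z * h z"] eq
        polyfun_partial polyfun.add polyfun.mult q r(1) h(1-3))
qed

lemma agree_mod_partial_funpow:
  assumes q: "polyfun q"
  shows "agree_mod q (m + s) f g \<Longrightarrow> agree_mod q s ((partial i ^^ m) f) ((partial i ^^ m) g)"
proof (induction m arbitrary: s)
  case (Suc m)
  then have "agree_mod q (Suc s) ((partial i ^^ m) f) ((partial i ^^ m) g)"
    by simp
  then show ?case
    using agree_mod_partial[OF q] by simp
qed simp

lemma agree_mod_multi_partial:
  fixes \<alpha> :: "nat ^ 3"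
  assumes q: "polyfun q" and "agree_mod q ((\<Sum>i\<in>UNIV. \<alpha> $ i) + s) f g"
  shows "agree_mod q s (multi_partial \<alpha> f) (multi_partial \<alpha> g)"
  unfolding multi_partial_def
  by (intro agree_mod_partial_funpow[OF q]) (use assms(2) in \<open>simp add: sum_3 add_ac\<close>)

section \<open>Boundary values and frontier of the closed polydisc; bounds for the profiles\<close>

lemma closed_polydisc_subset_closure: "(closed_polydisc :: (complex ^ 'd) set) \<subseteq> closure polydisc"
proof
  fix z :: "complex ^ 'd" assume z: "z \<in> closed_polydisc"
  have "(\<lambda>n. (real n / real (Suc n)) *\<^sub>R z) \<longlonglongrightarrow> 1 *\<^sub>R z"
    by (intro tendsto_scaleR LIMSEQ_n_over_Suc_n tendsto_const)
  moreover have "(real n / real (Suc n)) *\<^sub>R z \<in> polydisc" for n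
  proof -
    have "real n / real (Suc n) * cmod (z $ i) < 1" for i
    proof -
      have "real n / real (Suc n) * cmod (z $ i) \<le> real n / real (Suc n) * 1"
        using z by (intro mult_left_mono) (auto simp: closed_polydisc_def)
      also have "\<dots> < 1" by simp
      finally show ?thesis .
    qed
    then show ?thesis
      by (simp add: polydisc_def)
  qed
  ultimately show "z \<in> closure polydisc"
    unfolding closure_sequential by (intro exI[of _ "\<lambda>n. (real n / real (Suc n)) *\<^sub>R z"]) simp
qed

lemma bdry_ext_eq:
  fixes g :: "complex ^ 'd \<Rightarrow> complex ^ 'd"
  assumes "continuous_on UNIV g" "z \<in> closed_polydisc"
  shows "bdry_ext g z = g z"
proof -
  \<comment> \<open>A limit determines \<open>Lim\<close> only along a nontrivial filter, that is,
    when z is a limit point of the open polydisc.\<close>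
  have "z islimpt polydisc"
  proof (cases "z \<in> polydisc")
    case True
    then show ?thesis
      by (intro interior_limit_point) (simp add: interior_open open_polydisc)
  next
    case False
    then show ?thesis
      using closed_polydisc_subset_closure assms(2) by (auto simp: closure_def)
  qed
  then have "\<not> trivial_limit (at z within polydisc)"
    by (simp add: trivial_limit_within)
  moreover have "(g \<longlongrightarrow> g z) (at z within polydisc)"
    using assms(1) by (meson continuous_on_def iso_tuple_UNIV_I subset_UNIV tendsto_within_subset)
  ultimately show ?thesis
    unfolding bdry_ext_def by (rule tendsto_Lim)
qed

lemma closed_closed_polydisc: "closed (closed_polydisc :: (complex ^ 'd) set)"
proof -
  have "closed_polydisc = (\<Inter>i. (\<lambda>z :: complex ^ 'd. z $ i) -` cball 0 1)"
    by (auto simp: closed_polydisc_def)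
  also have "closed \<dots>"
    by (intro closed_INT ballI closed_vimage continuous_on_component continuous_on_id closed_cball)
  finally show ?thesis .
qed

lemma frontier_closed_polydisc:
  "frontier (closed_polydisc :: (complex ^ 'd) set) = closed_polydisc - polydisc"
proof -
  have "interior closed_polydisc = (polydisc :: (complex ^ 'd) set)"
  proof (rule interior_unique)
    show "polydisc \<subseteq> (closed_polydisc :: (complex ^ 'd) set)"
      by (auto simp: polydisc_def closed_polydisc_def less_imp_le)
    fix T :: "(complex ^ 'd) set" assume T: "T \<subseteq> closed_polydisc" "open T"
    show "T \<subseteq> polydisc"
    proof
      fix z assume "z \<in> T"
      then obtain e where e: "e > 0" "ball z e \<subseteq> T"
        using T(2) openE by blast
      \<comment> \<open>Small enough that (1 + t) z stays in the ball, with the summand 1 guarding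
        against z = 0. Since the dilated point still has coordinates of modulus at most 1, those of
        z are strictly smaller.\<close>
      define t where "t = e / (2 * (norm z + 1))"
      have "norm z + 1 > 0"
        using norm_ge_zero[of z] by linarith
      then have t: "t > 0"
        using e by (simp add: t_def)
      have "t * norm z < t * (2 * (norm z + 1))"
        using t \<open>norm z + 1 > 0\<close> by (intro mult_strict_left_mono) auto
      also have "\<dots> = e"
        using \<open>norm z + 1 > 0\<close> by (simp add: t_def)
      finally have "dist z ((1 + t) *\<^sub>R z) < e"
        using t by (simp add: dist_norm scaleR_add_left)
      then have "(1 + t) *\<^sub>R z \<in> closed_polydisc"
        using e T(1) by auto
      then have le: "(1 + t) * cmod (z $ i) \<le> 1" for i
        using t by (simp add: closed_polydisc_def)
      have "cmod (z $ i) < 1" for i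
      proof (rule ccontr)
        assume "\<not> cmod (z $ i) < 1"
        then have "(1 + t) * 1 \<le> (1 + t) * cmod (z $ i)"
          using t by (intro mult_left_mono) auto
        then have "(1 + t) * 1 \<le> 1"
          using le[of i] by (rule order_trans)
        with t show False by simp
      qed
      then show "z \<in> polydisc"
        by (simp add: polydisc_def)
    qed
  qed (rule open_polydisc)
  then show ?thesis
    by (simp add: frontier_def closed_closed_polydisc)
qed

lemma profile_bound:
  assumes k: "1 \<le> k" "k \<le> K"
  shows "cmod z < 1 \<Longrightarrow> cmod (poly (profile K k) z) < 1"
    and "cmod z = 1 \<Longrightarrow> cmod (poly (profile K k) z) \<le> 1"
    and "cmod z = 1 \<Longrightarrow> cmod (poly (profile K k) z) = 1 \<longleftrightarrow> z = 1"
proof -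
  define q where "q z = z ^ K - z ^ (K - k) * (- ((1 - z)\<^sup>2) / 4) ^ k" for z :: complex
  have pq: "poly (profile K k) z = z * q z" for z
    by (simp add: poly_profile q_def)
  have circle: "cmod (poly (profile K k) z) \<le> 1" "cmod (poly (profile K k) z) = 1 \<longleftrightarrow> z = 1"
    if z: "cmod z = 1" for z
  proof -
    obtain t where t: "0 \<le> t" "t < 2 * pi" "z = cis t"
      using complex_unimodular_polar[OF z] by (metis cis.code)
    have c: "cmod (poly (profile K k) z) = 1 - sin (t / 2) ^ (2 * k)"
      unfolding t(3) by (rule cmod_profile_cis[OF k(2)])
    then show "cmod (poly (profile K k) z) \<le> 1"
      by simp
    show "cmod (poly (profile K k) z) = 1 \<longleftrightarrow> z = 1"
    proof
      assume "cmod (poly (profile K k) z) = 1"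
      then have "sin (t / 2) = 0"
        using c k by simp
      \<comment> \<open>For 0 < t < 2 pi the half angle lies strictly between 0 and pi, where sin is
        positive.\<close>
      then have "t = 0"
        using sin_gt_zero[of "t / 2"] t by force
      then show "z = 1" by (simp add: t)
    next
      assume "z = 1"
      then show "cmod (poly (profile K k) z) = 1"
        using k by (simp add: poly_profile zero_power)
    qed
  qed
  show "cmod z = 1 \<Longrightarrow> cmod (poly (profile K k) z) \<le> 1"
    "cmod z = 1 \<Longrightarrow> cmod (poly (profile K k) z) = 1 \<longleftrightarrow> z = 1"
    using circle by auto
  assume z: "cmod z < 1"
  \<comment> \<open>The maximum principle is applied to p(z)/z: the result |p(z)| <= |z| is strictly
    below 1 inside the disc although p reaches modulus 1 on the circle.\<close>
  have "cmod (q z) \<le> 1"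
  proof (rule maximum_modulus_frontier[of q "cball 0 1"])
    show "q holomorphic_on interior (cball 0 1)"
      unfolding q_def by (intro holomorphic_intros) auto
    show "continuous_on (closure (cball 0 1)) q"
      unfolding q_def by (intro continuous_intros) auto
    show "cmod (q w) \<le> 1" if "w \<in> frontier (cball 0 1)" for w
      using circle(1)[of w] that by (simp add: pq norm_mult)
  qed (use z in auto)
  then have "cmod z * cmod (q z) \<le> cmod z"
    by (simp add: mult_left_le)
  with z show "cmod (poly (profile K k) z) < 1"
    by (simp add: pq norm_mult)
qed

section \<open>The symbols\<close>

lemma comp_symbol_nth:
  "comp_symbol p z $ 1 = z $ 1 * z $ 3 * poly p (z $ 2)"
  "comp_symbol p z $ 2 = z $ 1 * z $ 3 * poly p (z $ 2)"
  "comp_symbol p z $ 3 = 0"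
  by (simp_all add: comp_symbol_def)

lemma polyfun_comp_symbol: "polyfun (\<lambda>z. comp_symbol p z $ j)"
proof -
  have "polyfun (\<lambda>z :: complex ^ 3. z $ 1 * z $ 3 * poly p (z $ 2))"
    by (intro polyfun.mult polyfun_poly polyfun.coord)
  then show ?thesis
    using exhaust_3[of j] by (auto simp: comp_symbol_nth polyfun.const)
qed

lemma continuous_on_map_partial_comp_symbol: "continuous_on S (map_partial \<alpha> (comp_symbol p))"
  unfolding map_partial_def
  by (intro continuous_on_vec_lambda polyfun_continuous_on polyfun_multi_partial polyfun_comp_symbol)

lemma continuous_on_comp_symbol: "continuous_on S (comp_symbol p)"
proof -
  have "continuous_on S (\<lambda>z. \<chi> j. comp_symbol p z $ j)"
    by (intro continuous_on_vec_lambda polyfun_continuous_on polyfun_comp_symbol)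
  then show ?thesis by simp
qed

lemma comp_symbol_smooth: "comp_symbol p \<in> smooth_up_to_boundary"
  using continuous_on_map_partial_comp_symbol
  unfolding smooth_up_to_boundary_def extends_continuously_def by blast

lemma comp_symbol_mem_polydisc:
  assumes p: "\<And>w. cmod w < 1 \<Longrightarrow> cmod (poly p w) < 1" and z: "z \<in> polydisc"
  shows "comp_symbol p z \<in> polydisc"
proof -
  have zi: "cmod (z $ i) < 1" for i
    using z by (simp add: polydisc_def)
  have "cmod (z $ 1) * cmod (z $ 3) \<le> 1"
    using zi[of 1] zi[of 3] by (intro mult_le_one) auto
  then have "cmod (z $ 1) * cmod (z $ 3) * cmod (poly p (z $ 2)) \<le> cmod (poly p (z $ 2))"
    by (intro mult_left_le_one_le) auto
  then have "cmod (z $ 1 * z $ 3 * poly p (z $ 2)) < 1"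
    using p[OF zi[of 2]] by (simp add: norm_mult)
  then show ?thesis
    by (simp add: comp_symbol_def)
qed

lemma comp_symbol_holo_self_maps:
  assumes "\<And>w. cmod w < 1 \<Longrightarrow> cmod (poly p w) < 1"
  shows "comp_symbol p \<in> holo_self_maps"
  using comp_symbol_mem_polydisc[OF assms] polyfun_holo_on[OF polyfun_comp_symbol]
  by (auto simp: holo_self_maps_def)

lemma holo_on_comp_symbol:
  assumes p: "\<And>w. cmod w < 1 \<Longrightarrow> cmod (poly p w) < 1" and f: "holo_on f polydisc"
  shows "holo_on (comp_op (comp_symbol p) f) polydisc"
  unfolding holo_on_def
proof
  fix z :: "complex ^ 3" assume z: "z \<in> polydisc"
  define g where "g z = comp_symbol p z $ 1" for z
  \<comment> \<open>The symbol is a scalar function times a fixed vector, so its derivative is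
    complex linear as soon as that of the scalar is.\<close>
  have eq: "comp_symbol p = (\<lambda>z. g z *s vec3 1 1 0)"
    by (simp add: fun_eq_iff vec_eq_iff forall_3 comp_symbol_nth g_def)
  obtain D where D: "(g has_derivative D) (at z)" "\<And>c v. D (c *s v) = c * D v"
    unfolding g_def using polyfun_has_derivative[OF polyfun_comp_symbol] by blast
  obtain E where E: "(f has_derivative E) (at (comp_symbol p z))" "\<And>c v. E (c *s v) = c * E v"
    using f comp_symbol_mem_polydisc[OF p z] unfolding holo_on_def by blast
  have "(comp_symbol p has_derivative (\<lambda>v. D v *s vec3 1 1 0)) (at z)"
    unfolding eq by (rule bounded_linear.has_derivative[OF bounded_linear_scaleC D(1)])
  from has_derivative_compose[OF this E(1)]
  have "(comp_op (comp_symbol p) f has_derivative (\<lambda>v. E (D v *s vec3 1 1 0))) (at z)"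
    by (simp add: comp_op_def o_def)
  then show "\<exists>D. (comp_op (comp_symbol p) f has_derivative D) (at z) \<and> (\<forall>c v. D (c *s v) = c * D v)"
    by (intro exI[of _ "\<lambda>v. E (D v *s vec3 1 1 0)"]) (auto simp: D(2) E(2))
qed

text \<open>A product of numbers in [0, 1] equals 1 only if every factor does. The resulting set is
  free of k and K, which is what gives two symbols the same contact set.\<close>

lemma contact_set_comp_symbol:
  assumes k: "1 \<le> k" "k \<le> K"
  shows "contact_set (comp_symbol (profile K k)) = {z \<in> closed_polydisc. cmod (z $ 1) = 1 \<and> z $ 2 = 1 \<and> cmod (z $ 3) = 1}"
proof -
  let ?p = "profile K k"
  have "comp_symbol ?p z \<in> frontier closed_polydisc \<longleftrightarrow> cmod (z $ 1) = 1 \<and> z $ 2 = 1 \<and> cmod (z $ 3) = 1"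
    if "z \<in> closed_polydisc" for z
  proof -
    have zi: "cmod (z $ i) \<le> 1" for i
      using that by (simp add: closed_polydisc_def)
    let ?q = "cmod (poly ?p (z $ 2))"
    have q: "?q \<le> 1" "?q = 1 \<longleftrightarrow> z $ 2 = 1"
      using profile_bound[OF k, of "z $ 2"] zi[of 2] by (cases "cmod (z $ 2) = 1"; force)+
    have prod: "x * y \<le> 1" "x * y = 1 \<longleftrightarrow> x = 1 \<and> y = 1" if "0 \<le> x" "x \<le> 1" "0 \<le> y" "y \<le> 1" for x y :: real
    proof -
      show "x * y \<le> 1"
        using that by (intro mult_le_one) auto
      have "x * y \<le> x" "x * y \<le> y"
        using that by (auto intro: mult_left_le mult_left_le_one_le)
      then show "x * y = 1 \<longleftrightarrow> x = 1 \<and> y = 1"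
        using that by auto
    qed
    have le: "cmod (z $ 1) * cmod (z $ 3) * ?q \<le> 1"
      using zi q by (intro prod(1) mult_nonneg_nonneg) auto
    have "comp_symbol ?p z \<in> frontier closed_polydisc \<longleftrightarrow> cmod (z $ 1) * cmod (z $ 3) * ?q = 1"
      unfolding frontier_closed_polydisc
      using le by (auto simp: closed_polydisc_def polydisc_def forall_3 comp_symbol_nth norm_mult)
    also have "\<dots> \<longleftrightarrow> cmod (z $ 1) = 1 \<and> cmod (z $ 3) = 1 \<and> ?q = 1"
      using zi q prod(2)[of "cmod (z $ 1) * cmod (z $ 3)" ?q] prod(1,2)[of "cmod (z $ 1)" "cmod (z $ 3)"] by auto
    finally show ?thesis
      using q(2) by auto
  qed
  then show ?thesis
    using bdry_ext_eq[OF continuous_on_comp_symbol] unfolding contact_set_def by auto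
qed

text \<open>With u = -(1-w)^2/4 the profiles of exponents k and 2k, both with K = 2k, differ by w
  u^k (u^k - w^k), and u^k is a constant times (1-w)^{2k}.\<close>

lemma agree_mod_comp_symbol:
  assumes "1 \<le> k"
  shows "agree_mod (\<lambda>z. 1 - z $ 2) (2 * k) (\<lambda>z. comp_symbol (profile (2 * k) k) z $ j)
    (\<lambda>z. comp_symbol (profile (2 * k) (2 * k)) z $ j)"
proof -
  define u where "u w = - ((1 - w)\<^sup>2) / 4" for w :: complex
  define h where "h z = z $ 1 * z $ 3 * (z $ 2 * ((- 1 / 4) ^ k * (u (z $ 2) ^ k - z $ 2 ^ k)))" for z :: "complex ^ 3"
  have u: "u w ^ k = (1 - w) ^ (2 * k) * (- 1 / 4) ^ k" for w
  proof -
    have "u w = (1 - w)\<^sup>2 * (- 1 / 4)"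
      by (simp add: u_def)
    then show ?thesis
      by (simp only: power_mult_distrib power_mult)
  qed
  have P: "poly (profile (2 * k) k) w = poly (profile (2 * k) (2 * k)) w
      + (1 - w) ^ (2 * k) * (w * ((- 1 / 4) ^ k * (u w ^ k - w ^ k)))" for w
  proof -
    have 1: "poly (profile (2 * k) k) w = w * (w ^ (2 * k) - w ^ k * u w ^ k)"
      "poly (profile (2 * k) (2 * k)) w = w * (w ^ (2 * k) - u w ^ k * u w ^ k)"
      by (simp_all add: poly_profile u_def power_add[symmetric] mult_2[symmetric])
    have "poly (profile (2 * k) k) w = poly (profile (2 * k) (2 * k)) w + u w ^ k * (w * (u w ^ k - w ^ k))"
      unfolding 1 by (simp add: algebra_simps)
    also have "u w ^ k * (w * (u w ^ k - w ^ k)) = (1 - w) ^ (2 * k) * (w * ((- 1 / 4) ^ k * (u w ^ k - w ^ k)))"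
      using u[of w] by (metis (no_types, lifting) mult.assoc mult.left_commute)
    finally show ?thesis .
  qed
  have eq: "z $ 1 * z $ 3 * poly (profile (2 * k) k) (z $ 2)
    = z $ 1 * z $ 3 * poly (profile (2 * k) (2 * k)) (z $ 2) + (1 - z $ 2) ^ (2 * k) * h z" for z :: "complex ^ 3"
    by (subst P) (simp add: h_def distrib_left mult_ac)
  \<comment> \<open>Expanded into an explicit polynomial so that \<open>polyfun_poly\<close>
    recognizes it.\<close>
  have "u w = poly [:- 1 / 4, 1 / 2, - 1 / 4:] w" for w
    by (simp add: u_def power2_eq_square field_simps)
  then have "polyfun (\<lambda>z :: complex ^ 3. u (z $ 2))"
    by (simp only: polyfun_poly polyfun.coord)
  then have h: "polyfun h"
    unfolding h_def by (intro polyfun.mult polyfun.coord polyfun.const polyfun_diff polyfun_power)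
  define h' where "h' z = (if j = 3 then 0 else h z)" for z
  have "polyfun h'"
    unfolding h'_def using h by (cases "j = 3") (auto intro: polyfun.const)
  moreover have "comp_symbol (profile (2 * k) k) z $ j
    = comp_symbol (profile (2 * k) (2 * k)) z $ j + (1 - z $ 2) ^ (2 * k) * h' z" for z
    using exhaust_3[of j] eq by (auto simp: comp_symbol_nth h'_def)
  ultimately show ?thesis
    unfolding agree_mod_def using polyfun_comp_symbol by blast
qed

text \<open>As the order of differentiation is below 2k, at least one factor 1 - z_2 of the
  difference survives, and it vanishes where z_2 = 1.\<close>

lemma bdry_ext_map_partial_comp_symbol:
  fixes \<alpha> :: "nat ^ 3" and z :: "complex ^ 3"
  assumes k: "1 \<le> k" and \<alpha>: "(\<Sum>i\<in>UNIV. \<alpha> $ i) < 2 * k" and z: "z \<in> closed_polydisc" "z $ 2 = 1"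
  shows "bdry_ext (map_partial \<alpha> (comp_symbol (profile (2 * k) k))) z
    = bdry_ext (map_partial \<alpha> (comp_symbol (profile (2 * k) (2 * k)))) z"
proof -
  define s where "s = 2 * k - (\<Sum>i\<in>UNIV. \<alpha> $ i)"
  have s: "s > 0" "2 * k = (\<Sum>i\<in>UNIV. \<alpha> $ i) + s"
    using \<alpha> by (auto simp: s_def)
  have q: "polyfun (\<lambda>z :: complex ^ 3. 1 - z $ 2)"
    by (intro polyfun_diff polyfun.const polyfun.coord)
  have "multi_partial \<alpha> (\<lambda>z. comp_symbol (profile (2 * k) k) z $ j) z
    = multi_partial \<alpha> (\<lambda>z. comp_symbol (profile (2 * k) (2 * k)) z $ j) z" for j
    using agree_mod_multi_partial[OF q agree_mod_comp_symbol[OF k, of j, unfolded s(2)]] z(2) s(1)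
    unfolding s(2)[symmetric] agree_mod_def by (auto simp: fun_eq_iff)
  then have "map_partial \<alpha> (comp_symbol (profile (2 * k) k)) z = map_partial \<alpha> (comp_symbol (profile (2 * k) (2 * k))) z"
    by (simp add: map_partial_def)
  then show ?thesis
    by (simp add: bdry_ext_eq[OF continuous_on_map_partial_comp_symbol z(1)])
qed

section \<open>Continuity at the threshold and its failure beyond it\<close>

lemma comp_op_continuous_comp_symbol:
  assumes k: "1 \<le> k" "k \<le> K" and \<beta>: "\<beta> = - 1 / (2 * real k)"
  shows "comp_op_continuous \<beta> (comp_symbol (profile K k))"
proof -
  let ?p = "profile K k"
  have \<beta>1: "\<beta> > -1" "\<beta> \<le> 0"
    using k by (auto simp: \<beta>)
  have holo: "holo_on (comp_op (comp_symbol ?p) f) polydisc" if "f \<in> bergman_space \<beta>" for f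
    using that by (intro holo_on_comp_symbol profile_bound[OF k]) (auto simp: bergman_space_def)
  have le: "bergman_sqnorm \<beta> (comp_op (comp_symbol ?p) f) \<le> ennreal (2 * pi) * bergman_sqnorm \<beta> f"
    if f: "f \<in> bergman_space \<beta>" for f
    using profile_sqnorm_bounded[OF k \<beta>] holo_on_imp_continuous_on[OF holo[OF f]]
    by (intro bergman_sqnorm_comp_le[OF \<beta>1 f profile_bound(1)[OF k]]) (auto simp: profile_sqnorm_def)
  have fin: "bergman_sqnorm \<beta> f < \<infinity>" if "f \<in> bergman_space \<beta>" for f
    using that by (simp add: bergman_space_def)
  have fin': "ennreal (2 * pi) * bergman_sqnorm \<beta> f < \<infinity>" if "f \<in> bergman_space \<beta>" for f
    using fin[OF that] by (simp add: ennreal_mult_less_top)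
  have "comp_op (comp_symbol ?p) f \<in> bergman_space \<beta>" if "f \<in> bergman_space \<beta>" for f
    using holo[OF that] order.strict_trans1[OF le[OF that] fin'[OF that]] by (simp add: bergman_space_def)
  moreover have "bergman_norm \<beta> (comp_op (comp_symbol ?p) f) \<le> sqrt (2 * pi) * bergman_norm \<beta> f"
    if "f \<in> bergman_space \<beta>" for f
  proof -
    have "enn2real (bergman_sqnorm \<beta> (comp_op (comp_symbol ?p) f)) \<le> enn2real (ennreal (2 * pi) * bergman_sqnorm \<beta> f)"
      using le[OF that] fin'[OF that] by (intro enn2real_mono) auto
    also have "\<dots> = 2 * pi * enn2real (bergman_sqnorm \<beta> f)"
      by (simp add: enn2real_mult)
    finally show ?thesis
      unfolding bergman_norm_def real_sqrt_mult[symmetric] by (rule real_sqrt_le_mono)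
  qed
  ultimately show ?thesis
    unfolding comp_op_continuous_def by blast
qed

lemma diagonal_test_bergman_space:
  assumes "\<beta> > -1"
  shows "diagonal_test N \<in> bergman_space \<beta>"
proof -
  have "polyfun (diagonal_test N)"
    unfolding diagonal_test_def[abs_def]
    by (intro polyfun_sum polyfun.mult polyfun_power polyfun.coord)
  then show ?thesis
    using bergman_sqnorm_diagonal_test[OF assms, of N]
    by (auto simp: bergman_space_def polyfun_holo_on less_top[symmetric] top_unique)
qed

text \<open>With b = beta + 1 and s = 1/(2k), the test functions compare (N+1)^2 N^{-2b} N^{-b-s}
  with (N+1) N^{-2b}, up to constants. Continuity would therefore bound N^{1-b-s}, against
  \<open>gap\<close>.\<close>

lemma not_comp_op_continuous_comp_symbol:
  assumes \<beta>: "\<beta> > -1" "\<beta> \<le> 0" and k: "1 \<le> k" "k \<le> K" and gap: "\<beta> + 1 + 1 / (2 * real k) < 1"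
  shows "\<not> comp_op_continuous \<beta> (comp_symbol (profile K k))"
proof
  let ?p = "profile K k" and ?w = "disc_moment \<beta>"
  assume "comp_op_continuous \<beta> (comp_symbol ?p)"
  then obtain B where B: "\<And>f. f \<in> bergman_space \<beta> \<Longrightarrow> bergman_norm \<beta> (comp_op (comp_symbol ?p) f) \<le> B * bergman_norm \<beta> f"
    and maps: "\<And>f. f \<in> bergman_space \<beta> \<Longrightarrow> comp_op (comp_symbol ?p) f \<in> bergman_space \<beta>"
    unfolding comp_op_continuous_def by blast
  obtain c where c: "c > 0"
    "\<And>m. m \<ge> 1 \<Longrightarrow> ennreal (c * real m powr (- (\<beta> + 1) - 1 / (2 * real k))) \<le> profile_sqnorm \<beta> K k m"
    using profile_sqnorm_ge[OF \<beta> k] by blast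
  define b where "b = \<beta> + 1"
  define s where "s = 1 / (2 * real k)"
  have b: "0 < b" "b \<le> 1" "b + s < 1" "s > 0"
    using \<beta> gap k by (auto simp: b_def s_def)
  \<comment> \<open>Collects the constants at degree 3N: the squared moment bound and the lower
    bound for the profile power, each with its power of 3 split off.\<close>
  define C where "C = (3 powr (-b) / 2)\<^sup>2 * (c * 3 powr (- b - s))"
  have "C > 0"
    using c by (simp add: C_def)
  have key: "C * real N powr (1 - b - s) \<le> B\<^sup>2" if N: "N \<ge> 1" for N
  proof -
    define x where "x = real N"
    have x: "x \<ge> 1"
      using N by (simp add: x_def)
    let ?f = "diagonal_test N"
    have f: "?f \<in> bergman_space \<beta>"
      by (rule diagonal_test_bergman_space[OF \<beta>(1)])
    let ?Y = "enn2real (bergman_sqnorm \<beta> (comp_op (comp_symbol ?p) ?f))"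
    let ?X = "enn2real (bergman_sqnorm \<beta> ?f)"
    have "?Y = (bergman_norm \<beta> (comp_op (comp_symbol ?p) ?f))\<^sup>2"
      by (simp add: bergman_norm_def)
    also have "\<dots> \<le> (B * bergman_norm \<beta> ?f)\<^sup>2"
      using B[OF f] by (intro power_mono) (auto simp: bergman_norm_def)
    also have "\<dots> = B\<^sup>2 * ?X"
      by (simp add: bergman_norm_def power_mult_distrib)
    also have "\<dots> \<le> B\<^sup>2 * (real (Suc N) * (?w N)\<^sup>2)"
      using enn2real_mono[OF bergman_sqnorm_diagonal_test[OF \<beta>(1), of N]]
      by (intro mult_left_mono) auto
    also have "\<dots> \<le> B\<^sup>2 * (real (Suc N) * (x powr (-b))\<^sup>2)"
    proof -
      have "?w N \<le> real (Suc N) powr (-b)"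
        using disc_moment_upper[OF \<beta>, of N] by (simp add: b_def)
      also have "\<dots> \<le> x powr (-b)"
        using b x by (intro powr_mono2') (auto simp: x_def)
      finally show ?thesis
        using disc_moment_pos[OF \<beta>(1), of N] by (intro mult_left_mono power_mono) auto
    qed
    finally have upper: "?Y \<le> B\<^sup>2 * (real (Suc N) * (x powr (-b))\<^sup>2)" .
    have w3: "(3 * x) powr (-b) / 2 \<le> ?w (3 * N)"
      using disc_moment_lower[OF \<beta>, of "3 * N"] N by (simp add: b_def x_def)
    have "ennreal ((real (Suc N) * ((3 * x) powr (-b) / 2))\<^sup>2 * (c * (3 * x) powr (- b - s)))
      \<le> ennreal ((real (Suc N) * ?w (3 * N))\<^sup>2) * profile_sqnorm \<beta> K k (3 * N)"
    proof -
      have "ennreal ((real (Suc N) * ((3 * x) powr (-b) / 2))\<^sup>2) \<le> ennreal ((real (Suc N) * ?w (3 * N))\<^sup>2)"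
        using w3 x by (intro ennreal_leI power_mono mult_left_mono) auto
      moreover have "ennreal (c * (3 * x) powr (- b - s)) \<le> profile_sqnorm \<beta> K k (3 * N)"
        using c(2)[of "3 * N"] N by (simp add: b_def s_def x_def)
      ultimately show ?thesis
        using c(1) by (subst ennreal_mult) (auto intro: mult_mono)
    qed
    also have "\<dots> = bergman_sqnorm \<beta> (comp_op (comp_symbol ?p) ?f)"
      unfolding profile_sqnorm_def
      by (rule bergman_sqnorm_comp_diagonal_test[OF \<beta>(1) profile_bound(1)[OF k], symmetric])
    \<comment> \<open>Finiteness of the right side, supplied by \<open>maps\<close>, is essential:
      \<open>enn2real\<close> sends infinity to 0.\<close>
    finally have "enn2real (ennreal ((real (Suc N) * ((3 * x) powr (-b) / 2))\<^sup>2 * (c * (3 * x) powr (- b - s)))) \<le> ?Y"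
      using maps[OF f] by (intro enn2real_mono) (auto simp: bergman_space_def)
    then have "(real (Suc N) * ((3 * x) powr (-b) / 2))\<^sup>2 * (c * (3 * x) powr (- b - s)) \<le> ?Y"
      using c(1) by simp
    also note upper
    finally have "(real (Suc N) * (x powr (-b))\<^sup>2) * (real (Suc N) * C * x powr (- b - s))
        \<le> (real (Suc N) * (x powr (-b))\<^sup>2) * B\<^sup>2"
      using x by (simp add: C_def powr_mult power_mult_distrib power_divide power2_eq_square mult_ac)
    then have "real (Suc N) * C * x powr (- b - s) \<le> B\<^sup>2"
      using x by (subst (asm) mult_le_cancel_left_pos) auto
    moreover have "x * C * x powr (- b - s) \<le> real (Suc N) * C * x powr (- b - s)"
      using \<open>C > 0\<close> by (intro mult_right_mono) (auto simp: x_def)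
    moreover have "x * x powr (- b - s) = x powr (1 - b - s)"
      using x powr_mult_base[of x "- b - s"] by (simp add: add_diff_eq)
    ultimately show ?thesis
      by (simp add: x_def[symmetric] mult_ac)
  qed
  define e where "e = 1 - b - s"
  \<comment> \<open>Chosen so that C A = B^2 + C exceeds B^2; N is then taken with N^e at least
    A.\<close>
  define A where "A = B\<^sup>2 / C + 1"
  have e: "e > 0" and A: "A > 0"
    using b \<open>C > 0\<close> by (auto simp: e_def A_def intro: add_nonneg_pos)
  obtain N where "real N \<ge> max 1 (A powr (1 / e))"
    using real_arch_simple by blast
  then have N: "N \<ge> 1" "real N \<ge> A powr (1 / e)"
    by auto
  have "A = (A powr (1 / e)) powr e"
    using e A by (simp add: powr_powr)
  also have "\<dots> \<le> real N powr e"
    using N e by (intro powr_mono2) auto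
  finally have "C * A \<le> C * real N powr e"
    using \<open>C > 0\<close> by simp
  moreover have "C * A = B\<^sup>2 + C"
    using \<open>C > 0\<close> by (simp add: A_def field_simps)
  ultimately have "C * real N powr (1 - b - s) > B\<^sup>2"
    using \<open>C > 0\<close> by (simp add: e_def)
  with key[OF N(1)] show False by simp
qed

theorem theorem1p1:
  fixes n :: nat
  assumes "n \<ge> 1"
  shows "\<exists>(\<phi> :: complex ^ 3 \<Rightarrow> complex ^ 3) (\<psi> :: complex ^ 3 \<Rightarrow> complex ^ 3) (\<beta> :: real).
    \<phi> \<in> holo_self_maps \<inter> smooth_up_to_boundary \<and>
    \<psi> \<in> holo_self_maps \<inter> smooth_up_to_boundary \<and>
    \<beta> \<in> {-1<..<0} \<and>
    contact_set \<phi> = contact_set \<psi> \<and>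
    (\<forall>\<xi>\<in>contact_set \<phi>. \<forall>\<alpha> :: nat ^ 3. (\<Sum>i\<in>UNIV. \<alpha> $ i) \<le> n \<longrightarrow>
        bdry_ext (map_partial \<alpha> \<phi>) \<xi> = bdry_ext (map_partial \<alpha> \<psi>) \<xi>) \<and>
    comp_op_continuous \<beta> \<phi> \<and>
    \<not> comp_op_continuous \<beta> \<psi>"
proof -
  \<comment> \<open>The threshold for the exponent n.\<close>
  define \<beta> where "\<beta> = - 1 / (2 * real n)"
  define \<phi> where "\<phi> = comp_symbol (profile (2 * n) n)"
  \<comment> \<open>Exponent 2n with the same \<open>K\<close> as in \<open>\<phi>\<close>: the jets
    then agree up to order 2n - 1, which is at least n.\<close>
  define \<psi> where "\<psi> = comp_symbol (profile (2 * n) (2 * n))"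
  have n: "1 \<le> n" "n \<le> 2 * n" "1 \<le> 2 * n" "2 * n \<le> 2 * n"
    using assms by auto
  have \<beta>: "-1 < \<beta>" "\<beta> < 0"
    using assms by (auto simp: \<beta>_def field_simps)
  have "\<phi> \<in> holo_self_maps \<inter> smooth_up_to_boundary" "\<psi> \<in> holo_self_maps \<inter> smooth_up_to_boundary"
    using profile_bound(1)[OF n(1,2)] profile_bound(1)[OF n(3,4)]
    by (auto simp: \<phi>_def \<psi>_def comp_symbol_smooth intro!: comp_symbol_holo_self_maps)
  moreover have "contact_set \<phi> = contact_set \<psi>"
    unfolding \<phi>_def \<psi>_def contact_set_comp_symbol[OF n(1,2)] contact_set_comp_symbol[OF n(3,4)] ..
  moreover have "bdry_ext (map_partial \<alpha> \<phi>) \<xi> = bdry_ext (map_partial \<alpha> \<psi>) \<xi>"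
    if "\<xi> \<in> contact_set \<phi>" "(\<Sum>i\<in>UNIV. \<alpha> $ i) \<le> n" for \<xi> and \<alpha> :: "nat ^ 3"
    using that n(1) unfolding \<phi>_def \<psi>_def contact_set_comp_symbol[OF n(1,2)]
    by (intro bdry_ext_map_partial_comp_symbol) auto
  moreover have "comp_op_continuous \<beta> \<phi>"
    unfolding \<phi>_def by (rule comp_op_continuous_comp_symbol[OF n(1,2) \<beta>_def])
  moreover have "\<not> comp_op_continuous \<beta> \<psi>"
  proof -
    \<comment> \<open>The left side equals 1 - 1/(4n).\<close>
    have "\<beta> + 1 + 1 / (2 * real (2 * n)) < 1"
      using assms by (simp add: \<beta>_def field_simps)
    then show ?thesis
      unfolding \<psi>_def using \<beta> by (intro not_comp_op_continuous_comp_symbol n) auto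
  qed
  ultimately show ?thesis
    using \<beta> by (intro exI[of _ \<phi>] exI[of _ \<psi>] exI[of _ \<beta>]) auto
qed

end
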